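(* Let $a,b,c\in\mathbb R$ satisfy $a=-1$, $b>-1$, $0\le 2-c+b<1$ and $c>1$. Then the following hold. (a) If $2-c+b=0$, then neither $T_{a,b,c}$ nor $S_{a,b,c}$ is of weak type or restricted weak type $(p,1)$ for any $1\le p\le\infty$. (b) Suppose $0<2-c+b<1/2$. Then: (1) $T_{a,b,c}$ and $S_{a,b,c}$ map $L^p(\mathbb D)$ boundedly into $L^{1,\infty}(\mathbb D)$ if $0\le\frac1p<2-c+b$, while both are unbounded from $L^{\frac{1}{2-c+b}}(\mathbb D)$ to $L^{1,\infty}(\mathbb D)$. (2) $T_{a,b,c}$ and $S_{a,b,c}$ map $L^{\frac{1}{2-c+b},1}(\mathbb D)$ boundedly into $L^{1,\infty}(\mathbb D)$, while both are unbounded from $L^{p,1}(\mathbb D)$ to $L^{1,\infty}(\mathbb D)$ if $2-c+b<\frac1p\le1$. (c) Suppose $1/2\le 2-c+b<1$. Then: (1) $T_{a,b,c}$ and $S_{a,b,c}$ map $L^p(\mathbb D)$ boundedly into $L^{1,\infty}(\mathbb D)$ if $0\le\frac1p<2-c+b$. (2) $T_{a,b,c}$ maps $L^{\frac{1}{2-c+b}}(\mathbb D)$ boundedly into $L^{1,\infty}(\mathbb D)$, while $S_{a,b,c}$ does not. (3) $T_{a,b,c}$ and $S_{a,b,c}$ map $L^{\frac{1}{2-c+b},1}(\mathbb D)$ boundedly into $L^{1,\infty}(\mathbb D)$, while both are unbounded from $L^{p,1}(\mathbb D)$ to $L^{1,\infty}(\mathbb D)$ if $2-c+b<\frac1p\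le1$.
   Context: $\mathbb D$ is the open unit disc in $\mathbb C$, $dA$ is normalized area measure on $\mathbb D$, and $|E|$ is the $dA$-measure of $E\subseteq\mathbb D$. For $a,b,c\in\mathbb R$, $$T_{a,b,c}f(z):=(1-|z|^2)^a\int_{\mathbb D}\frac{(1-|w|^2)^b}{(1-z\overline w)^c}f(w)\,dA(w),\qquad S_{a,b,c}f(z):=(1-|z|^2)^a\int_{\mathbb D}\frac{(1-|w|^2)^b}{|1-z\overline w|^c}f(w)\,dA(w),$$ with the principal branch of the power. $L^p(\mathbb D)=L^p(\mathbb D,dA)$, and $\|f\|_{L^{1,\infty}}=\sup_{\lambda>0}\lambda|\{|f|>\lambda\}|$. For $1\le p<\infty$, $\|f\|_{L^{p,1}}=p\int_0^\infty|\{|f|>\lambda\}|^{1/p}\,d\lambda$. An operator $\mathcal T$ maps $X$ boundedly into $Y$ if for every $f\in X$ the defining integral converges absolutely for a.e. $z$ and $\|\mathcal Tf\|_Y\le C\|f\|_X$ with $C$ independent of $f$; otherwise it is unbounded from $X$ to $Y$. $\mathcal T$ is of weak type $(p,1)$ if it is bounded from $L^p(\mathbb D)$ to $L^{1,\infty}(\mathbb D)$. For $p<\infty$, $\mathcal T$ is of restricted weak type $(p,1)$ if it is bounded from $L^{p,1}(\mathbb D)$ to $L^{1,\infty}(\mathbb D)$; restricted weak type $(\infty,1)$ means $\|\mathcal T\mathbf 1_E\|_{L^{1,\infty}}\le C$ for all measurable $E\subseteq\mathbb D$. *)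

theory Defs
  imports "HOL-Probability.Essential_Supremum"
begin

abbreviation disc :: "complex set" where
  "disc \<equiv> ball 0 1"

(* The space is the disc, so the values of functions outside it never matter. *)
definition dA :: "complex measure" where
  "dA = density (lebesgue_on disc) (\<lambda>_. ennreal (1 / pi))"

record integral_operator =
  factor :: "complex \<Rightarrow> real"
  kernel :: "complex \<Rightarrow> complex \<Rightarrow> complex"

(* 1 - z * cnj w has positive real part on the disc, away from the cut of the principal branch;
   real powr is only applied to positive bases there. *)
definition T_op :: "real \<Rightarrow> real \<Rightarrow> real \<Rightarrow> integral_operator" where
  "T_op a b c =
     \<lparr> factor = (\<lambda>z. (1 - (cmod z)\<^sup>2) powr a),
       kernel = (\<lambda>z w. complex_of_real ((1 - (cmod w)\<^sup>2) powr b)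
                       / (1 - z * cnj w) powr complex_of_real c) \<rparr>"

definition S_op :: "real \<Rightarrow> real \<Rightarrow> real \<Rightarrow> integral_operator" where
  "S_op a b c =
     \<lparr> factor = (\<lambda>z. (1 - (cmod z)\<^sup>2) powr a),
       kernel = (\<lambda>z w. complex_of_real ((1 - (cmod w)\<^sup>2) powr b / cmod (1 - z * cnj w) powr c)) \<rparr>"

definition op_converges :: "integral_operator \<Rightarrow> (complex \<Rightarrow> complex) \<Rightarrow> complex \<Rightarrow> bool" where
  "op_converges T f z \<longleftrightarrow> integrable dA (\<lambda>w. kernel T z w * f w)"

(* Only meaningful where op_converges holds: the Bochner integral is 0 otherwise. *)
definition op_apply :: "integral_operator \<Rightarrow> (complex \<Rightarrow> complex) \<Rightarrow> complex \<Rightarrow> complex" where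
  "op_apply T f z = complex_of_real (factor T z) * (\<integral>w. kernel T z w * f w \<partial>dA)"

definition enn_powr :: "ennreal \<Rightarrow> real \<Rightarrow> ennreal" where
  "enn_powr x r = (if x = \<infinity> then \<infinity> else ennreal (enn2real x powr r))"

definition Lp_norm :: "ereal \<Rightarrow> (complex \<Rightarrow> complex) \<Rightarrow> ennreal" where
  "Lp_norm p f =
     (if p = \<infinity> then esssup dA (\<lambda>z. ennreal (cmod (f z)))
      else enn_powr (\<integral>\<^sup>+z. ennreal (cmod (f z) powr real_of_ereal p) \<partial>dA) (1 / real_of_ereal p))"

definition distr_fun :: "(complex \<Rightarrow> complex) \<Rightarrow> real \<Rightarrow> real" where
  "distr_fun f t = measure dA {z \<in> disc. cmod (f z) > t}"

definition weak_L1_norm :: "(complex \<Rightarrow> complex) \<Rightarrow> ennreal" where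
  "weak_L1_norm f = (SUP t\<in>{0<..}. ennreal (t * distr_fun f t))"

definition Lorentz_p1_norm :: "real \<Rightarrow> (complex \<Rightarrow> complex) \<Rightarrow> ennreal" where
  "Lorentz_p1_norm p f = ennreal p * (\<integral>\<^sup>+t\<in>{0<..}. ennreal (distr_fun f t powr (1 / p)) \<partial>lborel)"

(* Functions themselves rather than a.e. classes; all the norms above are a.e. invariant. *)
definition fun_space :: "((complex \<Rightarrow> complex) \<Rightarrow> ennreal) \<Rightarrow> (complex \<Rightarrow> complex) set" where
  "fun_space N = {f \<in> borel_measurable dA. N f < \<infinity>}"

definition maps_boundedly ::
  "integral_operator \<Rightarrow> ((complex \<Rightarrow> complex) \<Rightarrow> ennreal) \<Rightarrow> ((complex \<Rightarrow> complex) \<Rightarrow> ennreal) \<Rightarrow> bool"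
where
  "maps_boundedly T NX NY \<longleftrightarrow>
     (\<exists>C::real. \<forall>f\<in>fun_space NX.
        (AE z in dA. op_converges T f z) \<and>
        op_apply T f \<in> fun_space NY \<and>
        NY (op_apply T f) \<le> ennreal C * NX f)"

definition weak_type_p1 :: "integral_operator \<Rightarrow> ereal \<Rightarrow> bool" where
  "weak_type_p1 T p \<longleftrightarrow> maps_boundedly T (Lp_norm p) weak_L1_norm"

(* For p = \<infinity> the test functions are indicators, without dependence on the measure of E. *)
definition restricted_weak_type_p1 :: "integral_operator \<Rightarrow> ereal \<Rightarrow> bool" where
  "restricted_weak_type_p1 T p \<longleftrightarrow>
     (if p = \<infinity> then
        \<exists>C::real. \<forall>E\<in>sets dA.
          (AE z in dA. op_converges T (indicator E) z) \<and>
          op_apply T (indicator E) \<in> borel_measurable dA \<and>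
          weak_L1_norm (op_apply T (indicator E)) \<le> ennreal C
      else maps_boundedly T (Lorentz_p1_norm (real_of_ereal p)) weak_L1_norm)"

end

theory Submission
  imports Defs "HOL-Probability.Probability"
begin

text \<open>Write \<open>\<sigma> = 2 - c + b\<close>. For \<open>z = r u\<close> with \<open>\<bar>u\<bar> = 1\<close> one has \<open>\<bar>1 - z cnj w\<bar> \<ge> \<bar>1 - u cnj w\<bar> / 2\<close>, so the integral
  in \<open>S f (z)\<close> is at most a function of \<open>u\<close> alone, whose mean over the circle is bounded by
  \<open>\<integral> (1 - \<bar>w\<bar>\<^sup>2) powr (\<sigma> - 1) \<bar>f w\<bar>\<close>; since \<open>1 / (1 - \<bar>z\<bar>\<^sup>2)\<close> has uniformly distributed reciprocal, this gives a
  bound in weak \<open>L\<^sup>1\<close>, and with it every positive statement except the one for \<open>T\<close> at \<open>1/p = \<sigma> \<ge> 1/2\<close>.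
  For the latter, \<open>f\<close> is cut at the level \<open>\<bar>f\<bar> (1 - \<bar>w\<bar>\<^sup>2) powr \<sigma> = \<parallel>f\<parallel>\<^sub>p\<close>: because \<open>p \<le> 2\<close>, the large part is covered by the
  weighted \<open>L\<^sup>1\<close> bound and the small part by a weighted \<open>L\<^sup>2\<close> bound, which comes from orthogonality of the
  monomials in the power series of \<open>T f\<close>.

  All counterexamples are sums of the blocks \<open>1\<^sub>A\<^sub>k sgn w ^ n\<^sub>k\<close> over the annuli \<open>A\<^sub>k\<close> where \<open>1 - \<bar>w\<bar>\<^sup>2\<close> is about \<open>1 / n\<^sub>k\<close>,
  \<open>n\<^sub>k\<close> a power of 4. \<open>T\<close> maps such a block to a multiple, of size about \<open>n\<^sub>k powr (- \<sigma>)\<close>, of \<open>z ^ n\<^sub>k / (1 - \<bar>z\<bar>\<^sup>2)\<close>.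
  The weak norm of \<open>P / (1 - \<bar>z\<bar>\<^sup>2)\<close> dominates the mean of \<open>\<bar>P\<bar>\<close> over the circle, and pairing with a Riesz
  product shows that this mean is of order \<open>\<surd>N\<close> for a lacunary sum of \<open>N\<close> terms of size 1.\<close>

section \<open>Area measure on the disc and rotation invariance\<close>

text \<open>The value a = -1 is borderline: 1 / (1 - |z|^2) lies in weak L^1 but not in L^1, so
  nothing can be gained by integrating over the disc, and the estimates have to live on circles. The
  two operators part at the endpoint 1/p = \<sigma> because the modulus of the kernel destroys the
  cancellation between the scales of 1 - |w|^2. With N blocks normalised in L^p the source norm is
  at most N^\<sigma>. Without phases the N contributions add up to order N, with phases they keep at
  least order \<surd>N. Comparison with N^\<sigma> shows why S fails for all 0 < \<sigma> < 1 and
  why the same test functions defeat T only for \<sigma> < 1/2; from 1/2 on one has p = 1/\<sigma>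
  \<le> 2, which is what the splitting into an L^1 and an L^2 part requires. Failure of T entails
  failure of S, since S applied to |f| dominates |T f| and the source norms see only |f|. At
  \<sigma> = 0 the restricted type with p = \<infinity> admits indicators only, while the blocks
  oscillate; bridging this gap is the purpose of the duality argument near the end.\<close>

lemma disc_borel [measurable]: "disc \<in> sets borel"
  by simp

lemma nn_integral_lborel_translation:
  fixes f :: "complex \<Rightarrow> ennreal"
  assumes [measurable]: "f \<in> borel_measurable borel"
  shows "(\<integral>\<^sup>+x. f (c + x) \<partial>lborel) = (\<integral>\<^sup>+x. f x \<partial>lborel)"
proof -
  have "(\<integral>\<^sup>+x. f x \<partial>lborel) = (\<integral>\<^sup>+x. f x \<partial>distr lborel borel ((+) c))"
    by (simp add: lborel_distr_plus)
  also have "\<dots> = (\<integral>\<^sup>+x. f (c + x) \<partial>lborel)"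
    by (subst nn_integral_distr) auto
  finally show ?thesis by simp
qed

text \<open>Uniqueness of Haar measure by hand. Integrate \<open>g y * f (y + u * x)\<close> over
  both variables, with \<open>g\<close> the indicator of the disc. Translation invariance turns one
  order of integration into the left side times the area \<open>V\<close>; in the other order the
  points x with \<open>cmod (y - u * x) < 1\<close> fill a disc of the same area.\<close>

lemma nn_integral_lborel_rotation:
  fixes f :: "complex \<Rightarrow> ennreal"
  assumes f[measurable]: "f \<in> borel_measurable borel" and u: "cmod u = 1"
  shows "(\<integral>\<^sup>+x. f (u * x) \<partial>lborel) = (\<integral>\<^sup>+x. f x \<partial>lborel)"
proof -
  define g :: "complex \<Rightarrow> ennreal" where "g = indicator disc"
  have g[measurable]: "g \<in> borel_measurable borel" unfolding g_def by measurable
  define V where "V = emeasure lborel disc"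
  have V: "V \<noteq> 0" "V \<noteq> \<infinity>"
    unfolding V_def using emeasure_lborel_ball_finite[of "0::complex" 1]
    by (auto simp: emeasure_ball unit_ball_vol_2)
  have gV: "(\<integral>\<^sup>+y. g y \<partial>lborel) = V" by (simp add: g_def V_def)
  have uu: "u * cnj u = 1" using complex_norm_square[of u] u by simp
  have "(\<integral>\<^sup>+x. f (u * x) \<partial>lborel) * V = (\<integral>\<^sup>+y. g y * (\<integral>\<^sup>+x. f (u * x) \<partial>lborel) \<partial>lborel)"
    by (simp add: nn_integral_multc gV mult.commute)
  \<comment> \<open>Translating x by \<open>cnj u * y\<close> becomes a translation by y after the
    rotation, because \<open>u * cnj u = 1\<close>.\<close>
  also have "\<dots> = (\<integral>\<^sup>+y. g y * (\<integral>\<^sup>+x. f (u * (cnj u * y + x)) \<partial>lborel) \<partial>lborel)"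
    by (subst nn_integral_lborel_translation) auto
  also have "\<dots> = (\<integral>\<^sup>+y. (\<integral>\<^sup>+x. g y * f (y + u * x) \<partial>lborel) \<partial>lborel)"
    using uu by (subst nn_integral_cmult) (auto simp: ring_distribs mult.assoc[symmetric])
  also have "\<dots> = (\<integral>\<^sup>+x. (\<integral>\<^sup>+y. g y * f (y + u * x) \<partial>lborel) \<partial>lborel)"
    by (subst lborel_pair.Fubini') auto
  also have "\<dots> = (\<integral>\<^sup>+x. (\<integral>\<^sup>+y. g (y - u * x) * f y \<partial>lborel) \<partial>lborel)"
  proof (rule nn_integral_cong)
    fix x :: complex
    show "(\<integral>\<^sup>+y. g y * f (y + u * x) \<partial>lborel) = (\<integral>\<^sup>+y. g (y - u * x) * f y \<partial>lborel)"
      using nn_integral_lborel_translation[of "\<lambda>y. g (y - u * x) * f y" "u * x"]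
      by (simp add: add.commute)
  qed
  also have "\<dots> = (\<integral>\<^sup>+y. (\<integral>\<^sup>+x. g (y - u * x) * f y \<partial>lborel) \<partial>lborel)"
    by (subst lborel_pair.Fubini') auto
  also have "\<dots> = (\<integral>\<^sup>+y. V * f y \<partial>lborel)"
  proof (rule nn_integral_cong)
    fix y :: complex
    have [measurable]: "ball (cnj u * y) 1 \<in> sets borel" by simp
    have "g (y - u * x) = indicator (ball (cnj u * y) 1) x" for x
    proof -
      have "cmod (y - u * x) = cmod (u * (cnj u * y - x))"
        using uu by (simp add: ring_distribs mult.assoc[symmetric])
      also have "\<dots> = cmod (cnj u * y - x)" using u by (simp add: norm_mult)
      finally show ?thesis by (simp add: g_def indicator_def dist_norm norm_minus_commute)
    qed
    then show "(\<integral>\<^sup>+x. g (y - u * x) * f y \<partial>lborel) = V * f y"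
      by (subst nn_integral_multc) (auto simp: V_def emeasure_ball)
  qed
  also have "\<dots> = (\<integral>\<^sup>+x. f x \<partial>lborel) * V"
    by (simp add: nn_integral_cmult mult.commute)
  finally show ?thesis
    using V by (auto simp: mult.commute[of _ V] ennreal_mult_cancel_left)
qed

lemma space_dA [simp]: "space dA = disc"
  by (simp add: dA_def space_restrict_space)

text \<open>\<open>dA\<close> lives on the Lebesgue sets of the disc; through this rule every Borel
  function becomes \<open>dA\<close>-measurable by composition.\<close>

lemma measurable_ident_dA [measurable]: "(\<lambda>x. x) \<in> borel_measurable dA"
proof -
  have "(\<lambda>x. x) \<in> borel_measurable (lebesgue_on disc)"
    by (intro measurable_restrict_space1 measurable_completion) auto
  then show ?thesis by (simp add: dA_def)
qed

lemma disc_sets_dA: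
  assumes [measurable]: "P \<in> measurable borel (count_space UNIV)"
  shows "{z \<in> disc. P z} \<in> sets dA"
proof -
  have "{z \<in> space dA. P z} \<in> sets dA" by measurable
  then show ?thesis by simp
qed

lemma nn_integral_dA:
  assumes [measurable]: "f \<in> borel_measurable borel"
  shows "(\<integral>\<^sup>+z. f z \<partial>dA) = ennreal (1 / pi) * (\<integral>\<^sup>+z\<in>disc. f z \<partial>lborel)"
proof -
  have m: "f \<in> borel_measurable (lebesgue_on disc)"
    by (intro measurable_restrict_space1 measurable_completion) auto
  have "(\<integral>\<^sup>+z. f z \<partial>dA) = (\<integral>\<^sup>+z. ennreal (1 / pi) * f z \<partial>lebesgue_on disc)"
    unfolding dA_def using m by (subst nn_integral_density) auto
  also have "\<dots> = ennreal (1 / pi) * (\<integral>\<^sup>+z. f z \<partial>lebesgue_on disc)"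
    using m by (rule nn_integral_cmult)
  also have "(\<integral>\<^sup>+z. f z \<partial>lebesgue_on disc) = (\<integral>\<^sup>+z\<in>disc. f z \<partial>lebesgue)"
    by (rule nn_integral_restrict_space) simp
  also have "\<dots> = (\<integral>\<^sup>+z\<in>disc. f z \<partial>lborel)"
    by (rule nn_integral_completion)
  finally show ?thesis .
qed

lemma emeasure_dA:
  assumes [measurable]: "A \<in> sets borel"
  shows "emeasure dA (A \<inter> disc) = ennreal (1 / pi) * emeasure lborel (A \<inter> disc)"
proof -
  have s: "A \<inter> disc \<in> sets dA"
    using disc_sets_dA[of "\<lambda>z. z \<in> A"] by (auto simp: Int_def conj_commute)
  have "emeasure dA (A \<inter> disc) = (\<integral>\<^sup>+z. indicator (A \<inter> disc) z \<partial>dA)"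
    using s by simp
  also have "\<dots> = ennreal (1 / pi) * (\<integral>\<^sup>+z\<in>disc. indicator (A \<inter> disc) z \<partial>lborel)"
    by (rule nn_integral_dA) auto
  also have "(\<integral>\<^sup>+z\<in>disc. indicator (A \<inter> disc) z \<partial>lborel) = (\<integral>\<^sup>+z. indicator (A \<inter> disc) z \<partial>lborel)"
    by (intro nn_integral_cong) (auto simp: indicator_def)
  finally show ?thesis by simp
qed

lemma emeasure_dA_ball:
  assumes "0 \<le> r" "r \<le> 1"
  shows "emeasure dA (ball 0 r) = ennreal (r\<^sup>2)"
proof -
  have "ball 0 r \<inter> disc = (ball 0 r :: complex set)" using assms by auto
  then have "emeasure dA (ball 0 r) = ennreal (1 / pi) * emeasure lborel (ball (0::complex) r)"
    using emeasure_dA[of "ball 0 r"] by simp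
  also have "\<dots> = ennreal (r\<^sup>2)"
    using assms by (simp add: emeasure_ball unit_ball_vol_2 ennreal_mult[symmetric])
  finally show ?thesis .
qed

interpretation dA: prob_space dA
proof
  show "emeasure dA (space dA) = 1"
    using emeasure_dA_ball[of 1] by simp
qed

lemma nn_integral_dA_rotation:
  fixes f :: "complex \<Rightarrow> ennreal"
  assumes [measurable]: "f \<in> borel_measurable borel" and u: "cmod u = 1"
  shows "(\<integral>\<^sup>+x. f (u * x) \<partial>dA) = (\<integral>\<^sup>+x. f x \<partial>dA)"
proof -
  have "(\<integral>\<^sup>+x. f (u * x) \<partial>dA) = ennreal (1 / pi) * (\<integral>\<^sup>+x. f (u * x) * indicator disc (u * x) \<partial>lborel)"
    using u by (subst nn_integral_dA) (auto simp: indicator_def norm_mult)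
  also have "\<dots> = (\<integral>\<^sup>+x. f x \<partial>dA)"
    using u by (subst nn_integral_lborel_rotation[of "\<lambda>x. f x * indicator disc x"]) (auto simp: nn_integral_dA)
  finally show ?thesis .
qed

text \<open>Stated for image measures so that the invariance passes to Bochner integrals as
  well.\<close>

lemma distr_dA_rotation:
  assumes u: "cmod u = 1"
  shows "distr dA borel (\<lambda>z. u * z) = distr dA borel (\<lambda>z. z)"
proof (rule measure_eqI)
  fix A assume "A \<in> sets (distr dA borel (\<lambda>z. u * z))"
  then have [measurable]: "A \<in> sets borel" by simp
  have "emeasure (distr dA borel (\<lambda>z. u * z)) A = (\<integral>\<^sup>+x. indicator A x \<partial>distr dA borel (\<lambda>z. u * z))"
    by simp
  also have "\<dots> = (\<integral>\<^sup>+x. indicator A (u * x) \<partial>dA)"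
    by (subst nn_integral_distr) auto
  also have "\<dots> = (\<integral>\<^sup>+x. indicator A x \<partial>dA)"
    using u by (subst nn_integral_dA_rotation) auto
  also have "\<dots> = (\<integral>\<^sup>+x. indicator A x \<partial>distr dA borel (\<lambda>z. z))"
    by (subst nn_integral_distr) auto
  finally show "emeasure (distr dA borel (\<lambda>z. u * z)) A = emeasure (distr dA borel (\<lambda>z. z)) A" by simp
qed simp

lemma integral_dA_rotation:
  fixes f :: "complex \<Rightarrow> complex"
  assumes [measurable]: "f \<in> borel_measurable borel" and u: "cmod u = 1"
  shows "(\<integral>x. f (u * x) \<partial>dA) = (\<integral>x. f x \<partial>dA)"
proof -
  have "(\<integral>x. f (u * x) \<partial>dA) = (\<integral>x. f x \<partial>distr dA borel (\<lambda>z. u * z))"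
    by (subst integral_distr) auto
  also have "\<dots> = (\<integral>x. f x \<partial>dA)"
    unfolding distr_dA_rotation[OF u] by (subst integral_distr) auto
  finally show ?thesis .
qed

lemma AE_dA_nonzero: "AE z in dA. z \<noteq> 0"
proof (rule AE_I')
  have "{0::complex} \<inter> disc = {0}" by auto
  then have "emeasure dA {0} = 0"
    using emeasure_dA[of "{0}"] by simp
  moreover have "{0} \<in> sets dA"
    using disc_sets_dA[of "\<lambda>z. z = 0"] by (simp add: conj_commute Collect_conv_if)
  ultimately show "{0} \<in> null_sets dA" by auto
qed auto

lemma borel_measurable_sgn_complex [measurable]: "(sgn :: complex \<Rightarrow> complex) \<in> borel_measurable borel"
  unfolding sgn_div_norm[abs_def] by measurable

text \<open>Averaging over rotations makes \<open>sgn z\<close> and \<open>\<bar>z\<bar>\<close> independent; this replaces polar coordinates,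
  and the law of \<open>sgn\<close> under the area measure serves as arc length on the circle.\<close>

lemma nn_integral_dA_polar:
  fixes F :: "complex \<Rightarrow> real \<Rightarrow> ennreal"
  assumes [measurable]: "case_prod F \<in> borel_measurable (borel \<Otimes>\<^sub>M borel)"
  shows "(\<integral>\<^sup>+z. F (sgn z) (cmod z) \<partial>dA) = (\<integral>\<^sup>+z. \<integral>\<^sup>+v. F (sgn v) (cmod z) \<partial>dA \<partial>dA)"
proof -
  interpret pair_sigma_finite dA dA ..
  \<comment> \<open>An idle average over v is inserted, \<open>dA\<close> having total mass 1; v
    then supplies the rotation.\<close>
  have "(\<integral>\<^sup>+z. F (sgn z) (cmod z) \<partial>dA) = (\<integral>\<^sup>+v. \<integral>\<^sup>+z. F (sgn z) (cmod z) \<partial>dA \<partial>dA)"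
    by (simp add: dA.emeasure_space_1[simplified])
  also have "\<dots> = (\<integral>\<^sup>+v. \<integral>\<^sup>+z. F (sgn v * sgn z) (cmod z) \<partial>dA \<partial>dA)"
  proof (rule nn_integral_cong_AE, use AE_dA_nonzero in eventually_elim)
    fix v :: complex assume "v \<noteq> 0"
    then have u: "cmod (sgn v) = 1" by (simp add: norm_sgn)
    have "(\<integral>\<^sup>+z. F (sgn z) (cmod z) \<partial>dA) = (\<integral>\<^sup>+z. F (sgn (sgn v * z)) (cmod (sgn v * z)) \<partial>dA)"
      using u by (subst nn_integral_dA_rotation) auto
    then show "(\<integral>\<^sup>+z. F (sgn z) (cmod z) \<partial>dA) = (\<integral>\<^sup>+z. F (sgn v * sgn z) (cmod z) \<partial>dA)"
      using u by (simp add: norm_mult sgn_mult)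
  qed
  also have "\<dots> = (\<integral>\<^sup>+z. \<integral>\<^sup>+v. F (sgn v * sgn z) (cmod z) \<partial>dA \<partial>dA)"
    by (subst Fubini') auto
  also have "\<dots> = (\<integral>\<^sup>+z. \<integral>\<^sup>+v. F (sgn v) (cmod z) \<partial>dA \<partial>dA)"
  proof (rule nn_integral_cong_AE, use AE_dA_nonzero in eventually_elim)
    fix z :: complex assume "z \<noteq> 0"
    then have u: "cmod (sgn z) = 1" by (simp add: norm_sgn)
    have "(\<integral>\<^sup>+v. F (sgn v) (cmod z) \<partial>dA) = (\<integral>\<^sup>+v. F (sgn (sgn z * v)) (cmod z) \<partial>dA)"
      using u by (subst nn_integral_dA_rotation[of "\<lambda>v. F (sgn v) (cmod z)"]) auto
    then show "(\<integral>\<^sup>+v. F (sgn v * sgn z) (cmod z) \<partial>dA) = (\<integral>\<^sup>+v. F (sgn v) (cmod z) \<partial>dA)"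
      using u by (simp add: sgn_mult mult.commute)
  qed
  finally show ?thesis .
qed

section \<open>The radial variable and its distribution\<close>

definition wt :: "complex \<Rightarrow> real" where "wt z = 1 - (cmod z)\<^sup>2"

lemma wt_measurable [measurable]: "wt \<in> borel_measurable borel"
  unfolding wt_def[abs_def] by measurable

lemma wt_pos: "z \<in> disc \<Longrightarrow> 0 < wt z"
  by (simp add: wt_def abs_square_less_1)

lemma wt_le_1: "wt z \<le> 1"
  by (simp add: wt_def)

lemma emeasure_dA_wt_le:
  assumes "0 \<le> x" "x \<le> 1"
  shows "emeasure dA {z \<in> disc. wt z \<le> x} = ennreal x"
proof -
  have "{z \<in> disc. wt z \<le> x} = space dA - ball 0 (sqrt (1 - x))"
  proof (intro set_eqI iffI)
    fix z assume "z \<in> {z \<in> disc. wt z \<le> x}"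
    then show "z \<in> space dA - ball 0 (sqrt (1 - x))"
      by (auto simp: wt_def not_less intro: real_le_lsqrt)
  next
    fix z assume z: "z \<in> space dA - ball 0 (sqrt (1 - x))"
    then have "sqrt (1 - x) \<le> cmod z" by auto
    then have "(sqrt (1 - x))\<^sup>2 \<le> (cmod z)\<^sup>2" using assms by (intro power_mono) auto
    then show "z \<in> {z \<in> disc. wt z \<le> x}"
      using z assms by (auto simp: wt_def)
  qed
  moreover have "emeasure dA (space dA - ball 0 (sqrt (1 - x))) = ennreal x"
  proof -
    have "ball 0 (sqrt (1 - x)) \<in> sets dA"
    proof -
      have "ball 0 (sqrt (1 - x)) = {z \<in> disc. cmod z < sqrt (1 - x)}"
        using assms by (auto intro: less_le_trans)
      then show ?thesis using disc_sets_dA[of "\<lambda>z. cmod z < sqrt (1 - x)"] by simp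
    qed
    then show ?thesis
      using assms dA.emeasure_space_1 by (subst emeasure_compl)
        (auto simp: emeasure_dA_ball ennreal_minus simp flip: ennreal_1)
  qed
  ultimately show ?thesis by simp
qed

text \<open>Area grows linearly in the squared radius, so \<open>wt\<close> is uniform on [0,1] and
  radial integrals become one-dimensional without a Jacobian.\<close>

lemma distr_dA_wt: "distr dA lborel wt = density lborel (indicator {0..1})"
proof -
  have "distributed dA lborel wt (\<lambda>x. indicator {0..1} x / measure lborel {0..1::real})"
  proof (rule dA.uniform_distrI_borel_atLeastAtMost)
    fix t :: real assume t: "0 \<le> t" "t \<le> 1"
    have "{x \<in> space dA. wt x \<le> t} = {z \<in> disc. wt z \<le> t}" by simp
    with emeasure_dA_wt_le[OF t] t show "dA.prob {x \<in> space dA. wt x \<le> t} = (t - 0) / (1 - 0)"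
      by (simp add: measure_def)
  qed auto
  then show ?thesis
    by (simp add: distributed_def ennreal_indicator)
qed

lemma nn_integral_dA_radial:
  fixes \<phi> :: "real \<Rightarrow> ennreal"
  assumes [measurable]: "\<phi> \<in> borel_measurable borel"
  shows "(\<integral>\<^sup>+z. \<phi> (wt z) \<partial>dA) = (\<integral>\<^sup>+x\<in>{0..1}. \<phi> x \<partial>lborel)"
proof -
  have "(\<integral>\<^sup>+z. \<phi> (wt z) \<partial>dA) = (\<integral>\<^sup>+x. \<phi> x \<partial>distr dA lborel wt)"
    by (subst nn_integral_distr) auto
  also have "\<dots> = (\<integral>\<^sup>+x\<in>{0..1}. \<phi> x \<partial>lborel)"
    unfolding distr_dA_wt by (subst nn_integral_density) (auto simp: mult.commute)
  finally show ?thesis .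
qed

section \<open>Binomial series of the kernel and Parseval's identity on the circle\<close>

text \<open>\<open>Ln\<close> jumps across the negative axis: continuity serves off the cut, an
  explicit formula on it. With measurability on the whole plane the kernel is Borel without side
  conditions on its arguments.\<close>

lemma borel_measurable_Ln [measurable]: "(Ln :: complex \<Rightarrow> complex) \<in> borel_measurable borel"
proof -
  have [measurable]: "(\<real>\<^sub>\<le>\<^sub>0 :: complex set) \<in> sets borel"
    by (simp add: closed_nonpos_Reals_complex)
  have *: "(\<lambda>z. indicator (- \<real>\<^sub>\<le>\<^sub>0) z *\<^sub>R Ln z) \<in> borel_measurable borel"
    by (rule borel_measurable_continuous_on_indicator) (auto intro!: continuous_intros)
  have "Ln = (\<lambda>z. if z \<in> \<real>\<^sub>\<le>\<^sub>0 then (if z = 0 then Ln 0 else of_real (ln (cmod z)) + \<i> * pi)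
      else indicator (- \<real>\<^sub>\<le>\<^sub>0) z *\<^sub>R Ln z)"
  proof
    fix z :: complex
    show "Ln z = (if z \<in> \<real>\<^sub>\<le>\<^sub>0 then (if z = 0 then Ln 0 else of_real (ln (cmod z)) + \<i> * pi)
      else indicator (- \<real>\<^sub>\<le>\<^sub>0) z *\<^sub>R Ln z)"
    proof (cases "z \<in> \<real>\<^sub>\<le>\<^sub>0 \<and> z \<noteq> 0")
      case True
      then obtain x where x: "z = of_real x" "x < 0"
        by (auto elim!: nonpos_Reals_cases simp: less_le)
      then have "Ln z = Ln (- of_real (-x))" by simp
      also have "\<dots> = Ln (of_real (-x)) + \<i> * pi"
        using x by (subst Ln_minus) auto
      also have "Ln (complex_of_real (-x)) = of_real (ln (-x))"
        using x by (intro Ln_of_real) auto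
      finally show ?thesis using x True by simp
    qed auto
  qed
  also have "\<dots> \<in> borel_measurable borel" using * by measurable
  finally show ?thesis .
qed

lemma borel_measurable_cnj [measurable]: "cnj \<in> borel_measurable borel"
  by (intro borel_measurable_continuous_onI continuous_intros)

lemma kernel_T_measurable [measurable (raw)]:
  assumes [measurable]: "f \<in> borel_measurable M" "g \<in> borel_measurable M"
  shows "(\<lambda>x. kernel (T_op a b c) (f x) (g x)) \<in> borel_measurable M"
  unfolding T_op_def powr_def by simp measurable

text \<open>The exponent is real, so the phase of the base does not enter the modulus of the complex
  power.\<close>

lemma kernel_S: "kernel (S_op a b c) z w = of_real (cmod (kernel (T_op a b c) z w))"
  by (simp add: S_op_def T_op_def norm_divide norm_powr_real_powr')

lemma kernel_S_measurable [measurable (raw)]: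
  assumes [measurable]: "f \<in> borel_measurable M" "g \<in> borel_measurable M"
  shows "(\<lambda>x. kernel (S_op a b c) (f x) (g x)) \<in> borel_measurable M"
  unfolding kernel_S by measurable

text \<open>The Taylor coefficients of \<open>(1 - x) powr (- c)\<close>; in the
  \<open>pochhammer\<close> form their positivity for c > 0 is visible.\<close>

definition binom_coeff :: "real \<Rightarrow> nat \<Rightarrow> real" where "binom_coeff c n = pochhammer c n / fact n"

lemma binom_coeff_sums:
  fixes x :: complex
  assumes "cmod x < 1"
  shows "(\<lambda>n. of_real (binom_coeff c n) * x ^ n) sums ((1 - x) powr (- of_real c))"
proof -
  have "(\<lambda>n. ((- of_real c) gchoose n) * (- x) ^ n) sums ((1 + (- x)) powr (- of_real c))"
    using assms by (intro gen_binomial_complex) auto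
  moreover have "((- of_real c) gchoose n) * (- x) ^ n = of_real (binom_coeff c n) * x ^ n" for n
  proof -
    have "((- of_real c) gchoose n) * (- x) ^ n
       = ((-1) ^ n * (-1) ^ n) * (pochhammer (of_real c) n / fact n) * x ^ n"
      by (subst gbinomial_pochhammer) (simp add: power_minus[of x])
    also have "(-1 :: complex) ^ n * (-1) ^ n = 1" by (simp flip: power_mult_distrib)
    finally show ?thesis by (simp add: binom_coeff_def pochhammer_of_real)
  qed
  ultimately show ?thesis by simp
qed

lemma binom_coeff_pos: "0 < c \<Longrightarrow> 0 < binom_coeff c n"
  by (simp add: binom_coeff_def pochhammer_pos)

lemma binom_coeff_sums_real:
  fixes x :: real
  assumes "\<bar>x\<bar> < 1"
  shows "(\<lambda>n. binom_coeff c n * x ^ n) sums ((1 - x) powr (- c))"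
proof -
  have "(\<lambda>n. of_real (binom_coeff c n * x ^ n) :: complex) sums ((1 - of_real x) powr (- of_real c))"
    using binom_coeff_sums[of "of_real x" c] assms by simp
  also have "(1 - complex_of_real x) powr (- of_real c) = of_real ((1 - x) powr (- c))"
    using assms powr_of_real[of "1 - x" "- c"] by simp
  finally show ?thesis by (simp only: sums_of_real_iff)
qed

lemma binom_coeff_abs_summable:
  fixes x :: complex
  assumes "0 < c" "cmod x < 1"
  shows "summable (\<lambda>n. cmod (of_real (binom_coeff c n) * x ^ n))"
  using binom_coeff_sums_real[of "cmod x" c] assms binom_coeff_pos[of c]
  by (auto simp: norm_mult norm_power sums_iff less_imp_le)

section \<open>Size of the binomial coefficients from the Gamma function\<close>

lemma binom_coeff_Gamma: "0 < c \<Longrightarrow> binom_coeff c n = Gamma (c + n) / (Gamma c * fact n)"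
  using Gamma_real_pos[of c] by (subst binom_coeff_def, subst pochhammer_Gamma) auto

text \<open>Log-convexity of Gamma at a midpoint. It stands in for Stirling asymptotics below and
  gives constants uniform in n.\<close>

lemma Gamma_midpoint_le:
  fixes x y :: real
  assumes "0 < x" "0 < y"
  shows "(Gamma ((x + y) / 2))\<^sup>2 \<le> Gamma x * Gamma y"
proof -
  have "(ln \<circ> Gamma) ((1 - 1/2) *\<^sub>R x + (1/2) *\<^sub>R y) \<le> (1 - 1/2) * (ln \<circ> Gamma) x + (1/2) * (ln \<circ> Gamma) y"
    using assms by (intro convex_onD[OF log_convex_Gamma_real]) auto
  then have "2 * ln (Gamma ((x + y) / 2)) \<le> ln (Gamma x) + ln (Gamma y)"
    by (simp add: field_simps)
  moreover have "0 < Gamma x" "0 < Gamma y" "0 < Gamma ((x + y) / 2)"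
    using assms by (auto intro!: Gamma_real_pos)
  ultimately have "ln ((Gamma ((x + y) / 2))\<^sup>2) \<le> ln (Gamma x * Gamma y)"
    by (simp add: ln_mult_pos ln_realpow)
  with \<open>0 < Gamma x\<close> \<open>0 < Gamma y\<close> \<open>0 < Gamma ((x + y) / 2)\<close> show ?thesis
    by (subst (asm) ln_le_cancel_iff) auto
qed

text \<open>Both sides are of order n^(c - 2). The point c/2 + n is the midpoint of n + 1 and c - 1
  + n, so log-convexity applies directly.\<close>

lemma binom_coeff_half_square_le:
  assumes "1 < c"
  shows "(binom_coeff (c / 2) n)\<^sup>2 \<le> Gamma (c - 1) / (Gamma (c / 2))\<^sup>2 * binom_coeff (c - 1) n"
proof -
  have "((real n + 1) + (c - 1 + n)) / 2 = c / 2 + n" by (simp add: field_simps)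
  with assms have "(Gamma (c / 2 + n))\<^sup>2 \<le> Gamma (real n + 1) * Gamma (c - 1 + n)"
    using Gamma_midpoint_le[of "real n + 1" "c - 1 + n"] by (simp only:)
  then have "(Gamma (c / 2 + n))\<^sup>2 / ((Gamma (c / 2))\<^sup>2 * (fact n)\<^sup>2)
      \<le> fact n * Gamma (c - 1 + n) / ((Gamma (c / 2))\<^sup>2 * (fact n)\<^sup>2)"
    by (intro divide_right_mono) (auto simp: Gamma_fact add.commute)
  also have "\<dots> = Gamma (c - 1) / (Gamma (c / 2))\<^sup>2 * binom_coeff (c - 1) n"
  proof -
    define G where "G = Gamma (c - 1)"
    have "G > 0" unfolding G_def using assms by (intro Gamma_real_pos) auto
    then show ?thesis using assms unfolding binom_coeff_Gamma[of "c - 1", simplified, OF assms] G_def[symmetric]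
      by (simp add: power2_eq_square)
  qed
  finally show ?thesis using assms
    by (simp add: binom_coeff_Gamma power_divide power_mult_distrib)
qed

text \<open>\<open>Beta (2 * c - 2) (n + 1)\<close> is the squared norm of the n-th monomial for the
  weight \<open>wt powr (2 * c - 3)\<close>; it decays exactly as fast as the squared coefficient
  grows. Here c + n is the midpoint of n + 1 and 2 c - 2 + (n + 1).\<close>

lemma binom_coeff_square_Beta_le:
  assumes "1 < c"
  shows "(binom_coeff c n)\<^sup>2 * Beta (2 * c - 2) (n + 1) \<le> Gamma (2 * c - 2) / (Gamma c)\<^sup>2"
proof -
  have "((real n + 1) + (2 * c - 2 + (n + 1))) / 2 = c + n" by (simp add: field_simps)
  then have "(Gamma (c + n))\<^sup>2 \<le> Gamma (real n + 1) * Gamma (2 * c - 2 + (n + 1))"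
    using Gamma_midpoint_le[of "real n + 1" "2 * c - 2 + (n + 1)"] assms by (simp only:)
  then have *: "(Gamma (c + n))\<^sup>2 \<le> fact n * Gamma (2 * c - 2 + (n + 1))"
    by (simp add: Gamma_fact add.commute)
  define G where "G = Gamma (2 * c - 2 + (n + 1))"
  have G: "G > 0" unfolding G_def using assms by (intro Gamma_real_pos) auto
  have "(binom_coeff c n)\<^sup>2 * Beta (2 * c - 2) (n + 1) =
     (Gamma (c + n))\<^sup>2 / (fact n * G) * (Gamma (2 * c - 2) / (Gamma c)\<^sup>2)"
    using assms by (simp add: binom_coeff_Gamma Beta_def G_def Gamma_fact[symmetric] power_divide power2_eq_square add.commute mult_ac)
  also have "\<dots> \<le> 1 * (Gamma (2 * c - 2) / (Gamma c)\<^sup>2)"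
    using * G assms unfolding G_def[symmetric]
    by (intro mult_right_mono) (auto simp: divide_le_eq)
  finally show ?thesis by simp
qed

text \<open>The approximants \<open>Gamma_series' c n\<close> converge, hence are bounded, and their
  product with the coefficient is exactly \<open>n powr (c - 1)\<close>.\<close>

lemma binom_coeff_lower:
  assumes "0 < c"
  obtains c0 where "0 < c0" "\<And>n. 1 \<le> n \<Longrightarrow> c0 * real n powr (c - 1) \<le> binom_coeff c n"
proof -
  have "Bseq (Gamma_series' c)"
    using Gamma_series'_LIMSEQ[of c] convergent_imp_Bseq convergent_def by blast
  then obtain K where K: "0 < K" "\<And>n. norm (Gamma_series' c n) \<le> K"
    by (auto simp: Bseq_def)
  have "1 / K * real n powr (c - 1) \<le> binom_coeff c n" if n: "1 \<le> n" for n
  proof -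
    have "Gamma_series' c n * binom_coeff c n = real n powr (c - 1)"
    proof -
      have "pochhammer c n > 0" using assms by (rule pochhammer_pos)
      moreover have "fact n = real n * fact (n - 1)" using n by (simp add: fact_reduce)
      ultimately show ?thesis using n
        by (simp add: Gamma_series'_def binom_coeff_def powr_def exp_diff left_diff_distrib)
    qed
    moreover have "Gamma_series' c n * binom_coeff c n \<le> K * binom_coeff c n"
      using K(2)[of n] binom_coeff_pos[OF assms, of n] by (intro mult_right_mono) auto
    ultimately show ?thesis using K(1) by (simp add: field_simps)
  qed
  with K(1) show ?thesis by (intro that[of "1 / K"]) auto
qed

lemma kernel_T_sums:
  assumes "cmod z \<le> 1" "w \<in> disc"
  shows "(\<lambda>n. of_real (wt w powr b) * (of_real (binom_coeff c n) * (z * cnj w) ^ n)) sums kernel (T_op a b c) z w"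
proof -
  have "cmod (z * cnj w) \<le> 1 * cmod w"
    unfolding norm_mult complex_mod_cnj using assms by (intro mult_right_mono) auto
  then have "cmod (z * cnj w) < 1" using assms by auto
  from sums_mult[OF binom_coeff_sums[OF this, of c], of "of_real (wt w powr b)"] show ?thesis
    by (simp add: T_op_def wt_def powr_minus divide_inverse)
qed

section \<open>Orthogonality and Parseval's identity for powers of \<open>sgn\<close>\<close>

lemma integrable_dA_bounded:
  fixes f :: "complex \<Rightarrow> 'a :: {second_countable_topology, banach}"
  assumes "f \<in> borel_measurable dA" "\<And>v. v \<in> disc \<Longrightarrow> norm (f v) \<le> B"
  shows "integrable dA f"
  using assms by (intro dA.integrable_const_bound[of _ B]) auto

lemma cmod_sgn_power_le: "cmod (sgn v ^ n) \<le> 1"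
  by (auto simp: norm_power norm_sgn power_0_left)

text \<open>A rotation through the angle pi / (m - n) keeps the measure and the radial factor but
  changes the sign of the integrand. The factor \<phi> is carried along for the moments of functions
  supported in annuli.\<close>

lemma integral_sgn_orthogonal:
  fixes \<phi> :: "real \<Rightarrow> complex"
  assumes [measurable]: "\<phi> \<in> borel_measurable borel" and "m \<noteq> n"
  shows "(\<integral>v. \<phi> (cmod v) * (sgn v ^ m * cnj (sgn v) ^ n) \<partial>dA) = 0"
proof -
  define I where "I = (\<integral>v. \<phi> (cmod v) * (sgn v ^ m * cnj (sgn v) ^ n) \<partial>dA)"
  define u where "u = cis (pi / (real m - real n))"
  have u: "cmod u = 1" by (simp add: u_def)
  have uu: "u ^ m * cnj u ^ n = -1"
  proof -
    have "u ^ m * cnj u ^ n = cis (real m * (pi / (real m - real n)) + real n * - (pi / (real m - real n)))"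
      unfolding u_def cis_cnj Complex.DeMoivre cis_mult ..
    also have "real m * (pi / (real m - real n)) + real n * - (pi / (real m - real n)) = pi"
      using assms by (simp add: divide_simps) (simp add: algebra_simps)
    finally show ?thesis by simp
  qed
  have "I = (\<integral>v. \<phi> (cmod (u * v)) * (sgn (u * v) ^ m * cnj (sgn (u * v)) ^ n) \<partial>dA)"
    unfolding I_def by (rule integral_dA_rotation[symmetric, OF _ u]) measurable
  also have "\<dots> = (\<integral>v. (u ^ m * cnj u ^ n) * (\<phi> (cmod v) * (sgn v ^ m * cnj (sgn v) ^ n)) \<partial>dA)"
    using u by (intro Bochner_Integration.integral_cong) (auto simp: sgn_mult norm_mult sgn_div_norm[of u] power_mult_distrib)
  also have "\<dots> = (u ^ m * cnj u ^ n) * I"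
    unfolding I_def by (rule integral_mult_right_zero)
  finally show ?thesis using uu by (simp add: I_def)
qed

lemma integral_sgn_power:
  "(\<integral>v. sgn v ^ m * cnj (sgn v) ^ n \<partial>dA) = (if m = n then 1 else 0)"
proof (cases "m = n")
  case True
  have "(\<integral>v. sgn v ^ m * cnj (sgn v) ^ n \<partial>dA) = (\<integral>v. 1 \<partial>dA)"
  proof (rule integral_cong_AE)
    show "AE v in dA. sgn v ^ m * cnj (sgn v) ^ n = 1"
      using AE_dA_nonzero
    proof eventually_elim
      case (elim v)
      have "sgn v * cnj (sgn v) = 1" using complex_norm_square[of "sgn v"] elim by (simp add: norm_sgn)
      then show ?case using True by (simp flip: power_mult_distrib)
    qed
  qed measurable
  then show ?thesis using True dA.prob_space by simp
qed (use integral_sgn_orthogonal[of "\<lambda>_. 1" m n] in auto)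

lemma parseval_circle_finite:
  fixes a :: "nat \<Rightarrow> complex"
  shows "(\<integral>v. (cmod (\<Sum>n<N. a n * sgn v ^ n))\<^sup>2 \<partial>dA) = (\<Sum>n<N. (cmod (a n))\<^sup>2)"
proof -
  have int: "integrable dA (\<lambda>v. sgn v ^ m * cnj (sgn v) ^ n)" for m n
  proof (rule integrable_dA_bounded)
    show "cmod (sgn v ^ m * cnj (sgn v) ^ n) \<le> 1" for v
      using mult_mono[OF cmod_sgn_power_le[of v m] cmod_sgn_power_le[of v n]]
      by (simp add: norm_mult norm_power)
  qed measurable
  have "complex_of_real (\<integral>v. (cmod (\<Sum>n<N. a n * sgn v ^ n))\<^sup>2 \<partial>dA)
      = (\<integral>v. (\<Sum>m<N. \<Sum>n<N. a m * cnj (a n) * (sgn v ^ m * cnj (sgn v) ^ n)) \<partial>dA)"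
    unfolding integral_complex_of_real[symmetric] complex_norm_square
    by (simp add: sum_product mult_ac)
  also have "\<dots> = (\<Sum>m<N. \<Sum>n<N. a m * cnj (a n) * (if m = n then 1 else 0))"
    using int by (simp add: Bochner_Integration.integral_sum integral_sgn_power)
  also have "\<dots> = (\<Sum>m<N. of_real ((cmod (a m))\<^sup>2))"
    by (simp add: complex_norm_square if_distrib sum.delta del: of_real_power cong: if_cong)
  finally show ?thesis by (simp only: of_real_sum[symmetric] of_real_eq_iff)
qed

text \<open>Absolute summability bounds all partial sums by one constant, so dominated convergence
  carries the finite identity to the limit.\<close>

lemma parseval_circle:
  fixes a :: "nat \<Rightarrow> complex"
  assumes "summable (\<lambda>n. cmod (a n))"
  shows "(\<integral>\<^sup>+v. ennreal ((cmod (\<Sum>n. a n * sgn v ^ n))\<^sup>2) \<partial>dA) = ennreal (\<Sum>n. (cmod (a n))\<^sup>2)"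
    and "summable (\<lambda>n. (cmod (a n))\<^sup>2)"
proof -
  define B where "B = (\<Sum>n. cmod (a n))"
  have le: "cmod (a n * sgn v ^ n) \<le> cmod (a n)" for n v
    using mult_left_mono[OF cmod_sgn_power_le[of v n], of "cmod (a n)"] by (simp add: norm_mult)
  have sm: "summable (\<lambda>n. a n * sgn v ^ n)" for v
    by (rule summable_comparison_test'[OF assms, of 0]) (use le in auto)
  have bd: "cmod (\<Sum>n<N. a n * sgn v ^ n) \<le> B" for N v
  proof -
    have "cmod (\<Sum>n<N. a n * sgn v ^ n) \<le> (\<Sum>n<N. cmod (a n))"
      by (rule order_trans[OF norm_sum sum_mono[OF le]])
    also have "\<dots> \<le> B" unfolding B_def using assms by (intro sum_le_suminf) auto
    finally show ?thesis .
  qed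
  have bd': "cmod (\<Sum>n. a n * sgn v ^ n) \<le> B" for v
    by (rule LIMSEQ_le_const2[OF tendsto_norm[OF summable_LIMSEQ[OF sm]]]) (use bd in auto)
  have B: "0 \<le> B" using bd[of 0 0] by simp
  have meas: "(\<lambda>v. \<Sum>n. a n * sgn v ^ n) \<in> borel_measurable dA" by measurable
  have "(\<lambda>N. \<integral>v. (cmod (\<Sum>n<N. a n * sgn v ^ n))\<^sup>2 \<partial>dA)
      \<longlonglongrightarrow> (\<integral>v. (cmod (\<Sum>n. a n * sgn v ^ n))\<^sup>2 \<partial>dA)"
  proof (rule integral_dominated_convergence)
    show "integrable dA (\<lambda>v. B\<^sup>2)" by simp
    show "AE v in dA. (\<lambda>N. (cmod (\<Sum>n<N. a n * sgn v ^ n))\<^sup>2) \<longlonglongrightarrow> (cmod (\<Sum>n. a n * sgn v ^ n))\<^sup>2"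
      by (auto intro!: tendsto_power tendsto_norm summable_LIMSEQ sm)
    show "AE v in dA. norm ((cmod (\<Sum>n<N. a n * sgn v ^ n))\<^sup>2) \<le> B\<^sup>2" for N
      using bd by (auto intro!: power_mono)
  qed (use meas in measurable)
  then have "(\<lambda>n. (cmod (a n))\<^sup>2) sums (\<integral>v. (cmod (\<Sum>n. a n * sgn v ^ n))\<^sup>2 \<partial>dA)"
    unfolding parseval_circle_finite sums_def .
  moreover have "integrable dA (\<lambda>v. (cmod (\<Sum>n. a n * sgn v ^ n))\<^sup>2)"
    by (rule integrable_dA_bounded[of _ "B\<^sup>2"]) (use meas bd' in \<open>auto intro!: power_mono\<close>)
  ultimately show "(\<integral>\<^sup>+v. ennreal ((cmod (\<Sum>n. a n * sgn v ^ n))\<^sup>2) \<partial>dA) = ennreal (\<Sum>n. (cmod (a n))\<^sup>2)"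
    "summable (\<lambda>n. (cmod (a n))\<^sup>2)"
    by (auto simp: sums_iff nn_integral_eq_integral)
qed

section \<open>Radial integrals and the weighted \<open>L\<^sup>1\<close> bound\<close>

lemma nn_integral_dA_radial_has_integral:
  fixes \<psi> :: "real \<Rightarrow> real"
  assumes [measurable]: "\<psi> \<in> borel_measurable borel"
    and "\<And>x. x \<in> {0..s} \<Longrightarrow> 0 \<le> \<psi> x" and "(\<psi> has_integral I) {0..s}" and "s \<le> 1"
  shows "(\<integral>\<^sup>+z\<in>{z. wt z \<in> {0..s}}. ennreal (\<psi> (wt z)) \<partial>dA) = ennreal I"
proof -
  have "(\<integral>\<^sup>+z\<in>{z. wt z \<in> {0..s}}. ennreal (\<psi> (wt z)) \<partial>dA)
      = (\<integral>\<^sup>+z. (\<lambda>x. ennreal (\<psi> x) * indicator {0..s} x) (wt z) \<partial>dA)"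
    by (intro nn_integral_cong) (auto simp: indicator_def)
  also have "\<dots> = (\<integral>\<^sup>+x\<in>{0..1}. (\<lambda>x. ennreal (\<psi> x) * indicator {0..s} x) x \<partial>lborel)"
    by (rule nn_integral_dA_radial) measurable
  also have "\<dots> = (\<integral>\<^sup>+x\<in>{0..s}. ennreal (\<psi> x) \<partial>lborel)"
    using \<open>s \<le> 1\<close> by (intro nn_integral_cong) (auto simp: indicator_def)
  also have "\<dots> = ennreal I"
    using assms by (intro nn_integral_has_integral_lebesgue') auto
  finally show ?thesis .
qed

lemma nn_integral_wt_powr_le:
  assumes "-1 < \<kappa>" "0 \<le> s" "s \<le> 1"
  shows "(\<integral>\<^sup>+z\<in>{z. wt z \<le> s}. ennreal (wt z powr \<kappa>) \<partial>dA) = ennreal (s powr (\<kappa> + 1) / (\<kappa> + 1))"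
proof -
  have "(\<integral>\<^sup>+z\<in>{z. wt z \<le> s}. ennreal (wt z powr \<kappa>) \<partial>dA) = (\<integral>\<^sup>+z\<in>{z. wt z \<in> {0..s}}. ennreal (wt z powr \<kappa>) \<partial>dA)"
    using wt_pos by (intro nn_integral_cong) (force simp: indicator_def)
  also have "\<dots> = ennreal (s powr (\<kappa> + 1) / (\<kappa> + 1))"
    using assms has_integral_powr_from_0[of \<kappa> s] by (intro nn_integral_dA_radial_has_integral) auto
  finally show ?thesis .
qed

lemma nn_integral_wt_powr:
  assumes "-1 < \<kappa>"
  shows "(\<integral>\<^sup>+z. ennreal (wt z powr \<kappa>) \<partial>dA) = ennreal (1 / (\<kappa> + 1))"
  using nn_integral_wt_powr_le[OF assms, of 1] wt_le_1 by simp

text \<open>In the uniform variable x = \<open>wt z\<close> the squared norm of a monomial in a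
  weighted Bergman space is a Beta integral.\<close>

lemma nn_integral_wt_powr_Beta:
  assumes "-1 < \<kappa>"
  shows "(\<integral>\<^sup>+z. ennreal (wt z powr \<kappa> * cmod z ^ (2 * n)) \<partial>dA) = ennreal (Beta (\<kappa> + 1) (n + 1))"
proof -
  have "(\<integral>\<^sup>+z. ennreal (wt z powr \<kappa> * cmod z ^ (2 * n)) \<partial>dA)
      = (\<integral>\<^sup>+z\<in>{z. wt z \<in> {0..1}}. ennreal (wt z powr (\<kappa> + 1 - 1) * (1 - wt z) powr (real (n + 1) - 1)) \<partial>dA)"
  \<comment> \<open>The origin is excluded because for n = 0 the power there is 1 whereas
    \<open>0 powr 0\<close> is 0.\<close>
  proof (rule nn_integral_cong_AE, use AE_dA_nonzero AE_space in eventually_elim)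
    case (elim z)
    then have "cmod z ^ (2 * n) = (1 - wt z) powr real n"
      by (simp add: wt_def power_mult powr_realpow)
    then show ?case using wt_pos[of z] wt_le_1[of z] elim by simp
  qed
  also have "\<dots> = ennreal (Beta (\<kappa> + 1) (n + 1))"
    using assms by (intro nn_integral_dA_radial_has_integral has_integral_Beta_real) auto
  finally show ?thesis .
qed

lemma Beta_pos: "0 < x \<Longrightarrow> 0 < y \<Longrightarrow> 0 < Beta x (y :: real)"
  by (simp add: Beta_def)

lemma nn_integral_wt_inverse_square:
  assumes "0 < s" "s \<le> 1"
  shows "(\<integral>\<^sup>+z\<in>{z. s < wt z}. ennreal (1 / (wt z)\<^sup>2) \<partial>dA) \<le> ennreal (1 / s)"
proof -
  have "(\<integral>\<^sup>+z\<in>{z. s < wt z}. ennreal (1 / (wt z)\<^sup>2) \<partial>dA)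
      = (\<integral>\<^sup>+z. (\<lambda>x. ennreal (1 / x\<^sup>2) * indicator {s<..} x) (wt z) \<partial>dA)"
    by (intro nn_integral_cong) (auto simp: indicator_def)
  also have "\<dots> = (\<integral>\<^sup>+x\<in>{0..1}. (\<lambda>x. ennreal (1 / x\<^sup>2) * indicator {s<..} x) x \<partial>lborel)"
    by (rule nn_integral_dA_radial) measurable
  also have "\<dots> \<le> (\<integral>\<^sup>+x\<in>{s..1}. ennreal (1 / x\<^sup>2) \<partial>lborel)"
    by (intro nn_integral_mono) (auto simp: indicator_def)
  also have "\<dots> = ennreal (- 1 / 1 - (- 1 / s))"
    using assms
    by (intro nn_integral_FTC_Icc) (auto intro!: derivative_eq_intros simp: power2_eq_square)
  also have "\<dots> \<le> ennreal (1 / s)"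
    using assms by (intro ennreal_leI) auto
  finally show ?thesis .
qed

section \<open>From averages over the circle to the weak norm\<close>

lemma emeasure_wt_le_ennreal:
  assumes "0 < s"
  shows "emeasure dA {z \<in> disc. ennreal (s * wt z) \<le> h} = min 1 (h / ennreal s)"
proof (cases h)
  case (real r)
  have eq: "{z \<in> disc. ennreal (s * wt z) \<le> h} = {z \<in> disc. wt z \<le> r / s}"
    using assms real by (auto simp: ennreal_le_iff pos_le_divide_eq mult.commute)
  have h: "h / ennreal s = ennreal (r / s)" using assms real by (simp add: divide_ennreal)
  show ?thesis
  proof (cases "r / s \<le> 1")
    case True
    then show ?thesis unfolding eq h using assms real
      by (subst emeasure_dA_wt_le) (auto simp: min_def)
  next
    case False
    then have "{z \<in> disc. wt z \<le> r / s} = space dA" by (auto intro: order_trans[OF wt_le_1])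
    then show ?thesis unfolding eq h using False dA.emeasure_space_1 by (auto simp: min_def)
  qed
next
  case top
  then have "{z \<in> disc. ennreal (s * wt z) \<le> h} = space dA" by auto
  then show ?thesis using assms top dA.emeasure_space_1 by (simp add: ennreal_top_divide)
qed

text \<open>For a fixed direction the condition bounds a uniform variable by H / s, an event of
  probability \<open>min 1 (H / s)\<close>; direction and modulus are independent. Dropping the
  minimum yields the upper bounds for weak norms; the lower bounds use large s, where the minimum is
  inactive.\<close>

lemma emeasure_wt_le_sgn:
  assumes [measurable]: "H \<in> borel_measurable borel" and "0 < s"
  shows "emeasure dA {z \<in> disc. ennreal (s * wt z) \<le> H (sgn z)} = (\<integral>\<^sup>+v. min 1 (H (sgn v) / ennreal s) \<partial>dA)"
proof -
  interpret pair_sigma_finite dA dA ..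
  define F where "F u r = (indicator {(u, r). ennreal (s * (1 - r\<^sup>2)) \<le> H u} (u, r) :: ennreal)" for u :: complex and r :: real
  have F[measurable]: "case_prod F \<in> borel_measurable (borel \<Otimes>\<^sub>M borel)"
    unfolding F_def case_prod_beta by measurable
  have "emeasure dA {z \<in> disc. ennreal (s * wt z) \<le> H (sgn z)} = (\<integral>\<^sup>+z. indicator {z \<in> disc. ennreal (s * wt z) \<le> H (sgn z)} z \<partial>dA)"
    using disc_sets_dA[of "\<lambda>z. ennreal (s * wt z) \<le> H (sgn z)"] by simp
  also have "\<dots> = (\<integral>\<^sup>+z. F (sgn z) (cmod z) \<partial>dA)"
    by (intro nn_integral_cong) (auto simp: F_def wt_def indicator_def)
  also have "\<dots> = (\<integral>\<^sup>+z. \<integral>\<^sup>+v. F (sgn v) (cmod z) \<partial>dA \<partial>dA)"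
    by (rule nn_integral_dA_polar) measurable
  also have "\<dots> = (\<integral>\<^sup>+v. \<integral>\<^sup>+z. F (sgn v) (cmod z) \<partial>dA \<partial>dA)"
    by (rule Fubini') measurable
  also have "\<dots> = (\<integral>\<^sup>+v. emeasure dA {z \<in> disc. ennreal (s * wt z) \<le> H (sgn v)} \<partial>dA)"
  proof (rule nn_integral_cong)
    fix v
    have "{z \<in> disc. ennreal (s * wt z) \<le> H (sgn v)} \<in> sets dA"
      by (rule disc_sets_dA) measurable
    then have "emeasure dA {z \<in> disc. ennreal (s * wt z) \<le> H (sgn v)}
        = (\<integral>\<^sup>+z. indicator {z \<in> disc. ennreal (s * wt z) \<le> H (sgn v)} z \<partial>dA)" by simp
    also have "\<dots> = (\<integral>\<^sup>+z. F (sgn v) (cmod z) \<partial>dA)"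
      by (intro nn_integral_cong) (auto simp: F_def wt_def indicator_def)
    finally show "(\<integral>\<^sup>+z. F (sgn v) (cmod z) \<partial>dA) = emeasure dA {z \<in> disc. ennreal (s * wt z) \<le> H (sgn v)}" by simp
  qed
  also have "\<dots> = (\<integral>\<^sup>+v. min 1 (H (sgn v) / ennreal s) \<partial>dA)"
    using \<open>0 < s\<close> by (intro nn_integral_cong emeasure_wt_le_ennreal)
  finally show ?thesis .
qed

lemma weak_L1_norm_alt:
  "weak_L1_norm f = (SUP t\<in>{0<..}. ennreal t * emeasure dA {z \<in> disc. cmod (f z) > t})"
  unfolding weak_L1_norm_def distr_fun_def
  by (intro SUP_cong) (auto simp: ennreal_mult dA.emeasure_eq_measure)

lemma weak_L1_normI:
  assumes "\<And>t. 0 < t \<Longrightarrow> ennreal t * emeasure dA {z \<in> disc. cmod (f z) > t} \<le> B"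
  shows "weak_L1_norm f \<le> B"
  unfolding weak_L1_norm_alt using assms by (intro SUP_least) auto

lemma weak_L1_normD:
  "0 < t \<Longrightarrow> ennreal t * emeasure dA {z \<in> disc. cmod (f z) > t} \<le> weak_L1_norm f"
  unfolding weak_L1_norm_alt by (intro SUP_upper) auto

text \<open>Halving the exponent makes the kernel the squared modulus of a power series in
  \<open>sgn v\<close>. Parseval then gives a series in \<open>(cmod w)^2\<close> which
  \<open>binom_coeff_half_square_le\<close> dominates by the expansion of
  \<open>wt w powr (1 - c)\<close>.\<close>

lemma circle_kernel_bound:
  assumes "1 < c" "w \<in> disc"
  shows "(\<integral>\<^sup>+v. ennreal (cmod (1 - sgn v * cnj w) powr (- c)) \<partial>dA)
       \<le> ennreal (Gamma (c - 1) / (Gamma (c / 2))\<^sup>2 * wt w powr (1 - c))"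
proof -
  define a where "a n = of_real (binom_coeff (c / 2) n) * cnj w ^ n" for n
  define C where "C = Gamma (c - 1) / (Gamma (c / 2))\<^sup>2"
  have w: "cmod w < 1" using assms by simp
  have sm: "summable (\<lambda>n. cmod (a n))"
    using binom_coeff_abs_summable[of "c / 2" "cnj w"] assms w by (simp add: a_def)
  have "ennreal (cmod (1 - sgn v * cnj w) powr (- c)) = ennreal ((cmod (\<Sum>n. a n * sgn v ^ n))\<^sup>2)" for v
  proof -
    have "cmod (sgn v * cnj w) \<le> 1 * cmod w"
      unfolding norm_mult complex_mod_cnj by (intro mult_right_mono) (auto simp: norm_sgn)
    then have "cmod (sgn v * cnj w) < 1" using w by linarith
    from binom_coeff_sums[OF this, of "c / 2"]
    have "(\<Sum>n. a n * sgn v ^ n) = (1 - sgn v * cnj w) powr (- of_real (c / 2))"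
      by (simp add: sums_iff a_def power_mult_distrib mult_ac)
    also have "(cmod \<dots>)\<^sup>2 = cmod (1 - sgn v * cnj w) powr (- c)"
      using norm_powr_real_powr'[of "of_real (- (c / 2))" "1 - sgn v * cnj w"]
      by (simp add: power2_eq_square flip: powr_add)
    finally show ?thesis by simp
  qed
  then have "(\<integral>\<^sup>+v. ennreal (cmod (1 - sgn v * cnj w) powr (- c)) \<partial>dA) = ennreal (\<Sum>n. (cmod (a n))\<^sup>2)"
    using parseval_circle(1)[OF sm] by simp
  also have "\<dots> \<le> ennreal (C * wt w powr (1 - c))"
  proof (rule ennreal_leI)
    have "\<bar>(cmod w)\<^sup>2\<bar> < 1" using w by (simp add: abs_square_less_1)
    from sums_mult[OF binom_coeff_sums_real[OF this, of "c - 1"], of C]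
    have *: "(\<lambda>n. C * (binom_coeff (c - 1) n * ((cmod w)\<^sup>2) ^ n)) sums (C * wt w powr (1 - c))"
      by (simp add: wt_def)
    show "(\<Sum>n. (cmod (a n))\<^sup>2) \<le> C * wt w powr (1 - c)"
    proof (rule order_trans[OF suminf_le])
      show "(cmod (a n))\<^sup>2 \<le> C * (binom_coeff (c - 1) n * ((cmod w)\<^sup>2) ^ n)" for n
      proof -
        have "(cmod (a n))\<^sup>2 = (binom_coeff (c / 2) n)\<^sup>2 * ((cmod w)\<^sup>2) ^ n"
          by (simp add: a_def norm_mult norm_power power_mult_distrib flip: power_mult) (simp add: mult.commute)
        also have "\<dots> \<le> (C * binom_coeff (c - 1) n) * ((cmod w)\<^sup>2) ^ n"
          unfolding C_def using assms by (intro mult_right_mono binom_coeff_half_square_le) auto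
        finally show ?thesis by (simp add: mult.assoc)
      qed
    qed (use * parseval_circle(2)[OF sm] in \<open>auto simp: sums_iff\<close>)
  qed
  finally show ?thesis by (simp add: C_def)
qed

lemma kernel_norm:
  assumes "Op = T_op a b c \<or> Op = S_op a b c"
  shows "cmod (kernel Op z w) = wt w powr b * cmod (1 - z * cnj w) powr (- c)"
proof -
  have "cmod (kernel (T_op a b c) z w) = wt w powr b * cmod (1 - z * cnj w) powr (- c)"
    by (simp add: T_op_def norm_mult norm_inverse norm_powr_real_powr' wt_def powr_minus divide_inverse)
  then show ?thesis using assms by (elim disjE) (simp_all only: kernel_S norm_of_real, simp add: abs_mult)
qed

lemma kernel_measurable:
  assumes "Op = T_op a b c \<or> Op = S_op a b c"
  assumes [measurable]: "f \<in> borel_measurable M" "g \<in> borel_measurable M"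
  shows "(\<lambda>x. kernel Op (f x) (g x)) \<in> borel_measurable M"
  using assms(1) by (elim disjE) (simp_all, measurable)

lemma factor_eq: "factor (T_op a b c) z = wt z powr a" "factor (S_op a b c) z = wt z powr a"
  by (simp_all add: T_op_def S_op_def wt_def)

text \<open>Pushing z out to the circle changes \<open>1 - z * cnj w\<close> by (1 - |z|) |w|, which
  is at most 1 - |z| |w| and hence at most the modulus of \<open>1 - z * cnj w\<close> itself. At z
  = 0 nothing moves, as \<open>sgn 0 = 0\<close>.\<close>

lemma sgn_kernel_le:
  assumes "0 \<le> c" "z \<in> disc" "w \<in> disc"
  shows "cmod (1 - z * cnj w) powr (- c) \<le> 2 powr c * cmod (1 - sgn z * cnj w) powr (- c)"
proof -
  have z: "cmod z < 1" and w: "cmod w < 1" using assms by auto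
  have pos: "cmod (1 - u * cnj w) > 0" if "cmod u \<le> 1" for u
  proof -
    have "cmod (u * cnj w) \<le> 1 * cmod w"
      unfolding norm_mult complex_mod_cnj using that by (intro mult_right_mono) auto
    then have "u * cnj w \<noteq> 1" using w by (metis norm_one mult_1 not_le)
    then show ?thesis by simp
  qed
  have "cmod (1 - sgn z * cnj w) \<le> 2 * cmod (1 - z * cnj w)"
  proof (cases "z = 0")
    case False
    have "cmod (1 - sgn z * cnj w) = cmod ((1 - z * cnj w) + (z - sgn z) * cnj w)"
      by (simp add: algebra_simps)
    also have "\<dots> \<le> cmod (1 - z * cnj w) + cmod (z - sgn z) * cmod w"
      by (rule order_trans[OF norm_triangle_ineq]) (simp add: norm_mult)
    also have "cmod (z - sgn z) = 1 - cmod z"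
    proof -
      have "z - sgn z = (cmod z - 1) *\<^sub>R sgn z"
        using False by (simp add: sgn_div_norm algebra_simps)
      then show ?thesis using False z by (simp add: norm_sgn)
    qed
    also have "(1 - cmod z) * cmod w \<le> 1 - cmod z * cmod w"
      using z w by (simp add: algebra_simps)
    also have "1 - cmod z * cmod w \<le> cmod (1 - z * cnj w)"
      using norm_triangle_ineq2[of 1 "z * cnj w"] by (simp add: norm_mult)
    finally show ?thesis by simp
  qed simp
  then have "(2 * cmod (1 - z * cnj w)) powr (- c) \<le> cmod (1 - sgn z * cnj w) powr (- c)"
    using assms pos[of "sgn z"] by (intro powr_mono2') (auto simp: norm_sgn)
  then have "2 powr c * (2 * cmod (1 - z * cnj w)) powr (- c) \<le> 2 powr c * cmod (1 - sgn z * cnj w) powr (- c)"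
    by (intro mult_left_mono) auto
  moreover have "2 powr c * (2 * cmod (1 - z * cnj w)) powr (- c) = cmod (1 - z * cnj w) powr (- c)"
    by (simp add: powr_mult mult.assoc[symmetric] flip: powr_add)
  ultimately show ?thesis by simp
qed

lemma weak_L1_norm_op_le:
  assumes c: "1 < c" and Op: "Op = T_op (-1) b c \<or> Op = S_op (-1) b c"
    and [measurable]: "f \<in> borel_measurable dA"
  shows "weak_L1_norm (op_apply Op f) \<le> ennreal (2 powr c * (Gamma (c - 1) / (Gamma (c / 2))\<^sup>2))
     * (\<integral>\<^sup>+w. ennreal (wt w powr (b + 1 - c) * cmod (f w)) \<partial>dA)"
proof (rule weak_L1_normI)
  interpret pair_sigma_finite dA dA ..
  fix t :: real assume t: "0 < t"
  define CJ where "CJ = Gamma (c - 1) / (Gamma (c / 2))\<^sup>2"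
  have CJ: "CJ \<ge> 0" unfolding CJ_def using c by auto
  define G where "G u = (\<integral>\<^sup>+w. ennreal (wt w powr b * cmod (1 - u * cnj w) powr (- c) * cmod (f w)) \<partial>dA)" for u
  define H where "H u = ennreal (2 powr c) * G u" for u
  have G[measurable]: "G \<in> borel_measurable borel"
    unfolding G_def[abs_def] by measurable
  have [measurable]: "H \<in> borel_measurable borel"
    unfolding H_def[abs_def] by measurable
  have bound: "ennreal (wt z * cmod (op_apply Op f z)) \<le> H (sgn z)" if z: "z \<in> disc" for z
  \<comment> \<open>Where the integral diverges, \<open>op_apply\<close> is 0 by the default value
    of the Bochner integral.\<close>
  proof (cases "integrable dA (\<lambda>w. kernel Op z w * f w)")
    case True
    have "wt z * cmod (op_apply Op f z) = cmod (\<integral>w. kernel Op z w * f w \<partial>dA)"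
    proof -
      have "factor Op z = 1 / wt z" using Op wt_pos[OF z] by (auto simp: factor_eq powr_minus divide_inverse)
      then show ?thesis using wt_pos[OF z] by (simp add: op_apply_def norm_mult norm_divide)
    qed
    also have "ennreal \<dots> \<le> (\<integral>\<^sup>+w. ennreal (cmod (kernel Op z w * f w)) \<partial>dA)"
      using True by (rule integral_norm_bound_ennreal)
    also have "\<dots> \<le> (\<integral>\<^sup>+w. ennreal (2 powr c) * ennreal (wt w powr b * cmod (1 - sgn z * cnj w) powr (- c) * cmod (f w)) \<partial>dA)"
    proof (rule nn_integral_mono)
      fix w assume "w \<in> space dA"
      then have "cmod (1 - z * cnj w) powr (- c) \<le> 2 powr c * cmod (1 - sgn z * cnj w) powr (- c)"
        using sgn_kernel_le[of c z w] c z by simp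
      then have "wt w powr b * cmod (1 - z * cnj w) powr (- c) * cmod (f w) \<le>
          wt w powr b * (2 powr c * cmod (1 - sgn z * cnj w) powr (- c)) * cmod (f w)"
        by (intro mult_right_mono mult_left_mono) auto
      then show "ennreal (cmod (kernel Op z w * f w)) \<le>
          ennreal (2 powr c) * ennreal (wt w powr b * cmod (1 - sgn z * cnj w) powr (- c) * cmod (f w))"
        by (simp add: norm_mult kernel_norm[OF Op] mult_ac ennreal_leI flip: ennreal_mult)
    qed
    also have "\<dots> = H (sgn z)"
      unfolding H_def G_def by (rule nn_integral_cmult) measurable
    finally show ?thesis .
  qed (simp add: op_apply_def not_integrable_integral_eq)
  have "emeasure dA {z \<in> disc. cmod (op_apply Op f z) > t} \<le> emeasure dA {z \<in> disc. ennreal (t * wt z) \<le> H (sgn z)}"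
  proof (rule emeasure_mono)
    show "{z \<in> disc. ennreal (t * wt z) \<le> H (sgn z)} \<in> sets dA"
      by (rule disc_sets_dA) measurable
    show "{z \<in> disc. cmod (op_apply Op f z) > t} \<subseteq> {z \<in> disc. ennreal (t * wt z) \<le> H (sgn z)}"
    proof clarify
      fix z assume z: "z \<in> disc" "t < cmod (op_apply Op f z)"
      have "ennreal (t * wt z) \<le> ennreal (wt z * cmod (op_apply Op f z))"
        using z wt_pos[OF z(1)] by (intro ennreal_leI) (simp add: mult.commute)
      with bound[OF z(1)] show "ennreal (t * wt z) \<le> H (sgn z)" by (rule order_trans[rotated])
    qed
  qed
  also have "\<dots> \<le> (\<integral>\<^sup>+v. H (sgn v) / ennreal t \<partial>dA)"
    using t by (subst emeasure_wt_le_sgn) (auto intro!: nn_integral_mono)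
  also have "\<dots> = (\<integral>\<^sup>+v. H (sgn v) \<partial>dA) / ennreal t"
    by (rule nn_integral_divide) measurable
  finally have "ennreal t * emeasure dA {z \<in> disc. cmod (op_apply Op f z) > t} \<le> ennreal t * ((\<integral>\<^sup>+v. H (sgn v) \<partial>dA) / ennreal t)"
    by (rule mult_left_mono) simp
  also have "\<dots> = (\<integral>\<^sup>+v. H (sgn v) \<partial>dA)"
    using t by (simp add: ennreal_times_divide mult_divide_eq_ennreal mult.commute[of "ennreal t"])
  also have "\<dots> = ennreal (2 powr c) * (\<integral>\<^sup>+v. G (sgn v) \<partial>dA)"
    unfolding H_def by (rule nn_integral_cmult) measurable
  also have "(\<integral>\<^sup>+v. G (sgn v) \<partial>dA) = (\<integral>\<^sup>+w. \<integral>\<^sup>+v. ennreal (wt w powr b * cmod (1 - sgn v * cnj w) powr (- c) * cmod (f w)) \<partial>dA \<partial>dA)"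
    unfolding G_def by (subst Fubini') auto
  also have "\<dots> \<le> (\<integral>\<^sup>+w. ennreal CJ * ennreal (wt w powr (b + 1 - c) * cmod (f w)) \<partial>dA)"
  proof (rule nn_integral_mono)
    fix w assume w: "w \<in> space dA"
    have "(\<integral>\<^sup>+v. ennreal (wt w powr b * cmod (1 - sgn v * cnj w) powr (- c) * cmod (f w)) \<partial>dA)
        = (\<integral>\<^sup>+v. ennreal (wt w powr b * cmod (f w)) * ennreal (cmod (1 - sgn v * cnj w) powr (- c)) \<partial>dA)"
      by (intro nn_integral_cong) (simp add: mult_ac flip: ennreal_mult)
    also have "\<dots> = ennreal (wt w powr b * cmod (f w)) * (\<integral>\<^sup>+v. ennreal (cmod (1 - sgn v * cnj w) powr (- c)) \<partial>dA)"
      by (rule nn_integral_cmult) measurable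
    also have "\<dots> \<le> ennreal (wt w powr b * cmod (f w)) * ennreal (CJ * wt w powr (1 - c))"
      unfolding CJ_def using circle_kernel_bound[OF c] w by (intro mult_left_mono) auto
    also have "\<dots> = ennreal CJ * ennreal (wt w powr (b + 1 - c) * cmod (f w))"
      using CJ powr_add[of "wt w" b "1 - c"] by (simp add: mult_ac add_diff_eq flip: ennreal_mult)
    finally show "(\<integral>\<^sup>+v. ennreal (wt w powr b * cmod (1 - sgn v * cnj w) powr (- c) * cmod (f w)) \<partial>dA)
        \<le> ennreal CJ * ennreal (wt w powr (b + 1 - c) * cmod (f w))" .
  qed
  also have "\<dots> = ennreal CJ * (\<integral>\<^sup>+w. ennreal (wt w powr (b + 1 - c) * cmod (f w)) \<partial>dA)"
    by (rule nn_integral_cmult) measurable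
  finally show "ennreal t * emeasure dA {z \<in> disc. cmod (op_apply Op f z) > t} \<le>
      ennreal (2 powr c * (Gamma (c - 1) / (Gamma (c / 2))\<^sup>2)) * (\<integral>\<^sup>+w. ennreal (wt w powr (b + 1 - c) * cmod (f w)) \<partial>dA)"
    using CJ by (simp add: CJ_def[symmetric] ennreal_mult mult.assoc mult_left_mono)
qed

section \<open>The weighted \<open>L\<^sup>2\<close> bound\<close>

text \<open>Times \<open>binom_coeff c n\<close>, these are the Taylor coefficients of the analytic
  factor of T f.\<close>

definition moment :: "real \<Rightarrow> (complex \<Rightarrow> complex) \<Rightarrow> nat \<Rightarrow> complex" where
  "moment b f n = (\<integral>w. of_real (wt w powr b) * f w * cnj w ^ n \<partial>dA)"

text \<open>The bound by r < 1 is imposed only where f is nonzero, which covers two situations: z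
  inside the disc with arbitrary f, and z on the circle with f vanishing near the boundary. In both,
  the binomial series at a point s < 1 is a majorant that permits exchanging sum and
  integral.\<close>

lemma kernel_T_expansion:
  assumes c: "0 < c" and int: "integrable dA (\<lambda>w. of_real (wt w powr b) * f w)"
    and z: "cmod z \<le> 1" and r: "r < 1" "\<And>w. w \<in> disc \<Longrightarrow> f w \<noteq> 0 \<Longrightarrow> cmod (z * cnj w) \<le> r"
  shows "integrable dA (\<lambda>w. kernel (T_op a b c) z w * f w)"
    and "(\<lambda>n. of_real (binom_coeff c n) * moment b f n * z ^ n) sums (\<integral>w. kernel (T_op a b c) z w * f w \<partial>dA)"
proof -
  define h where "h w = of_real (wt w powr b) * f w" for w
  define g where "g n w = h w * (of_real (binom_coeff c n) * (z * cnj w) ^ n)" for n w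
  \<comment> \<open>A negative r can occur only if f vanishes on the disc; the maximum keeps the
    powers of s nonnegative then.\<close>
  define s where "s = max r 0"
  have s: "0 \<le> s" "s < 1" using r by (auto simp: s_def)
  have h: "integrable dA h" using int by (simp add: h_def[abs_def])
  then have [measurable]: "h \<in> borel_measurable dA" by auto
  have le: "cmod (g n w) \<le> binom_coeff c n * s ^ n * cmod (h w)" if w: "w \<in> disc" for n w
  proof (cases "f w = 0")
    case False
    then have "cmod (z * cnj w) \<le> s" using r(2)[OF w] by (simp add: s_def)
    then have "cmod (z * cnj w) ^ n \<le> s ^ n" by (intro power_mono) auto
    then have "binom_coeff c n * cmod (z * cnj w) ^ n * cmod (h w) \<le> binom_coeff c n * s ^ n * cmod (h w)"
      using binom_coeff_pos[OF c, of n] by (intro mult_right_mono mult_left_mono) auto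
    then show ?thesis
      using binom_coeff_pos[OF c, of n] by (simp add: g_def norm_mult norm_power mult_ac)
  qed (simp add: g_def h_def)
  have gi: "integrable dA (g n)" for n
    by (rule Bochner_Integration.integrable_bound[of _ "\<lambda>w. binom_coeff c n * s ^ n * cmod (h w)"])
       (use h le binom_coeff_pos[OF c, of n] s in \<open>auto simp: g_def[abs_def] abs_mult abs_of_pos\<close>)
  have gs: "(\<lambda>n. g n w) sums (kernel (T_op a b c) z w * f w)" if w: "w \<in> disc" for w
    using sums_mult2[OF kernel_T_sums[OF z w, of b c a], of "f w"]
    by (simp add: g_def h_def mult_ac)
  have sumh: "summable (\<lambda>n. binom_coeff c n * s ^ n * C)" for C
    using binom_coeff_sums_real[of s c] s by (intro summable_mult2) (auto simp: sums_iff)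
  have A: "AE w in dA. summable (\<lambda>n. norm (g n w))"
    by (rule AE_I2) (use le in \<open>auto intro!: summable_comparison_test'[OF sumh, of 0]\<close>)
  have B: "summable (\<lambda>n. \<integral>w. norm (g n w) \<partial>dA)"
  proof (rule summable_comparison_test'[of _ 0])
    show "summable (\<lambda>n. binom_coeff c n * s ^ n * (\<integral>w. cmod (h w) \<partial>dA))" by (rule sumh)
    have "(\<integral>w. norm (g n w) \<partial>dA) \<le> (\<integral>w. binom_coeff c n * s ^ n * cmod (h w) \<partial>dA)" for n
      using gi h le by (intro integral_mono) auto
    then show "norm (\<integral>w. norm (g n w) \<partial>dA) \<le> binom_coeff c n * s ^ n * (\<integral>w. cmod (h w) \<partial>dA)" for n
      by simp
  qed
  have eq: "kernel (T_op a b c) z w * f w = (\<Sum>n. g n w)" if "w \<in> disc" for w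
    using gs[OF that] by (simp add: sums_iff)
  show "integrable dA (\<lambda>w. kernel (T_op a b c) z w * f w)"
    using integrable_suminf[OF gi A B] eq by (subst Bochner_Integration.integrable_cong[OF refl]) auto
  have "(\<lambda>n. \<integral>w. g n w \<partial>dA) sums (\<integral>w. (\<Sum>n. g n w) \<partial>dA)"
    using sums_integral[OF gi A B] .
  also have "(\<integral>w. (\<Sum>n. g n w) \<partial>dA) = (\<integral>w. kernel (T_op a b c) z w * f w \<partial>dA)"
    using eq by (intro Bochner_Integration.integral_cong) auto
  also have "(\<lambda>n. \<integral>w. g n w \<partial>dA) = (\<lambda>n. of_real (binom_coeff c n) * moment b f n * z ^ n)"
  proof
    fix n
    have "(\<integral>w. g n w \<partial>dA) = (\<integral>w. (of_real (binom_coeff c n) * z ^ n) * (of_real (wt w powr b) * f w * cnj w ^ n) \<partial>dA)"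
      by (intro Bochner_Integration.integral_cong) (auto simp: g_def h_def power_mult_distrib mult_ac)
    also have "\<dots> = (of_real (binom_coeff c n) * z ^ n) * moment b f n"
      unfolding moment_def by (rule integral_mult_right_zero)
    finally show "(\<integral>w. g n w \<partial>dA) = of_real (binom_coeff c n) * moment b f n * z ^ n" by (simp add: mult_ac)
  qed
  finally show "(\<lambda>n. of_real (binom_coeff c n) * moment b f n * z ^ n) sums (\<integral>w. kernel (T_op a b c) z w * f w \<partial>dA)" .
qed

text \<open>On the circle of radius |z| this is Parseval for the coefficients
  \<open>a n * cmod z ^ n\<close>; the modulus is then integrated out.\<close>

lemma parseval_radial:
  fixes a :: "nat \<Rightarrow> complex" and \<phi> :: "real \<Rightarrow> ennreal"
  assumes [measurable]: "\<phi> \<in> borel_measurable borel"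
    and sm: "\<And>r. 0 \<le> r \<Longrightarrow> r < 1 \<Longrightarrow> summable (\<lambda>n. cmod (a n) * r ^ n)"
  shows "(\<integral>\<^sup>+z. \<phi> (wt z) * ennreal ((cmod (\<Sum>n. a n * z ^ n))\<^sup>2) \<partial>dA)
       = (\<integral>\<^sup>+z. \<phi> (wt z) * ennreal (\<Sum>n. (cmod (a n))\<^sup>2 * cmod z ^ (2 * n)) \<partial>dA)"
    and "z \<in> disc \<Longrightarrow> summable (\<lambda>n. (cmod (a n))\<^sup>2 * cmod z ^ (2 * n))"
proof -
  have pw: "(cmod (a n * of_real (cmod z) ^ n))\<^sup>2 = (cmod (a n))\<^sup>2 * cmod z ^ (2 * n)" for z n
    by (simp add: norm_mult norm_power power_mult_distrib flip: power_mult) (simp add: mult.commute)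
  have sm': "summable (\<lambda>n. cmod (a n * of_real (cmod z) ^ n))" if "z \<in> disc" for z
    using sm[of "cmod z"] that by (simp add: norm_mult norm_power)
  show "z \<in> disc \<Longrightarrow> summable (\<lambda>n. (cmod (a n))\<^sup>2 * cmod z ^ (2 * n))"
    using parseval_circle(2)[OF sm'] by (simp add: pw)
  define F where "F u r = \<phi> (1 - r\<^sup>2) * ennreal ((cmod (\<Sum>n. a n * (of_real r * u) ^ n))\<^sup>2)" for u :: complex and r :: real
  have [measurable]: "case_prod F \<in> borel_measurable (borel \<Otimes>\<^sub>M borel)"
    unfolding F_def case_prod_beta by measurable
  have "(\<integral>\<^sup>+z. \<phi> (wt z) * ennreal ((cmod (\<Sum>n. a n * z ^ n))\<^sup>2) \<partial>dA) = (\<integral>\<^sup>+z. F (sgn z) (cmod z) \<partial>dA)"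
  proof (rule nn_integral_cong)
    fix z :: complex
    have "of_real (cmod z) * sgn z = z"
      by (cases "z = 0") (simp_all add: sgn_div_norm scaleR_conv_of_real)
    then show "\<phi> (wt z) * ennreal ((cmod (\<Sum>n. a n * z ^ n))\<^sup>2) = F (sgn z) (cmod z)"
      by (simp add: F_def wt_def)
  qed
  also have "\<dots> = (\<integral>\<^sup>+z. \<integral>\<^sup>+v. F (sgn v) (cmod z) \<partial>dA \<partial>dA)"
    by (rule nn_integral_dA_polar) measurable
  also have "\<dots> = (\<integral>\<^sup>+z. \<phi> (wt z) * ennreal (\<Sum>n. (cmod (a n))\<^sup>2 * cmod z ^ (2 * n)) \<partial>dA)"
  proof (rule nn_integral_cong)
    fix z assume "z \<in> space dA"
    then have z: "z \<in> disc" by simp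
    have "(\<integral>\<^sup>+v. F (sgn v) (cmod z) \<partial>dA) =
        (\<integral>\<^sup>+v. \<phi> (wt z) * ennreal ((cmod (\<Sum>n. (a n * of_real (cmod z) ^ n) * sgn v ^ n))\<^sup>2) \<partial>dA)"
      by (simp add: F_def wt_def power_mult_distrib mult.assoc)
    also have "\<dots> = \<phi> (wt z) * (\<integral>\<^sup>+v. ennreal ((cmod (\<Sum>n. (a n * of_real (cmod z) ^ n) * sgn v ^ n))\<^sup>2) \<partial>dA)"
      by (rule nn_integral_cmult) measurable
    also have "\<dots> = \<phi> (wt z) * ennreal (\<Sum>n. (cmod (a n))\<^sup>2 * cmod z ^ (2 * n))"
      unfolding parseval_circle(1)[OF sm'[OF z]] pw ..
    finally show "(\<integral>\<^sup>+v. F (sgn v) (cmod z) \<partial>dA) = \<phi> (wt z) * ennreal (\<Sum>n. (cmod (a n))\<^sup>2 * cmod z ^ (2 * n))" .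
  qed
  finally show "(\<integral>\<^sup>+z. \<phi> (wt z) * ennreal ((cmod (\<Sum>n. a n * z ^ n))\<^sup>2) \<partial>dA)
       = (\<integral>\<^sup>+z. \<phi> (wt z) * ennreal (\<Sum>n. (cmod (a n))\<^sup>2 * cmod z ^ (2 * n)) \<partial>dA)" .
qed

lemma parseval_wt_powr:
  fixes a :: "nat \<Rightarrow> complex"
  assumes "-1 < \<kappa>"
  shows "(\<integral>\<^sup>+z. ennreal (wt z powr \<kappa> * (cmod (\<Sum>n<N. a n * z ^ n))\<^sup>2) \<partial>dA)
       = ennreal (\<Sum>n<N. (cmod (a n))\<^sup>2 * Beta (\<kappa> + 1) (n + 1))"
proof -
  define a' where "a' n = (if n < N then a n else 0)" for n
  have fin: "(\<Sum>n. a' n * z ^ n) = (\<Sum>n<N. a n * z ^ n)" for z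
    by (subst suminf_finite[of "{..<N}"]) (auto simp: a'_def)
  have fin': "(\<Sum>n. (cmod (a' n))\<^sup>2 * cmod z ^ (2 * n)) = (\<Sum>n<N. (cmod (a n))\<^sup>2 * cmod z ^ (2 * n))" for z
    by (subst suminf_finite[of "{..<N}"]) (auto simp: a'_def)
  have "(\<integral>\<^sup>+z. ennreal (wt z powr \<kappa> * (cmod (\<Sum>n<N. a n * z ^ n))\<^sup>2) \<partial>dA)
      = (\<integral>\<^sup>+z. ennreal (wt z powr \<kappa>) * ennreal ((cmod (\<Sum>n. a' n * z ^ n))\<^sup>2) \<partial>dA)"
    by (simp add: fin ennreal_mult)
  also have "\<dots> = (\<integral>\<^sup>+z. ennreal (wt z powr \<kappa>) * ennreal (\<Sum>n. (cmod (a' n))\<^sup>2 * cmod z ^ (2 * n)) \<partial>dA)"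
  proof (rule parseval_radial)
    show "summable (\<lambda>n. cmod (a' n) * r ^ n)" for r
      by (rule summable_finite[of "{..<N}"]) (auto simp: a'_def)
  qed measurable
  also have "\<dots> = (\<integral>\<^sup>+z. (\<Sum>n<N. ennreal ((cmod (a n))\<^sup>2) * ennreal (wt z powr \<kappa> * cmod z ^ (2 * n))) \<partial>dA)"
    unfolding fin' by (simp add: sum_distrib_left mult_ac sum_nonneg flip: ennreal_mult)
  also have "\<dots> = (\<Sum>n<N. ennreal ((cmod (a n))\<^sup>2) * ennreal (Beta (\<kappa> + 1) (n + 1)))"
    using assms by (simp add: nn_integral_sum nn_integral_cmult nn_integral_wt_powr_Beta)
  also have "\<dots> = ennreal (\<Sum>n<N. (cmod (a n))\<^sup>2 * Beta (\<kappa> + 1) (n + 1))"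
  proof -
    have "Beta (\<kappa> + 1) (real n + 1) \<ge> 0" for n
      using assms by (intro less_imp_le Beta_pos) auto
    then show ?thesis
      by (subst sum_ennreal[symmetric]) (auto simp: ennreal_mult add.commute)
  qed
  finally show ?thesis .
qed

lemma AM_GM_scaled:
  fixes x y :: real
  assumes "0 < K"
  shows "x * y \<le> (K * x\<^sup>2 + y\<^sup>2 / K) / 2"
proof -
  have "0 \<le> (K * x - y)\<^sup>2 / K" using assms by simp
  then show ?thesis using assms by (simp add: power2_diff field_simps power2_eq_square)
qed

text \<open>Duality: the sum X of squares is the pairing of \<open>wt w powr b * f w\<close> with a
  polynomial q built from the coefficients themselves. The weight is split by b = (2 b + 3 - 2 c) /
  2 + (2 c - 3) / 2, and in the second weight q has squared norm at most K X by the Beta estimate.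
  This gives X \<le> (K F + X) / 2, where X can be absorbed because the sum stops at N.\<close>

lemma L2_coefficient_bound:
  fixes f :: "complex \<Rightarrow> complex"
  assumes c: "1 < c" and [measurable]: "f \<in> borel_measurable dA" and F: "0 \<le> F"
    and int: "(\<integral>\<^sup>+w. ennreal (wt w powr (2 * b + 3 - 2 * c) * (cmod (f w))\<^sup>2) \<partial>dA) \<le> ennreal F"
  defines "K \<equiv> Gamma (2 * c - 2) / (Gamma c)\<^sup>2"
  shows "integrable dA (\<lambda>w. of_real (wt w powr b) * f w)"
    and "(\<Sum>n<N. (cmod (of_real (binom_coeff c n) * moment b f n))\<^sup>2) \<le> K * F"
proof -
  have K: "K > 0" unfolding K_def using c by (intro divide_pos_pos zero_less_power Gamma_real_pos) auto
  define A where "A w = wt w powr (2 * b + 3 - 2 * c) * (cmod (f w))\<^sup>2" for w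
  have [measurable]: "A \<in> borel_measurable dA" unfolding A_def[abs_def] by measurable
  have A: "integrable dA A"
    using int by (intro integrableI_bounded) (auto simp: A_def intro: le_less_trans[OF _ ennreal_less_top])
  have AF: "(\<integral>w. A w \<partial>dA) \<le> F"
  proof -
    have "ennreal (\<integral>w. A w \<partial>dA) \<le> ennreal F"
      using A int by (subst nn_integral_eq_integral[symmetric]) (auto simp: A_def)
    then show ?thesis using F by simp
  qed
  have pt: "wt w powr b * cmod (f w) * y \<le> (K * A w + (wt w powr (2 * c - 3) * y\<^sup>2) / K) / 2" if "w \<in> disc" for w y
  proof -
    have p: "wt w > 0" using wt_pos[OF that] .
    have "wt w powr b * cmod (f w) * y = (wt w powr ((2 * b + 3 - 2 * c) / 2) * cmod (f w)) * (wt w powr ((2 * c - 3) / 2) * y)"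
      by (simp add: mult_ac flip: powr_add) (simp add: field_simps flip: powr_add)
    also have "\<dots> \<le> (K * (wt w powr ((2 * b + 3 - 2 * c) / 2) * cmod (f w))\<^sup>2 + (wt w powr ((2 * c - 3) / 2) * y)\<^sup>2 / K) / 2"
      by (rule AM_GM_scaled[OF K])
    also have "\<dots> = (K * A w + (wt w powr (2 * c - 3) * y\<^sup>2) / K) / 2"
      unfolding A_def power_mult_distrib by (simp add: power2_eq_square flip: powr_add)
    finally show ?thesis .
  qed
  have wi: "integrable dA (\<lambda>w. wt w powr (2 * c - 3))"
    using c nn_integral_wt_powr[of "2 * c - 3"] by (intro integrableI_bounded) auto
  show fi: "integrable dA (\<lambda>w. of_real (wt w powr b) * f w)"
  proof (rule Bochner_Integration.integrable_bound)
    show "integrable dA (\<lambda>w. (K * A w + wt w powr (2 * c - 3) / K) / 2)"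
      using A wi by auto
    show "AE w in dA. norm (of_real (wt w powr b) * f w) \<le> norm ((K * A w + wt w powr (2 * c - 3) / K) / 2)"
    proof (rule AE_I2)
      fix w assume "w \<in> space dA"
      then have "norm (of_real (wt w powr b) * f w) \<le> (K * A w + wt w powr (2 * c - 3) / K) / 2"
        using pt[of w 1] by (simp add: norm_mult)
      also have "\<dots> \<le> norm ((K * A w + wt w powr (2 * c - 3) / K) / 2)"
        unfolding real_norm_def by (rule abs_ge_self)
      finally show "norm (of_real (wt w powr b) * f w) \<le> norm ((K * A w + wt w powr (2 * c - 3) / K) / 2)" .
    qed
  qed measurable
  define x where "x n = of_real (binom_coeff c n) * moment b f n" for n
  define X where "X = (\<Sum>n<N. (cmod (x n))\<^sup>2)"
  define q where "q w = (\<Sum>n<N. (of_real (binom_coeff c n) * x n) * w ^ n)" for w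
  have [measurable]: "q \<in> borel_measurable dA" unfolding q_def[abs_def] by measurable
  have qi: "(\<integral>\<^sup>+w. ennreal (wt w powr (2 * c - 3) * (cmod (q w))\<^sup>2) \<partial>dA) \<le> ennreal (K * X)"
  proof -
    have "(\<integral>\<^sup>+w. ennreal (wt w powr (2 * c - 3) * (cmod (q w))\<^sup>2) \<partial>dA) =
        ennreal (\<Sum>n<N. (cmod (of_real (binom_coeff c n) * x n))\<^sup>2 * Beta (2 * c - 3 + 1) (n + 1))"
      unfolding q_def using c by (intro parseval_wt_powr) auto
    also have "\<dots> \<le> ennreal (\<Sum>n<N. K * (cmod (x n))\<^sup>2)"
    proof (intro ennreal_leI sum_mono)
      fix n
      have "(cmod (of_real (binom_coeff c n) * x n))\<^sup>2 * Beta (2 * c - 3 + 1) (n + 1)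
          = ((binom_coeff c n)\<^sup>2 * Beta (2 * c - 2) (n + 1)) * (cmod (x n))\<^sup>2"
        by (simp add: norm_mult power_mult_distrib mult_ac)
      also have "\<dots> \<le> K * (cmod (x n))\<^sup>2"
        unfolding K_def using c by (intro mult_right_mono binom_coeff_square_Beta_le) auto
      finally show "(cmod (of_real (binom_coeff c n) * x n))\<^sup>2 * Beta (2 * c - 3 + 1) (n + 1) \<le> K * (cmod (x n))\<^sup>2" .
    qed
    finally show ?thesis by (simp add: X_def sum_distrib_left)
  qed
  define Q where "Q w = wt w powr (2 * c - 3) * (cmod (q w))\<^sup>2" for w
  have [measurable]: "Q \<in> borel_measurable dA" unfolding Q_def[abs_def] by measurable
  have X: "0 \<le> X" unfolding X_def by (intro sum_nonneg) auto
  have Q: "integrable dA Q"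
    using qi by (intro integrableI_bounded) (auto simp: Q_def intro: le_less_trans[OF _ ennreal_less_top])
  have QX: "(\<integral>w. Q w \<partial>dA) \<le> K * X"
  proof -
    have "ennreal (\<integral>w. Q w \<partial>dA) \<le> ennreal (K * X)"
      using Q qi by (subst nn_integral_eq_integral[symmetric]) (auto simp: Q_def)
    then show ?thesis using X K by simp
  qed
  have "complex_of_real X = (\<Sum>n<N. cnj (x n) * (of_real (binom_coeff c n) * moment b f n))"
    unfolding X_def of_real_sum complex_norm_square x_def by (simp add: mult_ac)
  also have "\<dots> = (\<Sum>n<N. \<integral>w. cnj (of_real (binom_coeff c n) * x n) * (of_real (wt w powr b) * f w * cnj w ^ n) \<partial>dA)"
    unfolding moment_def integral_mult_right_zero by (simp add: mult_ac)
  also have "\<dots> = (\<integral>w. (\<Sum>n<N. cnj (of_real (binom_coeff c n) * x n) * (of_real (wt w powr b) * f w * cnj w ^ n)) \<partial>dA)"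
  proof (rule Bochner_Integration.integral_sum[symmetric])
    fix n
    have "integrable dA (\<lambda>w. of_real (wt w powr b) * f w * cnj w ^ n)"
    proof (rule Bochner_Integration.integrable_bound[OF fi])
      show "AE w in dA. norm (of_real (wt w powr b) * f w * cnj w ^ n) \<le> norm (of_real (wt w powr b) * f w)"
        by (auto simp: norm_mult norm_power intro!: mult_left_le power_le_one)
    qed measurable
    then show "integrable dA (\<lambda>w. cnj (of_real (binom_coeff c n) * x n) * (of_real (wt w powr b) * f w * cnj w ^ n))"
      by (rule integrable_mult_right)
  qed
  also have "\<dots> = (\<integral>w. of_real (wt w powr b) * f w * cnj (q w) \<partial>dA)"
    by (simp add: q_def sum_distrib_left mult_ac)
  finally have Xeq: "complex_of_real X = (\<integral>w. of_real (wt w powr b) * f w * cnj (q w) \<partial>dA)" .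
  have "X = cmod (complex_of_real X)" using X by simp
  also have "\<dots> \<le> (\<integral>w. cmod (of_real (wt w powr b) * f w * cnj (q w)) \<partial>dA)"
    unfolding Xeq by (rule integral_norm_bound)
  also have "\<dots> \<le> (\<integral>w. (K * A w + Q w / K) / 2 \<partial>dA)"
  proof (rule integral_mono)
    show mi: "integrable dA (\<lambda>w. (K * A w + Q w / K) / 2)" using A Q by auto
    have le: "norm (of_real (wt w powr b) * f w * cnj (q w)) \<le> (K * A w + Q w / K) / 2" if "w \<in> disc" for w
      using pt[OF that, of "cmod (q w)"] by (simp add: norm_mult Q_def)
    then show "norm (of_real (wt w powr b) * f w * cnj (q w)) \<le> (K * A w + Q w / K) / 2" if "w \<in> space dA" for w
      using that by simp
    show "integrable dA (\<lambda>w. cmod (of_real (wt w powr b) * f w * cnj (q w)))"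
    proof (rule integrable_norm, rule Bochner_Integration.integrable_bound[OF mi])
      show "AE w in dA. norm (of_real (wt w powr b) * f w * cnj (q w)) \<le> norm ((K * A w + Q w / K) / 2)"
        by (rule AE_I2) (metis le real_norm_def abs_ge_self order_trans space_dA)
    qed measurable
  qed
  also have "\<dots> = (K * (\<integral>w. A w \<partial>dA) + (\<integral>w. Q w \<partial>dA) / K) / 2"
    using A Q by simp
  also have "\<dots> \<le> (K * F + (K * X) / K) / 2"
    using AF QX K by (intro divide_right_mono add_mono mult_left_mono) auto
  finally have "X \<le> K * F" using K by (simp add: field_simps)
  then show "(\<Sum>n<N. (cmod (of_real (binom_coeff c n) * moment b f n))\<^sup>2) \<le> K * F"
    by (simp add: X_def x_def)
qed

text \<open>Square-summable coefficients put the analytic factor g in the Hardy space, with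
  quadratic means at most K F on all circles. The set where \<open>t * wt z < cmod (g z)\<close> is
  cut at \<open>wt z = s\<close>: the outer ring has measure s, and inside it Chebyshev's inequality
  with the weight 1 / wt^2, of integral at most 1 / s, gives K F / (t^2 s).\<close>

lemma weak_L1_norm_T_L2:
  fixes f :: "complex \<Rightarrow> complex"
  assumes c: "1 < c" and f[measurable]: "f \<in> borel_measurable dA" and F: "0 < F"
    and int: "(\<integral>\<^sup>+w. ennreal (wt w powr (2 * b + 3 - 2 * c) * (cmod (f w))\<^sup>2) \<partial>dA) \<le> ennreal F"
  defines "K \<equiv> Gamma (2 * c - 2) / (Gamma c)\<^sup>2"
  shows "weak_L1_norm (op_apply (T_op (-1) b c) f) \<le> ennreal (2 * sqrt (K * F))"
    and "z \<in> disc \<Longrightarrow> op_converges (T_op (-1) b c) f z"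
proof -
  have K: "K > 0" unfolding K_def using c by (intro divide_pos_pos zero_less_power Gamma_real_pos) auto
  have F0: "0 \<le> F" using F by simp
  have fi: "integrable dA (\<lambda>w. of_real (wt w powr b) * f w)"
    by (rule L2_coefficient_bound(1)[OF c f F0 int])
  define x where "x n = of_real (binom_coeff c n) * moment b f n" for n
  define g where "g z = (\<Sum>n. x n * z ^ n)" for z
  have xN: "(\<Sum>n<N. (cmod (x n))\<^sup>2) \<le> K * F" for N
    unfolding x_def K_def by (rule L2_coefficient_bound(2)[OF c f F0 int])
  have x1: "cmod (x n) \<le> sqrt (K * F)" for n
  proof -
    have "(cmod (x n))\<^sup>2 \<le> (\<Sum>n<Suc n. (cmod (x n))\<^sup>2)" by (simp add: sum_nonneg)
    then show ?thesis using xN[of "Suc n"] by (intro real_le_rsqrt) linarith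
  qed
  have sm: "summable (\<lambda>n. cmod (x n) * r ^ n)" if "0 \<le> r" "r < 1" for r
  proof (rule summable_comparison_test'[of "\<lambda>n. sqrt (K * F) * r ^ n" 0])
    show "summable (\<lambda>n. sqrt (K * F) * r ^ n)" using that by (intro summable_mult summable_geometric) auto
    show "norm (cmod (x n) * r ^ n) \<le> sqrt (K * F) * r ^ n" for n
      using that x1[of n] by (simp add: abs_mult mult_right_mono)
  qed
  have zz: "integrable dA (\<lambda>w. kernel (T_op (-1) b c) z w * f w)"
    "(\<integral>w. kernel (T_op (-1) b c) z w * f w \<partial>dA) = g z" if z: "z \<in> disc" for z
  proof -
    have r: "cmod z < 1" "cmod (z * cnj w) \<le> cmod z" if "w \<in> disc" for w
      using z that mult_left_le[of "cmod w" "cmod z"] by (auto simp: norm_mult)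
    note * = kernel_T_expansion[OF _ fi, of c z "cmod z" "-1"]
    show "integrable dA (\<lambda>w. kernel (T_op (-1) b c) z w * f w)"
      using * c z r by auto
    show "(\<integral>w. kernel (T_op (-1) b c) z w * f w \<partial>dA) = g z"
      using * c z r unfolding g_def x_def by (auto simp: sums_iff)
  qed
  show "z \<in> disc \<Longrightarrow> op_converges (T_op (-1) b c) f z"
    using zz(1) by (simp add: op_converges_def)
  have gm[measurable]: "g \<in> borel_measurable dA" unfolding g_def[abs_def] by measurable
  have gborel[measurable]: "g \<in> borel_measurable borel" unfolding g_def[abs_def] by measurable
  show "weak_L1_norm (op_apply (T_op (-1) b c) f) \<le> ennreal (2 * sqrt (K * F))"
  proof (rule weak_L1_normI)
    fix t :: real assume t: "0 < t"
    \<comment> \<open>The value that balances the two contributions, K F / (t^2 s) = s. If it is at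
      least 1, the total mass 1 is already a sufficient bound.\<close>
    define s where "s = sqrt (K * F) / t"
    have s: "s > 0" "t * s = sqrt (K * F)" using t K F by (auto simp: s_def)
    define B where "B = {z \<in> disc. cmod (op_apply (T_op (-1) b c) f z) > t}"
    have B: "B = {z \<in> disc. t * wt z < cmod (g z)}"
    proof -
      have "t < cmod (op_apply (T_op (-1) b c) f z) \<longleftrightarrow> t * wt z < cmod (g z)" if z: "z \<in> disc" for z
        using wt_pos[OF z] zz(2)[OF z]
        by (simp add: op_apply_def factor_eq norm_mult norm_divide powr_minus divide_inverse[symmetric] field_simps)
      then show ?thesis unfolding B_def by auto
    qed
    have "ennreal t * emeasure dA B \<le> ennreal (2 * sqrt (K * F))"
    proof (cases "1 \<le> s")
      case True
      have "ennreal t * emeasure dA B \<le> ennreal t * 1"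
        by (intro mult_left_mono dA.measure_le_1) auto
      also have "\<dots> \<le> ennreal (2 * sqrt (K * F))"
        using True t K F mult_left_mono[OF True, of t] s by (auto intro!: ennreal_leI)
      finally show ?thesis .
    next
      case False
      define \<phi> where "\<phi> x = ennreal (1 / x\<^sup>2) * indicator {s<..} x" for x :: real
      have [measurable]: "\<phi> \<in> borel_measurable borel" unfolding \<phi>_def by measurable
      define S1 where "S1 = {z \<in> disc. wt z \<le> s}"
      define S2 where "S2 = {z \<in> disc. s < wt z \<and> t * wt z < cmod (g z)}"
      have m: "S1 \<in> sets dA" "S2 \<in> sets dA"
        unfolding S1_def S2_def by (intro disc_sets_dA; measurable)+
      have "emeasure dA B \<le> emeasure dA (S1 \<union> S2)"
        using m by (intro emeasure_mono) (auto simp: B S1_def S2_def)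
      also have "\<dots> \<le> emeasure dA S1 + emeasure dA S2"
        using m by (rule emeasure_subadditive)
      also have "emeasure dA S1 = ennreal s"
        unfolding S1_def using s False by (intro emeasure_dA_wt_le) auto
      also have "emeasure dA S2 \<le> ennreal (s)"
      proof -
        have "emeasure dA S2 = (\<integral>\<^sup>+z. indicator S2 z \<partial>dA)" using m by simp
        also have "\<dots> \<le> (\<integral>\<^sup>+z. ennreal (1 / t\<^sup>2) * (\<phi> (wt z) * ennreal ((cmod (g z))\<^sup>2)) \<partial>dA)"
        proof (rule nn_integral_mono)
          fix z
          show "indicator S2 z \<le> ennreal (1 / t\<^sup>2) * (\<phi> (wt z) * ennreal ((cmod (g z))\<^sup>2))"
          proof (cases "z \<in> S2")
            case True
            then have z: "s < wt z" "t * wt z < cmod (g z)" by (auto simp: S2_def)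
            have "(t * wt z)\<^sup>2 \<le> (cmod (g z))\<^sup>2"
              using z t s by (intro power_mono) auto
            then have "1 \<le> 1 / t\<^sup>2 * (1 / (wt z)\<^sup>2 * (cmod (g z))\<^sup>2)"
              using t z s by (simp add: power_mult_distrib field_simps)
            then have "1 \<le> ennreal (1 / t\<^sup>2 * (1 / (wt z)\<^sup>2 * (cmod (g z))\<^sup>2))" by simp
            then show ?thesis using True z(1) unfolding \<phi>_def
              by (simp add: ennreal_mult flip: ennreal_mult)
          qed simp
        qed
        also have "\<dots> = ennreal (1 / t\<^sup>2) * (\<integral>\<^sup>+z. \<phi> (wt z) * ennreal ((cmod (g z))\<^sup>2) \<partial>dA)"
          by (rule nn_integral_cmult) measurable
        also have "(\<integral>\<^sup>+z. \<phi> (wt z) * ennreal ((cmod (g z))\<^sup>2) \<partial>dA) =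
            (\<integral>\<^sup>+z. \<phi> (wt z) * ennreal (\<Sum>n. (cmod (x n))\<^sup>2 * cmod z ^ (2 * n)) \<partial>dA)"
          unfolding g_def using sm by (intro parseval_radial(1)) measurable
        also have "\<dots> \<le> (\<integral>\<^sup>+z. \<phi> (wt z) * ennreal (K * F) \<partial>dA)"
        proof (intro nn_integral_mono mult_left_mono ennreal_leI)
          fix z assume "z \<in> space dA"
          then have z: "z \<in> disc" by simp
          show "(\<Sum>n. (cmod (x n))\<^sup>2 * cmod z ^ (2 * n)) \<le> K * F"
          proof (rule suminf_le_const)
            show "summable (\<lambda>n. (cmod (x n))\<^sup>2 * cmod z ^ (2 * n))"
              using parseval_radial(2)[of "\<lambda>_. 0" x z] sm z by auto
            fix N
            have "(\<Sum>n<N. (cmod (x n))\<^sup>2 * cmod z ^ (2 * n)) \<le> (\<Sum>n<N. (cmod (x n))\<^sup>2 * 1)"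
              using z by (intro sum_mono mult_left_mono power_le_one) auto
            then show "(\<Sum>n<N. (cmod (x n))\<^sup>2 * cmod z ^ (2 * n)) \<le> K * F" using xN[of N] by simp
          qed
        qed auto
        also have "\<dots> = (\<integral>\<^sup>+z. \<phi> (wt z) \<partial>dA) * ennreal (K * F)"
          by (rule nn_integral_multc) measurable
        also have "(\<integral>\<^sup>+z. \<phi> (wt z) \<partial>dA) = (\<integral>\<^sup>+z\<in>{z. s < wt z}. ennreal (1 / (wt z)\<^sup>2) \<partial>dA)"
          by (intro nn_integral_cong) (auto simp: \<phi>_def indicator_def)
        also have "\<dots> \<le> ennreal (1 / s)"
          using s False by (intro nn_integral_wt_inverse_square) auto
        finally have "emeasure dA S2 \<le> ennreal (1 / t\<^sup>2) * (ennreal (1 / s) * ennreal (K * F))"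
          by (simp add: mult_left_mono mult_right_mono)
        also have "\<dots> = ennreal (1 / t\<^sup>2 * (1 / s * (K * F)))"
          using t s K F by (simp flip: ennreal_mult)
        also have "1 / t\<^sup>2 * (1 / s * (K * F)) = s"
        proof -
          have "K * F = (t * s)\<^sup>2" unfolding s(2) using K F by simp
          then show ?thesis using t s(1) by (simp add: power2_eq_square)
        qed
        finally show ?thesis .
      qed
      finally have "emeasure dA B \<le> ennreal (2 * s)"
        using s by (simp flip: ennreal_plus)
      then have "ennreal t * emeasure dA B \<le> ennreal t * ennreal (2 * s)"
        by (intro mult_left_mono) auto
      also have "\<dots> = ennreal (2 * (t * s))"
        using t s(1) by (simp add: mult_ac flip: ennreal_mult)
      also have "\<dots> = ennreal (2 * sqrt (K * F))"
        unfolding s(2) ..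
      finally show ?thesis .
    qed
    then show "ennreal t * emeasure dA {z \<in> disc. cmod (op_apply (T_op (-1) b c) f z) > t} \<le> ennreal (2 * sqrt (K * F))"
      unfolding B_def .
  qed
qed

section \<open>Boundedness\<close>

lemma op_apply_measurable:
  assumes Op: "Op = T_op a b c \<or> Op = S_op a b c" and [measurable]: "f \<in> borel_measurable dA"
  shows "op_apply Op f \<in> borel_measurable dA"
proof -
  have [measurable]: "(\<lambda>z. factor Op z) \<in> borel_measurable dA"
    using Op by (elim disjE) (simp_all only: factor_eq, measurable)
  have [measurable]: "(\<lambda>x. kernel Op (fst x) (snd x)) \<in> borel_measurable (dA \<Otimes>\<^sub>M dA)"
    by (rule kernel_measurable[OF Op]) measurable
  have "(\<lambda>z. \<integral>w. kernel Op z w * f w \<partial>dA) \<in> borel_measurable dA"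
    by (rule dA.borel_measurable_lebesgue_integral) (simp add: case_prod_beta, measurable)
  then show ?thesis unfolding op_apply_def[abs_def] by measurable
qed

text \<open>The two kernels have the same modulus, so T and S converge absolutely at the same
  points.\<close>

lemma op_converges_iff:
  assumes Op: "Op = T_op a b c \<or> Op = S_op a b c" and [measurable]: "f \<in> borel_measurable dA"
  shows "op_converges Op f z \<longleftrightarrow> integrable dA (\<lambda>w. cmod (kernel (T_op a b c) z w) * cmod (f w))"
proof -
  have m: "(\<lambda>w. kernel Op z w * f w) \<in> borel_measurable dA"
    using kernel_measurable[OF Op, of "\<lambda>_. z" dA "\<lambda>w. w"] by measurable
  have "op_converges Op f z \<longleftrightarrow> integrable dA (\<lambda>w. norm (kernel Op z w * f w))"
    unfolding op_converges_def using integrable_norm_iff[OF m] by simp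
  also have "(\<lambda>w. norm (kernel Op z w * f w)) = (\<lambda>w. cmod (kernel (T_op a b c) z w) * cmod (f w))"
    using kernel_norm[OF Op] kernel_norm[of "T_op a b c" a b c] by (simp add: norm_mult)
  finally show ?thesis .
qed

lemma op_convergesI:
  assumes "0 < c" and Op: "Op = T_op a b c \<or> Op = S_op a b c" and f[measurable]: "f \<in> borel_measurable dA"
    and int: "integrable dA (\<lambda>w. of_real (wt w powr b) * f w)" and z: "z \<in> disc"
  shows "op_converges Op f z"
proof -
  have "integrable dA (\<lambda>w. kernel (T_op a b c) z w * f w)"
  proof (rule kernel_T_expansion(1)[OF \<open>0 < c\<close> int])
    show "cmod z < 1" "cmod z \<le> 1" using z by auto
    show "cmod (z * cnj w) \<le> cmod z" if "w \<in> disc" for w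
      using z that mult_left_le[of "cmod w" "cmod z"] by (auto simp: norm_mult)
  qed
  then have "op_converges (T_op a b c) f z" by (simp add: op_converges_def)
  then show ?thesis
    using op_converges_iff[OF Op f] op_converges_iff[of "T_op a b c", OF _ f] by blast
qed

lemma maps_boundedly_weakI:
  assumes Op: "Op = T_op a b c \<or> Op = S_op a b c"
    and conv: "\<And>f z. f \<in> borel_measurable dA \<Longrightarrow> N f < \<infinity> \<Longrightarrow> z \<in> disc \<Longrightarrow> op_converges Op f z"
    and bound: "\<And>f. f \<in> borel_measurable dA \<Longrightarrow> N f < \<infinity> \<Longrightarrow> weak_L1_norm (op_apply Op f) \<le> ennreal C * N f"
  shows "maps_boundedly Op N weak_L1_norm"
  unfolding maps_boundedly_def
proof (intro exI[of _ C] ballI conjI)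
  fix f assume "f \<in> fun_space N"
  then have f: "f \<in> borel_measurable dA" "N f < \<infinity>" by (auto simp: fun_space_def)
  show "AE z in dA. op_converges Op f z" using conv[OF f] by (intro AE_I2) simp
  show "weak_L1_norm (op_apply Op f) \<le> ennreal C * N f" by (rule bound[OF f])
  also have "\<dots> < \<infinity>" using f by (simp add: ennreal_mult_less_top)
  finally show "op_apply Op f \<in> fun_space weak_L1_norm"
    using op_apply_measurable[OF Op f(1)] by (simp add: fun_space_def)
qed

lemma integrable_wt_powr_mult:
  assumes c: "1 \<le> c" and [measurable]: "f \<in> borel_measurable dA"
    and fin: "(\<integral>\<^sup>+w. ennreal (wt w powr (b + 1 - c) * cmod (f w)) \<partial>dA) < \<infinity>"
  shows "integrable dA (\<lambda>w. of_real (wt w powr b) * f w)"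
proof (rule integrableI_bounded)
  have "(\<integral>\<^sup>+w. ennreal (norm (of_real (wt w powr b) * f w)) \<partial>dA) \<le> (\<integral>\<^sup>+w. ennreal (wt w powr (b + 1 - c) * cmod (f w)) \<partial>dA)"
  proof (intro nn_integral_mono ennreal_leI)
    fix w assume "w \<in> space dA"
    then have "wt w powr b \<le> wt w powr (b + 1 - c)"
      using wt_pos[of w] wt_le_1[of w] c by (intro powr_mono') auto
    then show "norm (of_real (wt w powr b) * f w) \<le> wt w powr (b + 1 - c) * cmod (f w)"
      by (simp add: norm_mult mult_right_mono)
  qed
  with fin show "(\<integral>\<^sup>+w. ennreal (norm (of_real (wt w powr b) * f w)) \<partial>dA) < \<infinity>" by (rule le_less_trans[rotated])
qed measurable

text \<open>Every positive result without cancellation is thereby reduced to embedding the source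
  space into L^1 with weight \<open>wt powr (\<sigma> - 1)\<close>; note b + 1 - c = \<sigma> -
  1.\<close>

lemma maps_boundedly_weighted_L1:
  assumes c: "1 < c" and Op: "Op = T_op (-1) b c \<or> Op = S_op (-1) b c"
    and bound: "\<And>f. f \<in> borel_measurable dA \<Longrightarrow> N f < \<infinity> \<Longrightarrow>
      (\<integral>\<^sup>+w. ennreal (wt w powr (b + 1 - c) * cmod (f w)) \<partial>dA) \<le> ennreal C * N f" and C: "0 \<le> C"
  shows "maps_boundedly Op N weak_L1_norm"
proof (rule maps_boundedly_weakI[OF Op])
  fix f z assume f: "f \<in> borel_measurable dA" "N f < \<infinity>"
  let ?D = "2 powr c * (Gamma (c - 1) / (Gamma (c / 2))\<^sup>2)"
  have D: "?D \<ge> 0" using c by auto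
  have "weak_L1_norm (op_apply Op f) \<le> ennreal ?D * (\<integral>\<^sup>+w. ennreal (wt w powr (b + 1 - c) * cmod (f w)) \<partial>dA)"
    by (rule weak_L1_norm_op_le[OF c Op f(1)])
  also have "\<dots> \<le> ennreal ?D * (ennreal C * N f)"
    using bound[OF f] by (rule mult_left_mono) simp
  also have "\<dots> = ennreal (?D * C) * N f"
    unfolding ennreal_mult[OF D C] by (rule mult.assoc[symmetric])
  finally show "weak_L1_norm (op_apply Op f) \<le> ennreal (?D * C) * N f" .
  have "ennreal C * N f < \<infinity>" using f by (simp add: ennreal_mult_less_top)
  then have "(\<integral>\<^sup>+w. ennreal (wt w powr (b + 1 - c) * cmod (f w)) \<partial>dA) < \<infinity>"
    using bound[OF f] by (rule le_less_trans[rotated])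
  from integrable_wt_powr_mult[OF _ f(1) this] c
  show "z \<in> disc \<Longrightarrow> op_converges Op f z" by (intro op_convergesI[OF _ Op f(1)]) auto
qed

section \<open>Embeddings into the weighted \<open>L^1\<close> space\<close>

lemma Lp_norm_finiteE:
  assumes "0 < p" and fin: "Lp_norm (ereal p) f < \<infinity>"
  obtains M where "0 \<le> M" "Lp_norm (ereal p) f = ennreal M" "(\<integral>\<^sup>+z. ennreal (cmod (f z) powr p) \<partial>dA) = ennreal (M powr p)"
proof -
  define X where "X = (\<integral>\<^sup>+z. ennreal (cmod (f z) powr p) \<partial>dA)"
  have L: "Lp_norm (ereal p) f = enn_powr X (1 / p)" by (simp add: Lp_norm_def X_def)
  then have X: "X < \<infinity>" using fin by (auto simp: enn_powr_def less_top split: if_splits)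
  show ?thesis
  proof (rule that[of "enn2real X powr (1 / p)"])
    show "Lp_norm (ereal p) f = ennreal (enn2real X powr (1 / p))"
      using X unfolding L by (auto simp: enn_powr_def)
    have "ennreal ((enn2real X powr (1 / p)) powr p) = X"
      using X \<open>0 < p\<close> by (simp add: powr_powr less_top)
    then show "(\<integral>\<^sup>+z. ennreal (cmod (f z) powr p) \<partial>dA) = ennreal ((enn2real X powr (1 / p)) powr p)"
      by (simp add: X_def)
  qed simp
qed

lemma nn_integral_powr_eq_0D:
  assumes [measurable]: "f \<in> borel_measurable dA" and "(\<integral>\<^sup>+z. ennreal (cmod (f z) powr p) \<partial>dA) = 0"
  shows "(\<integral>\<^sup>+z. ennreal (wt z powr \<kappa> * cmod (f z)) \<partial>dA) = 0"
proof -
  have "AE z in dA. ennreal (cmod (f z) powr p) = 0"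
    using assms by (subst (asm) nn_integral_0_iff_AE) auto
  then have "AE z in dA. ennreal (wt z powr \<kappa> * cmod (f z)) = 0"
    by eventually_elim (auto simp: ennreal_eq_0_iff)
  then show ?thesis by (subst nn_integral_0_iff_AE) auto
qed

text \<open>Pointwise form of Hoelder's inequality: the case distinction is at a =
  \<open>M * \<phi> powr (1 / (p - 1))\<close>, where the two terms on the right coincide. With M
  the L^p norm of a, the second term integrates to M.\<close>

lemma powr_mult_le_Young:
  fixes \<phi> a M p :: real
  assumes p: "1 < p" and M: "0 < M" and \<phi>: "0 < \<phi>" and a: "0 \<le> a"
  shows "\<phi> * a \<le> M * \<phi> powr (p / (p - 1)) + M powr (1 - p) * a powr p"
proof (cases "a \<le> M * \<phi> powr (1 / (p - 1))")
  case True
  then have "\<phi> * a \<le> \<phi> * (M * \<phi> powr (1 / (p - 1)))" using \<phi> by (intro mult_left_mono) auto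
  also have "\<dots> = M * \<phi> powr (1 + 1 / (p - 1))" using \<phi> by (simp add: powr_add)
  also have "1 + 1 / (p - 1) = p / (p - 1)" using p by (simp add: field_simps)
  finally show ?thesis by (simp add: add_increasing2)
next
  case False
  then have a0: "a > 0" using M by (smt (verit) mult_nonneg_nonneg powr_ge_zero)
  have "(\<phi> powr (1 / (p - 1))) powr (p - 1) \<le> (a / M) powr (p - 1)"
    using False M p by (intro powr_mono2) (auto simp: field_simps)
  then have "\<phi> \<le> (a / M) powr (p - 1)" using \<phi> p by (simp add: powr_powr)
  then have "\<phi> * a \<le> (a / M) powr (p - 1) * a" using a by (rule mult_right_mono)
  also have "\<dots> = M powr (1 - p) * a powr p"
    using M a0 by (simp add: powr_divide powr_diff field_simps)
  finally show ?thesis using M by (simp add: add_increasing)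
qed

text \<open>The condition on \<kappa> says that \<open>wt powr \<kappa>\<close> belongs to the dual
  space, with exponent p / (p - 1).\<close>

lemma weighted_L1_le_Lp:
  assumes p: "1 < p" and \<kappa>: "-1 < \<kappa> * (p / (p - 1))" and f[measurable]: "f \<in> borel_measurable dA"
    and fin: "Lp_norm (ereal p) f < \<infinity>"
  shows "(\<integral>\<^sup>+w. ennreal (wt w powr \<kappa> * cmod (f w)) \<partial>dA) \<le> ennreal (1 / (\<kappa> * (p / (p - 1)) + 1) + 1) * Lp_norm (ereal p) f"
proof -
  obtain M where M: "0 \<le> M" "Lp_norm (ereal p) f = ennreal M" "(\<integral>\<^sup>+z. ennreal (cmod (f z) powr p) \<partial>dA) = ennreal (M powr p)"
    using Lp_norm_finiteE[of p f] p fin by auto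
  show ?thesis
  proof (cases "M = 0")
    case True
    then show ?thesis using nn_integral_powr_eq_0D[OF f, of p \<kappa>] M(3) by simp
  next
    case False
    then have M0: "M > 0" using M by simp
    have "(\<integral>\<^sup>+w. ennreal (wt w powr \<kappa> * cmod (f w)) \<partial>dA) \<le>
       (\<integral>\<^sup>+w. ennreal M * ennreal (wt w powr (\<kappa> * (p / (p - 1)))) + ennreal (M powr (1 - p)) * ennreal (cmod (f w) powr p) \<partial>dA)"
    proof (rule nn_integral_mono)
      fix w assume "w \<in> space dA"
      then have "wt w powr \<kappa> * cmod (f w) \<le> M * (wt w powr \<kappa>) powr (p / (p - 1)) + M powr (1 - p) * cmod (f w) powr p"
        using wt_pos[of w] by (intro powr_mult_le_Young[OF p M0]) auto
      then show "ennreal (wt w powr \<kappa> * cmod (f w)) \<le> ennreal M * ennreal (wt w powr (\<kappa> * (p / (p - 1)))) + ennreal (M powr (1 - p)) * ennreal (cmod (f w) powr p)"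
        using M0 by (simp add: powr_powr ennreal_leI flip: ennreal_mult ennreal_plus)
    qed
    also have "\<dots> = ennreal M * (\<integral>\<^sup>+w. ennreal (wt w powr (\<kappa> * (p / (p - 1)))) \<partial>dA)
        + ennreal (M powr (1 - p)) * (\<integral>\<^sup>+w. ennreal (cmod (f w) powr p) \<partial>dA)"
      by (simp add: nn_integral_add nn_integral_cmult)
    also have "\<dots> = ennreal M * ennreal (1 / (\<kappa> * (p / (p - 1)) + 1)) + ennreal (M powr (1 - p)) * ennreal (M powr p)"
      unfolding nn_integral_wt_powr[OF \<kappa>] M(3) ..
    also have "\<dots> = ennreal ((1 / (\<kappa> * (p / (p - 1)) + 1) + 1) * M)"
    proof -
      have "M powr (1 - p) * M powr p = M" using M0 by (simp flip: powr_add)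
      then show ?thesis using \<kappa> M0 by (simp add: algebra_simps flip: ennreal_mult ennreal_plus)
    qed
    also have "\<dots> = ennreal (1 / (\<kappa> * (p / (p - 1)) + 1) + 1) * ennreal M"
      using \<kappa> M by (intro ennreal_mult) auto
    finally show ?thesis unfolding M(2) .
  qed
qed

lemma weighted_L1_le_Linf:
  assumes \<kappa>: "-1 < \<kappa>" and f[measurable]: "f \<in> borel_measurable dA"
  shows "(\<integral>\<^sup>+w. ennreal (wt w powr \<kappa> * cmod (f w)) \<partial>dA) \<le> ennreal (1 / (\<kappa> + 1)) * Lp_norm \<infinity> f"
proof -
  have "AE w in dA. ennreal (cmod (f w)) \<le> Lp_norm \<infinity> f"
    unfolding Lp_norm_def by (simp add: esssup_AE)
  then have "(\<integral>\<^sup>+w. ennreal (wt w powr \<kappa> * cmod (f w)) \<partial>dA) \<le> (\<integral>\<^sup>+w. ennreal (wt w powr \<kappa>) * Lp_norm \<infinity> f \<partial>dA)"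
    by (intro nn_integral_mono_AE, elim eventually_mono) (auto simp: ennreal_mult intro!: mult_left_mono)
  also have "\<dots> = ennreal (1 / (\<kappa> + 1)) * Lp_norm \<infinity> f"
    by (subst nn_integral_multc) (auto simp: nn_integral_wt_powr[OF \<kappa>])
  finally show ?thesis .
qed

text \<open>The weight decreases in \<open>wt\<close>, so among the sets of measure s the ring
  \<open>wt z \<le> s\<close> is the worst. The integral over that ring is explicit, and off it the
  weight is at most \<open>s powr \<kappa>\<close>.\<close>

lemma set_integral_wt_powr_le:
  assumes \<kappa>: "-1 < \<kappa>" "\<kappa> \<le> 0" and E[measurable]: "E \<in> sets dA"
  shows "(\<integral>\<^sup>+w\<in>E. ennreal (wt w powr \<kappa>) \<partial>dA) \<le> ennreal ((1 / (\<kappa> + 1) + 1) * measure dA E powr (\<kappa> + 1))"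
proof (cases "measure dA E = 0")
  case True
  then have "emeasure dA E = 0" by (simp add: dA.emeasure_eq_measure)
  then have "AE w in dA. w \<notin> E" using E by (intro AE_not_in) auto
  then have "(\<integral>\<^sup>+w\<in>E. ennreal (wt w powr \<kappa>) \<partial>dA) = (\<integral>\<^sup>+w. 0 \<partial>dA)"
    by (intro nn_integral_cong_AE, elim eventually_mono) auto
  then show ?thesis using True by simp
next
  case False
  define s where "s = measure dA E"
  have s: "0 < s" "s \<le> 1" using False by (auto simp: s_def less_le)
  have "(\<integral>\<^sup>+w\<in>E. ennreal (wt w powr \<kappa>) \<partial>dA) \<le>
      (\<integral>\<^sup>+w. ennreal (wt w powr \<kappa>) * indicator {z. wt z \<le> s} w + ennreal (s powr \<kappa>) * indicator E w \<partial>dA)"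
  proof (rule nn_integral_mono)
    fix w
    have "wt w powr \<kappa> \<le> s powr \<kappa>" if "s < wt w" using that s \<kappa> by (intro powr_mono2') auto
    then show "ennreal (wt w powr \<kappa>) * indicator E w \<le> ennreal (wt w powr \<kappa>) * indicator {z. wt z \<le> s} w + ennreal (s powr \<kappa>) * indicator E w"
      by (auto simp: indicator_def ennreal_leI not_le)
  qed
  also have "\<dots> = (\<integral>\<^sup>+w\<in>{z. wt z \<le> s}. ennreal (wt w powr \<kappa>) \<partial>dA) + ennreal (s powr \<kappa>) * emeasure dA E"
  proof -
    have "(\<lambda>w. ennreal (wt w powr \<kappa>) * indicator {z. wt z \<le> s} w) \<in> borel_measurable dA" by measurable
    then show ?thesis by (simp add: nn_integral_add nn_integral_cmult_indicator)
  qed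
  also have "\<dots> = ennreal (s powr (\<kappa> + 1) / (\<kappa> + 1) + s powr \<kappa> * s)"
    using \<kappa> s by (simp add: nn_integral_wt_powr_le dA.emeasure_eq_measure flip: s_def ennreal_mult ennreal_plus)
  also have "s powr (\<kappa> + 1) / (\<kappa> + 1) + s powr \<kappa> * s = (1 / (\<kappa> + 1) + 1) * s powr (\<kappa> + 1)"
    using s \<kappa> by (simp add: powr_add field_simps)
  finally show ?thesis by (simp add: s_def)
qed

text \<open>The layer cake formula reduces the claim to superlevel sets; the power \<kappa> + 1 of
  their measure is precisely the 1/p of the Lorentz norm.\<close>

lemma weighted_L1_le_Lorentz:
  assumes \<kappa>: "-1 < \<kappa>" "\<kappa> \<le> 0" and f[measurable]: "f \<in> borel_measurable dA"
  shows "(\<integral>\<^sup>+w. ennreal (wt w powr \<kappa> * cmod (f w)) \<partial>dA) \<le> ennreal (1 / (\<kappa> + 1) + 1) * Lorentz_p1_norm (1 / (\<kappa> + 1)) f"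
proof -
  interpret pair_sigma_finite dA lborel ..
  define E where "E t = {z \<in> disc. cmod (f z) > t}" for t :: real
  have E: "E t \<in> sets dA" for t
  proof -
    have "{z \<in> space dA. cmod (f z) > t} \<in> sets dA" by measurable
    then show ?thesis by (simp add: E_def)
  qed
  define C where "C = 1 / (\<kappa> + 1) + 1"
  have C: "C \<ge> 0" using \<kappa> by (simp add: C_def)
  have "(\<integral>\<^sup>+w. ennreal (wt w powr \<kappa> * cmod (f w)) \<partial>dA) =
      (\<integral>\<^sup>+w. \<integral>\<^sup>+t. ennreal (wt w powr \<kappa>) * indicator {0<..<cmod (f w)} t \<partial>lborel \<partial>dA)"
    by (intro nn_integral_cong) (simp add: nn_integral_cmult ennreal_mult)
  \<comment> \<open>In this form the integrand is visibly measurable in w and t jointly, as the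
    exchange of integrals requires.\<close>
  also have "\<dots> = (\<integral>\<^sup>+w. \<integral>\<^sup>+t. ennreal (wt w powr \<kappa>) * (if 0 < t \<and> t < cmod (f w) then 1 else 0) \<partial>lborel \<partial>dA)"
    by (intro nn_integral_cong) (auto simp: indicator_def)
  also have "\<dots> = (\<integral>\<^sup>+t. \<integral>\<^sup>+w. ennreal (wt w powr \<kappa>) * (if 0 < t \<and> t < cmod (f w) then 1 else 0) \<partial>dA \<partial>lborel)"
  proof (rule Fubini'[symmetric])
    show "(\<lambda>(w, t). ennreal (wt w powr \<kappa>) * (if 0 < t \<and> t < cmod (f w) then 1 else 0)) \<in> borel_measurable (dA \<Otimes>\<^sub>M lborel)"
      by measurable
  qed
  also have "\<dots> = (\<integral>\<^sup>+t\<in>{0<..}. (\<integral>\<^sup>+w\<in>E t. ennreal (wt w powr \<kappa>) \<partial>dA) \<partial>lborel)"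
  proof (rule nn_integral_cong)
    fix t :: real
    show "(\<integral>\<^sup>+w. ennreal (wt w powr \<kappa>) * (if 0 < t \<and> t < cmod (f w) then 1 else 0) \<partial>dA)
        = (\<integral>\<^sup>+w\<in>E t. ennreal (wt w powr \<kappa>) \<partial>dA) * indicator {0<..} t"
    proof (cases "0 < t")
      case True
      then show ?thesis by (simp, intro nn_integral_cong) (auto simp: E_def indicator_def)
    qed simp
  qed
  also have "\<dots> \<le> (\<integral>\<^sup>+t\<in>{0<..}. ennreal C * ennreal (distr_fun f t powr (\<kappa> + 1)) \<partial>lborel)"
  proof (intro nn_integral_mono mult_right_mono)
    fix t :: real
    show "(\<integral>\<^sup>+w\<in>E t. ennreal (wt w powr \<kappa>) \<partial>dA) \<le> ennreal C * ennreal (distr_fun f t powr (\<kappa> + 1))"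
      using set_integral_wt_powr_le[OF \<kappa> E[of t]] C by (simp add: C_def distr_fun_def E_def ennreal_mult)
  qed simp
  also have "\<dots> = ennreal C * (\<integral>\<^sup>+t\<in>{0<..}. ennreal (distr_fun f t powr (\<kappa> + 1)) \<partial>lborel)"
  proof -
    have [measurable]: "(\<lambda>t. distr_fun f t) \<in> borel_measurable lborel"
    proof -
      have "mono (\<lambda>t. - distr_fun f t)"
        unfolding mono_def distr_fun_def using E by (auto intro!: dA.finite_measure_mono simp: E_def)
      then have "(\<lambda>t. - (- distr_fun f t)) \<in> borel_measurable borel"
        by (intro borel_measurable_uminus borel_measurable_mono)
      then show ?thesis by simp
    qed
    show ?thesis by (simp add: nn_integral_cmult mult.assoc)
  qed
  \<comment> \<open>The factor p in the Lorentz norm is 1 / (\<kappa> + 1) \<ge> 1, so it may be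
    inserted.\<close>
  also have "\<dots> \<le> ennreal C * (ennreal (1 / (\<kappa> + 1)) * (\<integral>\<^sup>+t\<in>{0<..}. ennreal (distr_fun f t powr (\<kappa> + 1)) \<partial>lborel))"
  proof (rule mult_left_mono)
    have "1 \<le> ennreal (1 / (\<kappa> + 1))" using \<kappa> by simp
    then have "1 * (\<integral>\<^sup>+t\<in>{0<..}. ennreal (distr_fun f t powr (\<kappa> + 1)) \<partial>lborel)
        \<le> ennreal (1 / (\<kappa> + 1)) * (\<integral>\<^sup>+t\<in>{0<..}. ennreal (distr_fun f t powr (\<kappa> + 1)) \<partial>lborel)"
      by (rule mult_right_mono) simp
    then show "(\<integral>\<^sup>+t\<in>{0<..}. ennreal (distr_fun f t powr (\<kappa> + 1)) \<partial>lborel)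
        \<le> ennreal (1 / (\<kappa> + 1)) * (\<integral>\<^sup>+t\<in>{0<..}. ennreal (distr_fun f t powr (\<kappa> + 1)) \<partial>lborel)" by simp
  qed simp
  finally show ?thesis by (simp add: Lorentz_p1_norm_def C_def)
qed

lemma maps_boundedly_Lp:
  assumes c: "1 < c" and \<sigma>: "2 - c + b < 1" and Op: "Op = T_op (-1) b c \<or> Op = S_op (-1) b c"
    and p: "1 \<le> p" "1 / p < ereal (2 - c + b)" "0 < 2 - c + b"
  shows "maps_boundedly Op (Lp_norm p) weak_L1_norm"
proof (cases p)
  case (real r)
  then have r: "1 \<le> r" "1 / r < 2 - c + b" using p by (auto simp: one_ereal_def)
  then have r1: "1 < r" using \<sigma> by (cases "r = 1") auto
  \<comment> \<open>Equivalent to 1 / r < 2 - c + b: this is exactly where the weight enters the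
    dual space of L^r.\<close>
  have "-1 < (b + 1 - c) * (r / (r - 1))"
  proof -
    have "1 < (2 - c + b) * r" using r by (simp add: field_simps)
    then show ?thesis using r1 by (simp add: field_simps)
  qed
  then show ?thesis unfolding real
    using weighted_L1_le_Lp[OF r1] by (intro maps_boundedly_weighted_L1[OF c Op]) (assumption+, auto)
next
  case PInf
  show ?thesis unfolding PInf
    using weighted_L1_le_Linf[of "b + 1 - c"] p by (intro maps_boundedly_weighted_L1[OF c Op]) auto
qed (use p in auto)

lemma maps_boundedly_Lorentz:
  assumes c: "1 < c" and \<sigma>: "0 < 2 - c + b" "2 - c + b < 1" and Op: "Op = T_op (-1) b c \<or> Op = S_op (-1) b c"
  shows "maps_boundedly Op (Lorentz_p1_norm (1 / (2 - c + b))) weak_L1_norm"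
proof -
  have e: "b + 1 - c + 1 = 2 - c + b" by simp
  show ?thesis
    using weighted_L1_le_Lorentz[of "b + 1 - c"] \<sigma> unfolding e
    by (intro maps_boundedly_weighted_L1[OF c Op, of _ "1 / (2 - c + b) + 1"]) auto
qed

section \<open>The endpoint estimate for T\<close>

lemma weak_L1_norm_add_le:
  assumes [measurable]: "g \<in> borel_measurable dA" "h \<in> borel_measurable dA"
    and f: "\<And>z. z \<in> disc \<Longrightarrow> f z = g z + h z"
  shows "weak_L1_norm f \<le> 2 * (weak_L1_norm g + weak_L1_norm h)"
proof (rule weak_L1_normI)
  fix t :: real assume t: "0 < t"
  define G where "G = {z \<in> disc. cmod (g z) > t / 2}"
  define H where "H = {z \<in> disc. cmod (h z) > t / 2}"
  have m: "G \<in> sets dA" "H \<in> sets dA"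
  proof -
    have "{z \<in> space dA. cmod (g z) > t / 2} \<in> sets dA" "{z \<in> space dA. cmod (h z) > t / 2} \<in> sets dA" by measurable
    then show "G \<in> sets dA" "H \<in> sets dA" by (simp_all add: G_def H_def)
  qed
  have sub: "{z \<in> disc. cmod (f z) > t} \<subseteq> G \<union> H"
  proof clarify
    fix z assume z: "z \<in> disc" "t < cmod (f z)" "z \<notin> H"
    then have "t < cmod (g z) + cmod (h z)" using f[OF z(1)] norm_triangle_ineq[of "g z" "h z"] by simp
    then show "z \<in> G" using z by (simp add: G_def H_def)
  qed
  have "ennreal t * emeasure dA {z \<in> disc. cmod (f z) > t} \<le> ennreal t * (emeasure dA G + emeasure dA H)"
    using m sub by (intro mult_left_mono order_trans[OF emeasure_mono emeasure_subadditive]) auto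
  also have "\<dots> = 2 * (ennreal (t / 2) * emeasure dA G + ennreal (t / 2) * emeasure dA H)"
  proof -
    have "ennreal t = 2 * ennreal (t / 2)" using t by (simp flip: ennreal_numeral ennreal_mult)
    then show ?thesis by (simp add: distrib_left mult.assoc)
  qed
  also have "\<dots> \<le> 2 * (weak_L1_norm g + weak_L1_norm h)"
    unfolding G_def H_def using t by (intro mult_left_mono add_mono weak_L1_normD) auto
  finally show "ennreal t * emeasure dA {z \<in> disc. cmod (f z) > t} \<le> 2 * (weak_L1_norm g + weak_L1_norm h)" .
qed

text \<open>Everything rests on s p = 1. With x = |f| wt^s, the integrands |f|^p, wt^(s - 1) |f| and
  wt^(2 s - 1) |f|^2 are x^p / wt, x / wt and x^2 / wt. As 1 < p \<le> 2, x^p controls x where x > M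
  and x^2 where x \<le> M, up to the powers M^(1 - p) and M^(2 - p).\<close>

lemma weak_L1_norm_T_endpoint:
  assumes c: "1 < c" and \<sigma>: "1 / 2 \<le> 2 - c + b" "2 - c + b < 1"
    and f[measurable]: "f \<in> borel_measurable dA" and M: "0 < M"
    and int: "(\<integral>\<^sup>+z. ennreal (cmod (f z) powr (1 / (2 - c + b))) \<partial>dA) = ennreal (M powr (1 / (2 - c + b)))"
  defines "D \<equiv> 2 powr c * (Gamma (c - 1) / (Gamma (c / 2))\<^sup>2)"
    and "K \<equiv> Gamma (2 * c - 2) / (Gamma c)\<^sup>2"
  shows "weak_L1_norm (op_apply (T_op (-1) b c) f) \<le> ennreal (2 * (D + 2 * sqrt K)) * ennreal M"
    and "z \<in> disc \<Longrightarrow> op_converges (T_op (-1) b c) f z"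
proof -
  define s where "s = 2 - c + b"
  define p where "p = 1 / s"
  have s: "1 / 2 \<le> s" "s < 1" using \<sigma> by (auto simp: s_def)
  have p: "1 < p" "p \<le> 2" "s * p = 1" using s by (auto simp: p_def field_simps)
  have intp: "(\<integral>\<^sup>+z. ennreal (cmod (f z) powr p) \<partial>dA) = ennreal (M powr p)"
    using int by (simp add: p_def s_def)
  define B where "B = {z. M < cmod (f z) * wt z powr s}"
  define f1 where "f1 z = f z * (if z \<in> B then 1 else 0)" for z
  define f2 where "f2 z = f z * (if z \<in> B then 0 else 1)" for z
  have [measurable]: "Measurable.pred dA (\<lambda>z. z \<in> B)" unfolding B_def mem_Collect_eq by measurable
  have f1[measurable]: "f1 \<in> borel_measurable dA" and f2[measurable]: "f2 \<in> borel_measurable dA"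
    unfolding f1_def[abs_def] f2_def[abs_def] by measurable
  have i1: "(\<integral>\<^sup>+w. ennreal (wt w powr (b + 1 - c) * cmod (f1 w)) \<partial>dA) \<le> ennreal M"
  proof -
    have "(\<integral>\<^sup>+w. ennreal (wt w powr (b + 1 - c) * cmod (f1 w)) \<partial>dA) \<le> (\<integral>\<^sup>+w. ennreal (M powr (1 - p)) * ennreal (cmod (f w) powr p) \<partial>dA)"
    proof (rule nn_integral_mono)
      fix w assume "w \<in> space dA"
      then have w: "wt w > 0" using wt_pos by simp
      have "wt w powr (b + 1 - c) * cmod (f1 w) \<le> M powr (1 - p) * cmod (f w) powr p"
      proof (cases "w \<in> B")
        case True
        then have big: "M < cmod (f w) * wt w powr s" by (simp add: B_def)
        have f0: "cmod (f w) > 0" using big M by (cases "f w = 0") auto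
        have "1 \<le> (cmod (f w) * wt w powr s / M) powr (p - 1)"
          using big M p by (intro ge_one_powr_ge_zero) auto
        then have "wt w powr (s - 1) * cmod (f w) * 1 \<le> wt w powr (s - 1) * cmod (f w) * (cmod (f w) * wt w powr s / M) powr (p - 1)"
          by (intro mult_left_mono) auto
        also have "\<dots> = (wt w powr (s - 1) * wt w powr (s * (p - 1))) * (cmod (f w) powr 1 * cmod (f w) powr (p - 1)) * M powr (1 - p)"
        proof -
          have "M powr (1 - p) = inverse (M powr (p - 1))" using powr_minus[of M "p - 1"] by simp
          then show ?thesis using f0 M w by (simp add: powr_mult powr_divide powr_powr) (simp add: divide_inverse)
        qed
        also have "wt w powr (s - 1) * wt w powr (s * (p - 1)) = 1"
          using w p by (simp add: algebra_simps flip: powr_add)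
        also have "cmod (f w) powr 1 * cmod (f w) powr (p - 1) = cmod (f w) powr p"
          by (subst powr_add[symmetric]) simp
        finally show ?thesis using True by (simp add: f1_def s_def algebra_simps)
      qed (simp add: f1_def)
      then show "ennreal (wt w powr (b + 1 - c) * cmod (f1 w)) \<le> ennreal (M powr (1 - p)) * ennreal (cmod (f w) powr p)"
        by (simp add: ennreal_leI flip: ennreal_mult)
    qed
    also have "\<dots> = ennreal (M powr (1 - p)) * ennreal (M powr p)"
      by (simp add: nn_integral_cmult intp)
    also have "\<dots> = ennreal M" using M by (simp flip: ennreal_mult powr_add)
    finally show ?thesis .
  qed
  have i2: "(\<integral>\<^sup>+w. ennreal (wt w powr (2 * b + 3 - 2 * c) * (cmod (f2 w))\<^sup>2) \<partial>dA) \<le> ennreal (M\<^sup>2)"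
  proof -
    have "(\<integral>\<^sup>+w. ennreal (wt w powr (2 * b + 3 - 2 * c) * (cmod (f2 w))\<^sup>2) \<partial>dA) \<le> (\<integral>\<^sup>+w. ennreal (M powr (2 - p)) * ennreal (cmod (f w) powr p) \<partial>dA)"
    proof (rule nn_integral_mono)
      fix w assume "w \<in> space dA"
      then have w: "wt w > 0" using wt_pos by simp
      have "wt w powr (2 * b + 3 - 2 * c) * (cmod (f2 w))\<^sup>2 \<le> M powr (2 - p) * cmod (f w) powr p"
      proof (cases "w \<in> B \<or> f w = 0")
        case False
        define x where "x = cmod (f w) * wt w powr s"
        have x: "0 < x" "x \<le> M" using False w by (auto simp: B_def x_def)
        have f0: "cmod (f w) > 0" using False by simp
        have "wt w powr (2 * s - 1) * (cmod (f w))\<^sup>2 = wt w powr (-1) * x powr 2"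
          using w f0 by (simp add: x_def powr_mult powr_powr powr_diff mult.commute[of 2 s])
        also have "x powr 2 = x powr (2 - p) * x powr p" by (simp flip: powr_add)
        also have "wt w powr (-1) * (x powr (2 - p) * x powr p) \<le> wt w powr (-1) * (M powr (2 - p) * x powr p)"
          using x p by (intro mult_left_mono mult_right_mono powr_mono2) auto
        also have "x powr p = cmod (f w) powr p * wt w powr 1"
          using w f0 p by (simp add: x_def powr_mult powr_powr)
        also have "wt w powr (-1) * (M powr (2 - p) * (cmod (f w) powr p * wt w powr 1)) = M powr (2 - p) * cmod (f w) powr p"
          using w by (simp add: powr_minus)
        finally show ?thesis using False by (simp add: f2_def s_def algebra_simps)
      qed (auto simp: f2_def)
      then show "ennreal (wt w powr (2 * b + 3 - 2 * c) * (cmod (f2 w))\<^sup>2) \<le> ennreal (M powr (2 - p)) * ennreal (cmod (f w) powr p)"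
        by (simp add: ennreal_leI flip: ennreal_mult)
    qed
    also have "\<dots> = ennreal (M powr (2 - p)) * ennreal (M powr p)"
      by (simp add: nn_integral_cmult intp)
    also have "\<dots> = ennreal (M\<^sup>2)" using M by (simp flip: ennreal_mult powr_add)
    finally show ?thesis .
  qed
  have K: "K \<ge> 0" unfolding K_def using c by (intro divide_nonneg_nonneg less_imp_le[OF Gamma_real_pos]) auto
  have D: "D \<ge> 0" unfolding D_def using c by auto
  have M2: "0 < M\<^sup>2" using M by simp
  note T2 = weak_L1_norm_T_L2[OF c f2 M2 i2]
  have conv1: "op_converges (T_op (-1) b c) f1 z" if "z \<in> disc" for z
  proof (rule op_convergesI[OF _ _ f1 _ that])
    have "(\<integral>\<^sup>+w. ennreal (wt w powr (b + 1 - c) * cmod (f1 w)) \<partial>dA) < \<infinity>"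
      using i1 by (rule le_less_trans) simp
    then show "integrable dA (\<lambda>w. of_real (wt w powr b) * f1 w)"
      using c by (intro integrable_wt_powr_mult[OF _ f1]) auto
  qed (use c in auto)
  have f12: "kernel (T_op (-1) b c) z w * f w = kernel (T_op (-1) b c) z w * f1 w + kernel (T_op (-1) b c) z w * f2 w" for z w
    by (simp add: f1_def f2_def)
  show "op_converges (T_op (-1) b c) f z" if "z \<in> disc" for z
    using conv1[OF that] T2(2)[OF that] unfolding op_converges_def f12 by (rule Bochner_Integration.integrable_add)
  have sum: "op_apply (T_op (-1) b c) f z = op_apply (T_op (-1) b c) f1 z + op_apply (T_op (-1) b c) f2 z" if "z \<in> disc" for z
    using conv1[OF that] T2(2)[OF that] unfolding op_converges_def op_apply_def f12
    by (simp add: distrib_left)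
  have "weak_L1_norm (op_apply (T_op (-1) b c) f) \<le> 2 * (weak_L1_norm (op_apply (T_op (-1) b c) f1) + weak_L1_norm (op_apply (T_op (-1) b c) f2))"
    using f1 f2 sum by (intro weak_L1_norm_add_le op_apply_measurable[where c = c and b = b and a = "-1"]) auto
  also have "\<dots> \<le> 2 * (ennreal D * ennreal M + ennreal (2 * sqrt (K * M\<^sup>2)))"
  proof (intro mult_left_mono add_mono)
    show "weak_L1_norm (op_apply (T_op (-1) b c) f1) \<le> ennreal D * ennreal M"
      unfolding D_def
      by (rule order_trans[OF weak_L1_norm_op_le[OF c _ f1] mult_left_mono[OF i1]]) auto
    show "weak_L1_norm (op_apply (T_op (-1) b c) f2) \<le> ennreal (2 * sqrt (K * M\<^sup>2))"
      unfolding K_def by (rule T2(1))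
  qed simp
  also have "\<dots> = ennreal (2 * (D + 2 * sqrt K)) * ennreal M"
    using M K D by (simp add: real_sqrt_mult algebra_simps flip: ennreal_mult ennreal_plus ennreal_numeral)
  finally show "weak_L1_norm (op_apply (T_op (-1) b c) f) \<le> ennreal (2 * (D + 2 * sqrt K)) * ennreal M" .
qed

lemma maps_boundedly_T_endpoint:
  assumes c: "1 < c" and \<sigma>: "1 / 2 \<le> 2 - c + b" "2 - c + b < 1"
  shows "maps_boundedly (T_op (-1) b c) (Lp_norm (ereal (1 / (2 - c + b)))) weak_L1_norm"
proof (rule maps_boundedly_weakI)
  define D where "D = 2 powr c * (Gamma (c - 1) / (Gamma (c / 2))\<^sup>2)"
  define K where "K = Gamma (2 * c - 2) / (Gamma c)\<^sup>2"
  show "T_op (-1) b c = T_op (-1) b c \<or> T_op (-1) b c = S_op (-1) b c" by simp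
  let ?N = "Lp_norm (ereal (1 / (2 - c + b)))"
  have main: "weak_L1_norm (op_apply (T_op (-1) b c) f) \<le> ennreal (2 * (D + 2 * sqrt K)) * ?N f \<and>
      (\<forall>z\<in>disc. op_converges (T_op (-1) b c) f z)" if f: "f \<in> borel_measurable dA" "?N f < \<infinity>" for f
  proof -
    obtain M where M: "0 \<le> M" "?N f = ennreal M"
      "(\<integral>\<^sup>+z. ennreal (cmod (f z) powr (1 / (2 - c + b))) \<partial>dA) = ennreal (M powr (1 / (2 - c + b)))"
      using Lp_norm_finiteE[OF _ f(2)] \<sigma> by auto
    show ?thesis
    proof (cases "M = 0")
      case True
      then have 0: "(\<integral>\<^sup>+w. ennreal (wt w powr (b + 1 - c) * cmod (f w)) \<partial>dA) = 0"
        using nn_integral_powr_eq_0D[OF f(1), of "1 / (2 - c + b)" "b + 1 - c"] M(3) by simp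
      have "integrable dA (\<lambda>w. of_real (wt w powr b) * f w)"
        using c 0 by (intro integrable_wt_powr_mult[of c, OF _ f(1)]) auto
      then have "\<forall>z\<in>disc. op_converges (T_op (-1) b c) f z"
        using c f by (intro ballI op_convergesI[where a = "-1" and b = b and c = c]) auto
      then show ?thesis
        using weak_L1_norm_op_le[OF c _ f(1), of "T_op (-1) b c" b] 0 by simp
    next
      case False
      then have M0: "0 < M" using M by simp
      show ?thesis
        using weak_L1_norm_T_endpoint[OF c \<sigma> f(1) M0 M(3)] unfolding M(2) D_def K_def by blast
    qed
  qed
  show "f \<in> borel_measurable dA \<Longrightarrow> ?N f < \<infinity> \<Longrightarrow> z \<in> disc \<Longrightarrow> op_converges (T_op (-1) b c) f z" for f z
    using main by blast
  show "f \<in> borel_measurable dA \<Longrightarrow> ?N f < \<infinity> \<Longrightarrow> weak_L1_norm (op_apply (T_op (-1) b c) f) \<le> ennreal (2 * (D + 2 * sqrt K)) * ?N f" for f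
    using main by blast
qed

section \<open>Circle means and Riesz products\<close>

lemma wt_powr_le:
  assumes "0 < s" "s \<le> wt w"
  shows "wt w powr b \<le> max 1 (s powr b)"
proof (cases "0 \<le> b")
  case True
  then have "wt w powr b \<le> 1 powr b" using assms wt_le_1[of w] by (intro powr_mono2) auto
  then show ?thesis by simp
next
  case False
  then have "wt w powr b \<le> s powr b" using assms by (intro powr_mono2') auto
  then show ?thesis by simp
qed

lemma test_fun_integrable:
  assumes [measurable]: "f \<in> borel_measurable dA" and B: "\<And>w. cmod (f w) \<le> B"
    and s: "0 < s" "\<And>w. w \<in> disc \<Longrightarrow> f w \<noteq> 0 \<Longrightarrow> s \<le> wt w"
  shows "integrable dA (\<lambda>w. of_real (wt w powr b) * f w)"
proof (rule integrable_dA_bounded[of _ "max 1 (s powr b) * B"])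
  fix w :: complex assume w: "w \<in> disc"
  have B0: "0 \<le> B" using B[of 0] norm_ge_zero[of "f 0"] by linarith
  show "norm (of_real (wt w powr b) * f w) \<le> max 1 (s powr b) * B"
  proof (cases "f w = 0")
    case False
    then have sw: "s \<le> wt w" using s w by auto
    then have "wt w powr b \<le> max 1 (s powr b)" using wt_powr_le s(1) by auto
    then show ?thesis using B[of w] by (simp add: norm_mult mult_mono)
  qed (simp add: B0)
qed measurable

lemma test_fun_radius:
  assumes s: "0 < s" "s \<le> wt w" and z: "cmod z \<le> 1"
  shows "cmod (z * cnj w) \<le> sqrt (1 - s)"
proof -
  have "cmod (z * cnj w) \<le> 1 * cmod w"
    unfolding norm_mult complex_mod_cnj using z by (intro mult_right_mono) auto
  also have "\<dots> \<le> sqrt (1 - s)" using s by (auto simp: wt_def intro: real_le_rsqrt)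
  finally show ?thesis .
qed

text \<open>As \<open>t \<rightarrow> \<infinity>\<close>, the set where \<open>\<bar>P\<bar> / wt\<close> exceeds \<open>t\<close> shrinks to the circle,
  and \<open>t\<close> times its measure tends to the mean of \<open>\<bar>P\<bar>\<close> over the circle.\<close>

lemma weak_L1_norm_T_ge_circle:
  fixes f :: "complex \<Rightarrow> complex" and b c :: real
  assumes c: "0 < c" and f[measurable]: "f \<in> borel_measurable dA" and B: "\<And>w. cmod (f w) \<le> B"
    and s: "0 < s" "\<And>w. w \<in> disc \<Longrightarrow> f w \<noteq> 0 \<Longrightarrow> s \<le> wt w"
  defines "P \<equiv> \<lambda>u. \<integral>w. kernel (T_op (-1) b c) u w * f w \<partial>dA"
  shows "ennreal (\<integral>v. cmod (P (sgn v)) \<partial>dA) \<le> weak_L1_norm (op_apply (T_op (-1) b c) f)"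
    and "integrable dA (\<lambda>v. cmod (P (sgn v)))"
proof -
  \<comment> \<open>On the disc f lives in \<open>cmod w \<le> r\<close>. The maximum covers s > 1,
    where f vanishes on the disc.\<close>
  define r where "r = sqrt (max 0 (1 - s))"
  have r: "0 \<le> r" "r < 1" "sqrt (1 - s) \<le> r" using s(1) by (auto simp: r_def)
  define h where "h w = of_real (wt w powr b) * f w" for w
  have hi: "integrable dA h"
    unfolding h_def[abs_def] by (rule test_fun_integrable[OF f B s])
  define C where "C = (\<integral>w. cmod (h w) \<partial>dA)"
  define x where "x n = of_real (binom_coeff c n) * moment b f n" for n
  have mle: "cmod (moment b f n) \<le> C * r ^ n" for n
  proof -
    have le: "cmod (h w * cnj w ^ n) \<le> cmod (h w) * r ^ n" if w: "w \<in> disc" for w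
    proof (cases "f w = 0")
      case False
      then have "cmod w \<le> r"
        using test_fun_radius[of s w 1] s w r(3) by auto
      then show ?thesis by (simp add: norm_mult norm_power mult_left_mono power_mono)
    qed (simp add: h_def)
    have "integrable dA (\<lambda>w. h w * cnj w ^ n)"
    proof (rule Bochner_Integration.integrable_bound)
      show "integrable dA (\<lambda>w. cmod (h w) * r ^ n)" using hi by auto
      show "AE w in dA. norm (h w * cnj w ^ n) \<le> norm (cmod (h w) * r ^ n)"
        using le r by (auto simp: abs_mult)
    qed (use hi in measurable)
    then have "cmod (\<integral>w. h w * cnj w ^ n \<partial>dA) \<le> (\<integral>w. cmod (h w) * r ^ n \<partial>dA)"
      using hi le by (intro order_trans[OF integral_norm_bound integral_mono]) auto
    then show ?thesis by (simp add: moment_def h_def C_def)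
  qed
  have C: "0 \<le> C" unfolding C_def by (intro Bochner_Integration.integral_nonneg) auto
  have xle: "cmod (x n) \<le> C * (binom_coeff c n * r ^ n)" for n
    using mult_left_mono[OF mle[of n], of "binom_coeff c n"] binom_coeff_pos[OF c, of n]
    by (simp add: x_def norm_mult mult_ac)
  have sx: "summable (\<lambda>n. cmod (x n))"
    by (rule summable_comparison_test'[of "\<lambda>n. C * (binom_coeff c n * r ^ n)" 0])
       (use binom_coeff_sums_real[of r c] r xle in \<open>auto simp: sums_iff intro!: summable_mult\<close>)
  \<comment> \<open>The differentiated binomial series still converges at r < 1; this makes P
    Lipschitz up to the circle.\<close>
  have snx: "summable (\<lambda>n. real n * cmod (x n))"
  proof -
    have "summable (\<lambda>n. diffs (binom_coeff c) n * r ^ n)"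
      using r binom_coeff_sums_real[of _ c] by (intro termdiff_converges[of r 1]) (auto simp: sums_iff)
    then have "summable (\<lambda>n. C * r * (diffs (binom_coeff c) n * r ^ n))" by (rule summable_mult)
    then have "summable (\<lambda>n. C * (real (Suc n) * (binom_coeff c (Suc n) * r ^ Suc n)))"
      by (simp add: diffs_def mult_ac)
    then have "summable (\<lambda>n. C * (real n * (binom_coeff c n * r ^ n)))"
      by (subst (asm) summable_Suc_iff)
    then show ?thesis
    proof (rule summable_comparison_test'[of _ 0])
      fix n
      show "norm (real n * cmod (x n)) \<le> C * (real n * (binom_coeff c n * r ^ n))"
        using mult_left_mono[OF xle[of n], of "real n"] by (simp add: mult_ac)
    qed
  qed
  have P: "(\<lambda>n. x n * u ^ n) sums P u" if u: "cmod u \<le> 1" for u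
    unfolding x_def P_def
  proof (rule kernel_T_expansion(2)[OF c _ u r(2)])
    show "integrable dA (\<lambda>w. of_real (wt w powr b) * f w)" using hi by (simp add: h_def[abs_def])
    show "cmod (u * cnj w) \<le> r" if "w \<in> disc" "f w \<noteq> 0" for w
      using order_trans[OF test_fun_radius[of s w u] r(3)] s that u by auto
  qed
  \<comment> \<open>One more than the Lipschitz constant: the surplus turns the final comparison
    with \<open>t * wt z\<close> into a strict inequality.\<close>
  define L where "L = (\<Sum>n. real n * cmod (x n)) + 1"
  have L: "1 \<le> L" unfolding L_def using snx by (simp add: suminf_nonneg)
  have Lip: "cmod (P z - P u) \<le> (L - 1) * cmod (z - u)" if z: "cmod z \<le> 1" "cmod u \<le> 1" for z u
  proof -
    have "(\<lambda>n. x n * z ^ n - x n * u ^ n) sums (P z - P u)" using z by (intro sums_diff P) auto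
    then have eq: "P z - P u = (\<Sum>n. x n * z ^ n - x n * u ^ n)" by (simp add: sums_iff)
    have le: "cmod (x n * z ^ n - x n * u ^ n) \<le> real n * cmod (x n) * cmod (z - u)" for n
      using mult_left_mono[OF norm_power_diff[OF z, of n], of "cmod (x n)"]
      by (simp add: norm_mult mult_ac flip: right_diff_distrib)
    have sm: "summable (\<lambda>n. real n * cmod (x n) * cmod (z - u))" using snx by (rule summable_mult2)
    have "cmod (P z - P u) \<le> (\<Sum>n. real n * cmod (x n) * cmod (z - u))"
      unfolding eq by (rule norm_suminf_le[OF le sm])
    also have "\<dots> = (L - 1) * cmod (z - u)"
      unfolding L_def using snx by (simp add: suminf_mult2)
    finally show ?thesis .
  qed
  define M where "M = (\<Sum>n. cmod (x n))"
  have PM: "cmod (P (sgn v)) \<le> M" for v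
  proof -
    have "P (sgn v) = (\<Sum>n. x n * sgn v ^ n)" using P[of "sgn v"] by (simp add: norm_sgn sums_iff)
    also have "cmod \<dots> \<le> M"
      unfolding M_def
    proof (rule norm_suminf_le[OF _ sx])
      show "norm (x n * sgn v ^ n) \<le> cmod (x n)" for n
        using mult_left_mono[OF cmod_sgn_power_le[of v n], of "cmod (x n)"] by (simp add: norm_mult)
    qed
    finally show ?thesis .
  qed
  have M: "0 \<le> M" using PM[of 0] norm_ge_zero order_trans by blast
  have Pm[measurable]: "P \<in> borel_measurable borel"
    unfolding P_def by (rule dA.borel_measurable_lebesgue_integral) (simp add: case_prod_beta, measurable)
  show Pi: "integrable dA (\<lambda>v. cmod (P (sgn v)))"
    by (rule integrable_dA_bounded[of _ M]) (use PM in auto)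
  define i where "i = (\<integral>v. cmod (P (sgn v)) \<partial>dA)"
  have i0: "0 \<le> i" unfolding i_def by (intro Bochner_Integration.integral_nonneg) auto
  have i: "(\<integral>\<^sup>+v. ennreal (cmod (P (sgn v))) \<partial>dA) = ennreal i"
    unfolding i_def using Pi by (intro nn_integral_eq_integral) auto
  define W where "W = weak_L1_norm (op_apply (T_op (-1) b c) f)"
  \<comment> \<open>For t \<ge> M the quotient of |P| by t + L is at most 1 on the circle, so the
    truncation in \<open>emeasure_wt_le_sgn\<close> is inactive and the measure there equals i / (t
    + L).\<close>
  have lower: "ennreal (t * (i / (t + L))) \<le> W" if t: "0 < t" "M \<le> t" for t
  proof -
    have meas: "{z \<in> disc. cmod (op_apply (T_op (-1) b c) f z) > t} \<in> sets dA"
    proof -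
      have [measurable]: "op_apply (T_op (-1) b c) f \<in> borel_measurable dA"
        by (rule op_apply_measurable[OF _ f]) blast
      have "{z \<in> space dA. cmod (op_apply (T_op (-1) b c) f z) > t} \<in> sets dA" by measurable
      then show ?thesis by simp
    qed
    have "ennreal (i / (t + L)) = (\<integral>\<^sup>+v. ennreal (cmod (P (sgn v))) \<partial>dA) / ennreal (t + L)"
      unfolding i using t L i0 divide_ennreal[of i "t + L"] by (simp del: ennreal_plus)
    also have "\<dots> = (\<integral>\<^sup>+v. ennreal (cmod (P (sgn v))) / ennreal (t + L) \<partial>dA)"
      by (rule nn_integral_divide[symmetric]) measurable
    also have "\<dots> = (\<integral>\<^sup>+v. min 1 (ennreal (cmod (P (sgn v))) / ennreal (t + L)) \<partial>dA)"
    proof (rule nn_integral_cong)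
      fix v
      have "cmod (P (sgn v)) / (t + L) \<le> 1" using PM[of v] t L by (simp add: divide_le_eq)
      then have "ennreal (cmod (P (sgn v))) / ennreal (t + L) \<le> 1"
        using t L by (simp add: divide_ennreal del: ennreal_plus)
      then show "ennreal (cmod (P (sgn v))) / ennreal (t + L) = min 1 (ennreal (cmod (P (sgn v))) / ennreal (t + L))"
        by (simp add: min_def)
    qed
    also have "\<dots> = emeasure dA {z \<in> disc. ennreal ((t + L) * wt z) \<le> ennreal (cmod (P (sgn z)))}"
      using t L by (intro emeasure_wt_le_sgn[of "\<lambda>u. ennreal (cmod (P u))", symmetric]) auto
    also have "\<dots> \<le> emeasure dA {z \<in> disc. cmod (op_apply (T_op (-1) b c) f z) > t}"
    proof (rule emeasure_mono[OF _ meas], clarify)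
      fix z assume z: "z \<in> disc" and "ennreal ((t + L) * wt z) \<le> ennreal (cmod (P (sgn z)))"
      then have le: "(t + L) * wt z \<le> cmod (P (sgn z))" by (simp add: ennreal_le_iff)
      have w: "0 < wt z" by (rule wt_pos[OF z])
      have "cmod (sgn z - z) \<le> wt z"
      proof (cases "z = 0")
        case False
        have "sgn z - z = (1 - cmod z) *\<^sub>R sgn z"
          using False by (simp add: sgn_div_norm algebra_simps)
        then have "cmod (sgn z - z) = 1 - cmod z" using False z by (simp add: norm_sgn)
        also have "\<dots> \<le> wt z" using z by (simp add: wt_def power2_eq_square mult_left_le)
        finally show ?thesis .
      qed (simp add: wt_def)
      then have "(L - 1) * cmod (sgn z - z) \<le> (L - 1) * wt z" using L by (intro mult_left_mono) auto
      moreover have "cmod (P (sgn z)) \<le> cmod (P z) + (L - 1) * cmod (sgn z - z)"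
      proof -
        have "cmod (P (sgn z) - P z) \<le> (L - 1) * cmod (sgn z - z)"
          using z by (intro Lip) (auto simp: norm_sgn)
        then show ?thesis using norm_triangle_ineq2[of "P (sgn z)" "P z"] by linarith
      qed
      ultimately have "(t + L) * wt z \<le> cmod (P z) + (L - 1) * wt z" using le by linarith
      then have "t * wt z < cmod (P z)" using w by (simp add: algebra_simps)
      moreover have "cmod (op_apply (T_op (-1) b c) f z) = cmod (P z) / wt z"
        using w by (simp add: op_apply_def factor_eq norm_mult norm_inverse powr_minus divide_inverse P_def)
      ultimately show "t < cmod (op_apply (T_op (-1) b c) f z)" using w by (simp add: less_divide_eq)
    qed
    finally have "ennreal t * ennreal (i / (t + L)) \<le> ennreal t * emeasure dA {z \<in> disc. cmod (op_apply (T_op (-1) b c) f z) > t}"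
      by (rule mult_left_mono) simp
    also have "\<dots> \<le> W" unfolding W_def using t by (intro weak_L1_normD)
    finally show ?thesis using t L i0 by (subst ennreal_mult) auto
  qed
  have "ennreal i \<le> W"
  proof (cases W)
    case (real w)
    have le: "t * (i / (t + L)) \<le> w" if "0 < t" "M \<le> t" for t
      using lower[OF that] real that L i0 by (simp add: ennreal_le_iff)
    have "i \<le> w"
    proof (rule ccontr)
      assume "\<not> i \<le> w"
      then have wi: "w < i" by simp
      \<comment> \<open>Solving t i / (t + L) \<le> w for t shows that the bound breaks once t
        exceeds w L / (i - w).\<close>
      define t where "t = max (max 1 M) (w * L / (i - w) + 1)"
      have t: "0 < t" "M \<le> t" "w * L / (i - w) < t" by (auto simp: t_def)
      then have "w * L < t * (i - w)" using wi by (simp add: pos_divide_less_eq)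
      moreover have "t * i \<le> w * (t + L)" using le[OF t(1,2)] t(1) L by (simp add: pos_divide_le_eq)
      ultimately show False by (simp add: algebra_simps)
    qed
    then show ?thesis using real by (simp add: ennreal_leI)
  qed simp
  then show "ennreal (\<integral>v. cmod (P (sgn v)) \<partial>dA) \<le> weak_L1_norm (op_apply (T_op (-1) b c) f)"
    by (simp add: W_def i_def)
qed

section \<open>Trigonometric polynomials and Riesz products\<close>

inductive trig :: "nat \<Rightarrow> (complex \<Rightarrow> complex) \<Rightarrow> bool" where
  trig_monom: "i \<le> d \<Longrightarrow> j \<le> d \<Longrightarrow> trig d (\<lambda>u. u ^ i * cnj u ^ j)"
| trig_add: "trig d f \<Longrightarrow> trig d g \<Longrightarrow> trig d (\<lambda>u. f u + g u)"
| trig_scale: "trig d f \<Longrightarrow> trig d (\<lambda>u. a * f u)"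

lemma trig_mono: "trig d f \<Longrightarrow> d \<le> d' \<Longrightarrow> trig d' f"
  by (induction rule: trig.induct) (auto intro!: trig.intros)

lemma trig_mult_power: "trig d f \<Longrightarrow> trig (d + n) (\<lambda>u. u ^ n * f u)"
proof (induction rule: trig.induct)
  case (trig_monom i d j)
  then have "trig (d + n) (\<lambda>u. u ^ (n + i) * cnj u ^ j)" by (intro trig.trig_monom) auto
  then show ?case by (simp add: power_add mult_ac)
next
  case (trig_add d f g)
  from trig.trig_add[OF trig_add.IH] show ?case by (simp add: distrib_left)
next
  case (trig_scale d f a)
  from trig.trig_scale[OF trig_scale.IH, of a] show ?case by (simp add: mult_ac)
qed

lemma trig_mult_cnj_power: "trig d f \<Longrightarrow> trig (d + n) (\<lambda>u. cnj u ^ n * f u)"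
proof (induction rule: trig.induct)
  case (trig_monom i d j)
  then have "trig (d + n) (\<lambda>u. u ^ i * cnj u ^ (n + j))" by (intro trig.trig_monom) auto
  then show ?case by (simp add: power_add mult_ac)
next
  case (trig_add d f g)
  from trig.trig_add[OF trig_add.IH] show ?case by (simp add: distrib_left)
next
  case (trig_scale d f a)
  from trig.trig_scale[OF trig_scale.IH, of a] show ?case by (simp add: mult_ac)
qed

lemma trig_measurable: "trig d f \<Longrightarrow> f \<in> borel_measurable borel"
proof (induction rule: trig.induct)
  case (trig_monom i d j)
  show ?case by (intro borel_measurable_continuous_onI continuous_intros)
qed auto

lemma trig_integrable: "trig d f \<Longrightarrow> integrable dA (\<lambda>v. f (sgn v))"
proof (induction rule: trig.induct)
  case (trig_monom i d j)
  show ?case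
  proof (rule integrable_dA_bounded[of _ 1])
    show "norm (sgn v ^ i * cnj (sgn v) ^ j) \<le> 1" for v
      using mult_mono[OF cmod_sgn_power_le[of v i] cmod_sgn_power_le[of v j]]
      by (simp add: norm_mult norm_power)
  qed measurable
qed auto

text \<open>A mere bound d on the exponents is enough information, since each factor of the Riesz
  product brings a frequency above all earlier ones. The monomials are not reduced by
  \<open>u * cnj u = 1\<close>, which would fail at \<open>sgn 0 = 0\<close>.\<close>

lemma trig_integral_power_eq_0:
  "trig d f \<Longrightarrow> d < n \<Longrightarrow> (\<integral>v. sgn v ^ n * f (sgn v) \<partial>dA) = 0"
proof (induction rule: trig.induct)
  case (trig_monom i d j)
  have eq: "sgn v ^ n * (sgn v ^ i * cnj (sgn v) ^ j) = sgn v ^ (n + i) * cnj (sgn v) ^ j" for v :: complex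
    by (simp add: power_add mult_ac)
  show ?case unfolding eq using trig_monom integral_sgn_power[of "n + i" j] by simp
next
  case (trig_add d f g)
  then have "(\<integral>v. sgn v ^ n * f (sgn v) + sgn v ^ n * g (sgn v) \<partial>dA) = 0"
    using trig_integrable[OF trig_mult_power] by (subst Bochner_Integration.integral_add) auto
  then show ?case by (simp add: distrib_left)
next
  case (trig_scale d f a)
  have "(\<integral>v. sgn v ^ n * (a * f (sgn v)) \<partial>dA) = (\<integral>v. a * (sgn v ^ n * f (sgn v)) \<partial>dA)"
    by (simp add: mult_ac)
  also have "\<dots> = a * (\<integral>v. sgn v ^ n * f (sgn v) \<partial>dA)" by (rule integral_mult_right_zero)
  finally show ?case using trig_scale by simp
qed

lemma trig_integral_cnj_power_eq_0:
  "trig d f \<Longrightarrow> d < n \<Longrightarrow> (\<integral>v. cnj (sgn v) ^ n * f (sgn v) \<partial>dA) = 0"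
proof (induction rule: trig.induct)
  case (trig_monom i d j)
  have eq: "cnj (sgn v) ^ n * (sgn v ^ i * cnj (sgn v) ^ j) = sgn v ^ i * cnj (sgn v) ^ (n + j)" for v :: complex
    by (simp add: power_add mult_ac)
  show ?case unfolding eq using trig_monom integral_sgn_power[of i "n + j"] by simp
next
  case (trig_add d f g)
  then have "(\<integral>v. cnj (sgn v) ^ n * f (sgn v) + cnj (sgn v) ^ n * g (sgn v) \<partial>dA) = 0"
    using trig_integrable[OF trig_mult_cnj_power] by (subst Bochner_Integration.integral_add) auto
  then show ?case by (simp add: distrib_left)
next
  case (trig_scale d f a)
  have "(\<integral>v. cnj (sgn v) ^ n * (a * f (sgn v)) \<partial>dA) = (\<integral>v. a * (cnj (sgn v) ^ n * f (sgn v)) \<partial>dA)"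
    by (simp add: mult_ac)
  also have "\<dots> = a * (\<integral>v. cnj (sgn v) ^ n * f (sgn v) \<partial>dA)" by (rule integral_mult_right_zero)
  finally show ?case using trig_scale by simp
qed

text \<open>Ratio 4 leaves the room used below: a product of N factors has frequencies at most
  \<open>2 * 4 ^ N\<close>, and even after multiplication by an earlier \<open>u ^ freq k\<close>
  they stay below \<open>freq N\<close>.\<close>

abbreviation freq :: "nat \<Rightarrow> nat" where "freq k \<equiv> 4 ^ Suc k"

text \<open>The imaginary unit makes each factor exceed modulus 1 only quadratically in \<alpha>, so
  for \<alpha> = 1 / sqrt N the product of N factors is uniformly bounded. Real factors 1 + \<alpha>
  Re (u^n) would reach (1 + \<alpha>)^N at u = 1, which is unbounded for this choice.\<close>

primrec riesz :: "real \<Rightarrow> nat \<Rightarrow> complex \<Rightarrow> complex" where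
  "riesz \<alpha> 0 u = 1"
| "riesz \<alpha> (Suc N) u = riesz \<alpha> N u * (1 + \<i> * of_real (\<alpha> * Re (u ^ freq N)))"

lemma riesz_Suc:
  "riesz \<alpha> (Suc N) u = riesz \<alpha> N u + (\<i> * of_real \<alpha> / 2) * (u ^ freq N * riesz \<alpha> N u + cnj u ^ freq N * riesz \<alpha> N u)"
proof -
  define x where "x = u ^ freq N"
  have cnj: "cnj u ^ freq N = cnj x" by (simp add: x_def)
  have Re: "of_real (Re x) = (x + cnj x) / 2" using complex_add_cnj[of x] by simp
  show ?thesis unfolding riesz.simps of_real_mult cnj x_def[symmetric] Re by (simp add: field_simps)
qed

lemma trig_riesz: "trig (2 * 4 ^ N) (riesz \<alpha> N)"
proof (induction N)
  case 0
  have "trig 2 (\<lambda>u. u ^ 0 * cnj u ^ 0)" by (intro trig_monom) auto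
  then show ?case by (simp add: riesz.simps(1)[abs_def])
next
  case (Suc N)
  have "trig (2 * 4 ^ N + freq N) (\<lambda>u. u ^ freq N * riesz \<alpha> N u + cnj u ^ freq N * riesz \<alpha> N u)"
    using Suc by (intro trig_add trig_mult_power trig_mult_cnj_power)
  then have "trig (2 * 4 ^ N + freq N) (\<lambda>u. riesz \<alpha> N u + (\<i> * of_real \<alpha> / 2) * (u ^ freq N * riesz \<alpha> N u + cnj u ^ freq N * riesz \<alpha> N u))"
    by (rule trig_add[OF trig_mono[OF Suc le_add1] trig_scale])
  then have "trig (2 * 4 ^ N + freq N) (riesz \<alpha> (Suc N))"
    unfolding riesz_Suc[symmetric] .
  then show ?case by (rule trig_mono) simp
qed

text \<open>The new frequency exceeds those of g, so both added terms have mean zero. It is applied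
  to g = \<open>riesz\<close> and to its product with an earlier power.\<close>

lemma integral_riesz_step:
  assumes g: "trig d g" and d: "d < freq N"
  shows "(\<integral>v. (g (sgn v) + (\<i> * of_real \<alpha> / 2) * (sgn v ^ freq N * g (sgn v) + cnj (sgn v) ^ freq N * g (sgn v))) \<partial>dA)
       = (\<integral>v. g (sgn v) \<partial>dA)"
proof -
  have "integrable dA (\<lambda>v. sgn v ^ freq N * g (sgn v))" "integrable dA (\<lambda>v. cnj (sgn v) ^ freq N * g (sgn v))"
    "integrable dA (\<lambda>v. g (sgn v))"
    using trig_integrable[OF trig_mult_power[OF g]] trig_integrable[OF trig_mult_cnj_power[OF g]] trig_integrable[OF g] by auto
  then show ?thesis
    using trig_integral_power_eq_0[OF g d] trig_integral_cnj_power_eq_0[OF g d]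
    by (simp del: power_Suc)
qed

lemma integral_riesz: "(\<integral>v. riesz \<alpha> N (sgn v) \<partial>dA) = 1"
proof (induction N)
  case 0
  show ?case using dA.prob_space by simp
next
  case (Suc N)
  show ?case unfolding riesz_Suc using Suc integral_riesz_step[OF trig_riesz, of N N \<alpha> \<alpha>] by simp
qed

text \<open>Only the k-th factor matters: its term \<open>cnj u ^ freq k\<close> meets
  \<open>u ^ freq k\<close> and leaves \<i> \<alpha> / 2 times the mean 1 of the earlier product;
  later factors do not change the mean.\<close>

lemma integral_riesz_freq:
  "k < N \<Longrightarrow> (\<integral>v. riesz \<alpha> N (sgn v) * sgn v ^ freq k \<partial>dA) = \<i> * of_real \<alpha> / 2"
proof (induction N)
  case (Suc N)
  note T = trig_riesz[of N \<alpha>]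
  show ?case
  proof (cases "k = N")
    case False
    then have k: "k < N" using Suc by simp
    then have "freq k \<le> 4 ^ N" by (intro power_increasing) auto
    then have "trig (2 * 4 ^ N + 4 ^ N) (\<lambda>u. u ^ freq k * riesz \<alpha> N u)"
      by (intro trig_mono[OF trig_mult_power[OF T]]) auto
    moreover have "2 * 4 ^ N + 4 ^ N < freq N" by simp
    ultimately have "(\<integral>v. (sgn v ^ freq k * riesz \<alpha> N (sgn v) + (\<i> * of_real \<alpha> / 2) * (sgn v ^ freq N * (sgn v ^ freq k * riesz \<alpha> N (sgn v)) +
        cnj (sgn v) ^ freq N * (sgn v ^ freq k * riesz \<alpha> N (sgn v)))) \<partial>dA) = (\<integral>v. sgn v ^ freq k * riesz \<alpha> N (sgn v) \<partial>dA)"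
      by (rule integral_riesz_step)
    then
    have "(\<integral>v. riesz \<alpha> (Suc N) (sgn v) * sgn v ^ freq k \<partial>dA) = (\<integral>v. sgn v ^ freq k * riesz \<alpha> N (sgn v) \<partial>dA)"
      unfolding riesz_Suc by (simp add: algebra_simps del: power_Suc)
    also have "\<dots> = \<i> * of_real \<alpha> / 2" using Suc.IH[OF k] by (simp add: mult.commute del: power_Suc)
    finally show ?thesis .
  next
    case True
    let ?n = "freq N"
    have i1: "integrable dA (\<lambda>v. sgn v ^ ?n * riesz \<alpha> N (sgn v))"
      by (rule trig_integrable[OF trig_mult_power[OF T]])
    have i2: "integrable dA (\<lambda>v. sgn v ^ (?n + ?n) * riesz \<alpha> N (sgn v))"
      by (rule trig_integrable[OF trig_mult_power[OF T]])
    have i3: "integrable dA (\<lambda>v. riesz \<alpha> N (sgn v))"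
      by (rule trig_integrable[OF T])
    have [measurable]: "riesz \<alpha> N \<in> borel_measurable borel" by (rule trig_measurable[OF T])
    have "(\<integral>v. riesz \<alpha> (Suc N) (sgn v) * sgn v ^ ?n \<partial>dA) =
        (\<integral>v. sgn v ^ ?n * riesz \<alpha> N (sgn v) + (\<i> * of_real \<alpha> / 2) * (sgn v ^ (?n + ?n) * riesz \<alpha> N (sgn v) + riesz \<alpha> N (sgn v)) \<partial>dA)"
    proof (rule integral_cong_AE)
      show "AE v in dA. riesz \<alpha> (Suc N) (sgn v) * sgn v ^ ?n =
          sgn v ^ ?n * riesz \<alpha> N (sgn v) + (\<i> * of_real \<alpha> / 2) * (sgn v ^ (?n + ?n) * riesz \<alpha> N (sgn v) + riesz \<alpha> N (sgn v))"
        using AE_dA_nonzero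
      proof eventually_elim
        case (elim v)
        define x where "x = sgn v ^ ?n"
        define y where "y = cnj (sgn v) ^ ?n"
        have "sgn v * cnj (sgn v) = 1" using complex_norm_square[of "sgn v"] elim by (simp add: norm_sgn)
        then have "y * x = 1" unfolding x_def y_def by (simp add: mult.commute flip: power_mult_distrib)
        then have "(y * riesz \<alpha> N (sgn v)) * x = riesz \<alpha> N (sgn v)" by (simp add: mult_ac)
        then show ?case
          unfolding riesz_Suc power_add x_def[symmetric] y_def[symmetric] by (simp add: algebra_simps)
      qed
    qed (simp_all del: power_Suc, measurable)
    also have "\<dots> = (\<integral>v. sgn v ^ ?n * riesz \<alpha> N (sgn v) \<partial>dA) + (\<i> * of_real \<alpha> / 2) *
        ((\<integral>v. sgn v ^ (?n + ?n) * riesz \<alpha> N (sgn v) \<partial>dA) + (\<integral>v. riesz \<alpha> N (sgn v) \<partial>dA))"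
      using i1 i2 i3 by (simp del: power_Suc)
    also have "(\<integral>v. sgn v ^ ?n * riesz \<alpha> N (sgn v) \<partial>dA) = 0"
      by (rule trig_integral_power_eq_0[OF T]) simp
    also have "(\<integral>v. sgn v ^ (?n + ?n) * riesz \<alpha> N (sgn v) \<partial>dA) = 0"
      by (rule trig_integral_power_eq_0[OF T]) simp
    finally show ?thesis using True by (simp add: integral_riesz)
  qed
qed simp

text \<open>The squared modulus is at most (1 + 1 / N)^N \<le> exp 1 < 4.\<close>

lemma cmod_riesz_le:
  assumes u: "cmod u \<le> 1" and N: "0 < N"
  shows "cmod (riesz (1 / sqrt N) N u) \<le> 2"
proof -
  define \<alpha> where "\<alpha> = 1 / sqrt N"
  have "(cmod (riesz \<alpha> n u))\<^sup>2 \<le> (1 + \<alpha>\<^sup>2) ^ n" for n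
  proof (induction n)
    case (Suc n)
    define x where "x = Re (u ^ freq n)"
    have "\<bar>x\<bar> \<le> cmod (u ^ freq n)" unfolding x_def by (rule abs_Re_le_cmod)
    also have "\<dots> \<le> 1" using u unfolding norm_power by (intro power_le_one) auto
    finally have "x\<^sup>2 \<le> 1" by (simp add: abs_square_le_1)
    then have "\<alpha>\<^sup>2 * x\<^sup>2 \<le> \<alpha>\<^sup>2" by (intro mult_left_le) auto
    then have "(cmod (1 + \<i> * of_real (\<alpha> * x)))\<^sup>2 \<le> 1 + \<alpha>\<^sup>2"
      by (simp add: cmod_power2 power_mult_distrib)
    then have "(cmod (riesz \<alpha> n u))\<^sup>2 * (cmod (1 + \<i> * of_real (\<alpha> * x)))\<^sup>2 \<le> (1 + \<alpha>\<^sup>2) ^ n * (1 + \<alpha>\<^sup>2)"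
      using Suc by (intro mult_mono) auto
    then show ?case by (simp add: x_def norm_mult power_mult_distrib mult_ac del: power_Suc(1)[of 4])
  qed simp
  from this[of N] have "(cmod (riesz \<alpha> N u))\<^sup>2 \<le> (1 + \<alpha>\<^sup>2) ^ N" .
  also have "\<dots> \<le> exp (\<alpha>\<^sup>2) ^ N" by (intro power_mono exp_ge_add_one_self) auto
  also have "\<dots> = exp 1" using N by (simp add: \<alpha>_def power_divide flip: exp_of_nat_mult)
  also have "\<dots> \<le> 2\<^sup>2" using exp_le by simp
  finally show ?thesis unfolding \<alpha>_def by (rule power2_le_imp_le) simp
qed

text \<open>The Riesz product gives every frequency the same factor \<i> \<alpha> / 2, so the
  coefficients add up without cancellation. The constant 4 is the bound 2 for the product times the
  2 in \<alpha> / 2, and sqrt N is 1 / \<alpha>.\<close>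

lemma lacunary_L1_lower:
  fixes \<beta> :: "nat \<Rightarrow> real"
  assumes N: "0 < N" and \<beta>: "\<And>k. 0 \<le> \<beta> k"
  shows "(\<Sum>k<N. \<beta> k) \<le> 4 * sqrt N * (\<integral>v. cmod (\<Sum>k<N. of_real (\<beta> k) * sgn v ^ freq k) \<partial>dA)"
proof -
  define \<alpha> where "\<alpha> = 1 / sqrt N"
  have \<alpha>: "\<alpha> > 0" using N by (simp add: \<alpha>_def)
  define G where "G v = (\<Sum>k<N. of_real (\<beta> k) * sgn v ^ freq k)" for v :: complex
  have [measurable]: "riesz \<alpha> N \<in> borel_measurable borel" "G \<in> borel_measurable borel"
    unfolding G_def[abs_def] using trig_measurable[OF trig_riesz] by measurable
  have bnd: "cmod (riesz \<alpha> N (sgn v)) \<le> 2" for v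
    unfolding \<alpha>_def using N by (intro cmod_riesz_le) (auto simp: norm_sgn)
  have Gb: "cmod (G v) \<le> (\<Sum>k<N. \<beta> k)" for v
    unfolding G_def
    by (rule order_trans[OF norm_sum sum_mono])
       (use \<beta> cmod_sgn_power_le[of v] in \<open>auto simp: norm_mult intro!: mult_left_le simp del: power_Suc\<close>)
  have Gi: "integrable dA (\<lambda>v. cmod (G v))"
    by (rule integrable_dA_bounded[of _ "\<Sum>k<N. \<beta> k"]) (use Gb in auto)
  have "(\<integral>v. riesz \<alpha> N (sgn v) * G v \<partial>dA) = (\<integral>v. (\<Sum>k<N. of_real (\<beta> k) * (riesz \<alpha> N (sgn v) * sgn v ^ freq k)) \<partial>dA)"
    by (simp add: G_def sum_distrib_left mult_ac)
  also have "\<dots> = (\<Sum>k<N. of_real (\<beta> k) * (\<integral>v. riesz \<alpha> N (sgn v) * sgn v ^ freq k \<partial>dA))"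
  proof -
    have "integrable dA (\<lambda>v. riesz \<alpha> N (sgn v) * sgn v ^ freq k)" for k
      using trig_integrable[OF trig_mult_power[OF trig_riesz[of N \<alpha>], of "freq k"]] by (simp add: mult.commute)
    then show ?thesis by (simp add: Bochner_Integration.integral_sum del: power_Suc)
  qed
  also have "\<dots> = (\<Sum>k<N. of_real (\<beta> k)) * (\<i> * of_real \<alpha> / 2)"
    by (simp add: integral_riesz_freq sum_distrib_right del: power_Suc)
  also have "\<dots> = \<i> * of_real ((\<Sum>k<N. \<beta> k) * (\<alpha> / 2))" by simp
  finally have "cmod (\<integral>v. riesz \<alpha> N (sgn v) * G v \<partial>dA) = (\<Sum>k<N. \<beta> k) * (\<alpha> / 2)"
    using \<alpha> \<beta> by (simp only: norm_mult norm_of_real norm_ii) (simp add: sum_nonneg)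
  moreover have "cmod (\<integral>v. riesz \<alpha> N (sgn v) * G v \<partial>dA) \<le> (\<integral>v. 2 * cmod (G v) \<partial>dA)"
  proof (rule order_trans[OF integral_norm_bound integral_mono])
    show le: "norm (riesz \<alpha> N (sgn v) * G v) \<le> 2 * cmod (G v)" for v
      using mult_right_mono[OF bnd[of v], of "cmod (G v)"] by (simp add: norm_mult)
    show "integrable dA (\<lambda>v. 2 * cmod (G v))" using Gi by simp
    show "integrable dA (\<lambda>v. norm (riesz \<alpha> N (sgn v) * G v))"
      by (rule Bochner_Integration.integrable_bound[of _ "\<lambda>v. 2 * cmod (G v)"]) (use Gi le in auto)
  qed
  ultimately have "(\<Sum>k<N. \<beta> k) * (\<alpha> / 2) \<le> 2 * (\<integral>v. cmod (G v) \<partial>dA)" using Gi by simp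
  then show ?thesis using N unfolding \<alpha>_def G_def by (simp add: field_simps del: power_Suc)
qed

section \<open>Lacunary test functions\<close>

text \<open>The reciprocal of \<open>freq k\<close>: at this distance from the circle a monomial of
  degree \<open>freq k\<close> is still of order 1.\<close>

definition gap :: "nat \<Rightarrow> real" where "gap k = 1 / 4 ^ Suc k"

text \<open>The inner and outer values of \<open>wt\<close> differ by a factor 2 while the gaps have
  ratio 4, so the annuli are disjoint.\<close>

definition annulus :: "nat \<Rightarrow> complex set" where
  "annulus k = {w. gap k / 2 < wt w \<and> wt w \<le> gap k}"

definition block :: "nat \<Rightarrow> complex \<Rightarrow> complex" where
  "block k w = indicator (annulus k) w * sgn w ^ freq k"

text \<open>The factor with which the integral of the kernel against \<open>block k\<close>
  reproduces the monomial \<open>u ^ freq k\<close>.\<close>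

definition block_coeff :: "real \<Rightarrow> real \<Rightarrow> nat \<Rightarrow> real" where
  "block_coeff b c k = binom_coeff c (freq k) * (\<integral>w. wt w powr b * (indicator (annulus k) w * cmod w ^ freq k) \<partial>dA)"

definition lacunary :: "(nat \<Rightarrow> real) \<Rightarrow> nat \<Rightarrow> complex \<Rightarrow> complex" where
  "lacunary a N w = (\<Sum>k<N. of_real (a k) * block k w)"

lemma gap_pos [simp]: "0 < gap k"
  by (simp add: gap_def)

lemma gap_nonneg [simp]: "0 \<le> gap k" and gap_nonzero [simp]: "gap k \<noteq> 0"
  using gap_pos[of k] by linarith+

lemma gap_antimono: "j \<le> k \<Longrightarrow> gap k \<le> gap j"
  unfolding gap_def by (intro divide_left_mono power_increasing) auto

lemma gap_less:
  assumes "j < k"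
  shows "gap k < gap j / 2"
proof -
  have "gap k \<le> gap (Suc j)" using assms by (intro gap_antimono) simp
  also have "\<dots> = gap j / 4" by (simp add: gap_def)
  also have "\<dots> < gap j / 2" by simp
  finally show ?thesis .
qed

lemma gap_le_quarter: "gap k \<le> 1 / 4"
  using gap_antimono[of 0 k] by (simp add: gap_def)

lemma annulus_measurable [measurable]: "annulus k \<in> sets borel"
  unfolding annulus_def by measurable

lemma annulus_unique: "w \<in> annulus j \<Longrightarrow> w \<in> annulus k \<Longrightarrow> j = k"
  using gap_less[of j k] gap_less[of k j] by (cases j k rule: linorder_cases) (auto simp: annulus_def)

lemma annulus_nonzero: "w \<in> annulus k \<Longrightarrow> w \<noteq> 0"
  using gap_le_quarter[of k] by (auto simp: annulus_def wt_def)

lemma block_measurable [measurable]: "block k \<in> borel_measurable borel"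
  unfolding block_def[abs_def] by measurable

lemma lacunary_measurable [measurable]: "lacunary a N \<in> borel_measurable borel"
  unfolding lacunary_def[abs_def] by measurable

lemma cmod_block: "cmod (block k w) = indicator (annulus k) w"
  using annulus_nonzero[of w k] by (auto simp: block_def norm_mult norm_power norm_sgn indicator_def)

lemma lacunary_in_annulus:
  assumes "w \<in> annulus k" "k < N"
  shows "lacunary a N w = of_real (a k) * block k w"
proof -
  have "lacunary a N w = (\<Sum>j\<in>{k}. of_real (a j) * block j w)"
    unfolding lacunary_def using assms
    by (intro sum.mono_neutral_right) (auto simp: block_def indicator_def dest: annulus_unique)
  then show ?thesis by simp
qed

lemma cmod_lacunary:
  assumes "\<And>k. 0 \<le> a k"
  shows "cmod (lacunary a N w) = (\<Sum>k<N. a k * indicator (annulus k) w)"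
proof (cases "\<exists>k<N. w \<in> annulus k")
  case True
  then obtain k where k: "k < N" "w \<in> annulus k" by auto
  have "(\<Sum>j<N. a j * indicator (annulus j) w) = (\<Sum>j\<in>{k}. a j * indicator (annulus j) w)"
    using k by (intro sum.mono_neutral_right) (auto simp: indicator_def dest: annulus_unique)
  then show ?thesis using k lacunary_in_annulus[OF k(2,1), of a] assms[of k] by (simp add: norm_mult cmod_block)
qed (auto simp: lacunary_def block_def indicator_def intro!: sum.neutral)

lemma lacunary_nonzeroD:
  assumes "lacunary a N w \<noteq> 0"
  shows "gap N \<le> wt w" "cmod (lacunary a N w) \<le> (\<Sum>k<N. \<bar>a k\<bar>)"
proof -
  from assms obtain k where k: "k < N" "block k w \<noteq> 0"
    unfolding lacunary_def by (metis (no_types, lifting) lessThan_iff mult_zero_right sum.neutral)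
  then have "w \<in> annulus k" by (auto simp: block_def indicator_def split: if_splits)
  then show "gap N \<le> wt w" using gap_less[OF k(1)] by (simp add: annulus_def)
  show "cmod (lacunary a N w) \<le> (\<Sum>k<N. \<bar>a k\<bar>)"
    unfolding lacunary_def
    by (rule order_trans[OF norm_sum sum_mono]) (auto simp: norm_mult cmod_block indicator_def)
qed

lemma annulus_disc: "annulus k \<subseteq> disc"
proof
  fix w assume "w \<in> annulus k"
  then have "0 < wt w" using gap_pos[of k] by (simp add: annulus_def)
  then show "w \<in> disc" by (simp add: wt_def abs_square_less_1)
qed

lemma emeasure_annulus: "emeasure dA (annulus k) = ennreal (gap k / 2)"
proof -
  have eq: "annulus k = {z \<in> disc. wt z \<le> gap k} - {z \<in> disc. wt z \<le> gap k / 2}"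
    using annulus_disc[of k] by (auto simp: annulus_def)
  have m: "{z \<in> disc. wt z \<le> x} \<in> sets dA" for x by (rule disc_sets_dA) measurable
  have e: "emeasure dA {z \<in> disc. wt z \<le> gap k} = ennreal (gap k)"
    "emeasure dA {z \<in> disc. wt z \<le> gap k / 2} = ennreal (gap k / 2)"
    by (rule emeasure_dA_wt_le, use gap_le_quarter[of k] gap_pos[of k] in linarith, use gap_le_quarter[of k] gap_pos[of k] in linarith)+
  have "emeasure dA (annulus k) = ennreal (gap k) - ennreal (gap k / 2)"
    unfolding eq e[symmetric]
  proof (rule emeasure_Diff[OF _ m m])
    have "gap k / 2 \<le> gap k" by (simp add: less_imp_le)
    then show "{z \<in> disc. wt z \<le> gap k / 2} \<subseteq> {z \<in> disc. wt z \<le> gap k}"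
      by (intro Collect_mono impI conjI) (elim conjE, assumption, elim conjE, rule order_trans)
  qed simp
  also have "\<dots> = ennreal (gap k / 2)" by (simp add: ennreal_minus)
  finally show ?thesis .
qed

lemma annulus_sets: "annulus k \<in> sets dA"
proof -
  have "{z \<in> disc. z \<in> annulus k} = annulus k" using annulus_disc[of k] by auto
  then show ?thesis using disc_sets_dA[of "\<lambda>z. z \<in> annulus k"] by simp
qed

lemma measure_annulus: "measure dA (annulus k) = gap k / 2"
  using emeasure_annulus[of k] by (simp add: measure_def)

lemma moment_block:
  "moment b (block k) m = (if m = freq k then of_real (\<integral>w. wt w powr b * (indicator (annulus k) w * cmod w ^ freq k) \<partial>dA) else 0)"
proof -
  define \<phi> where "\<phi> r = complex_of_real ((1 - r\<^sup>2) powr b * indicator {x. gap k / 2 < x \<and> x \<le> gap k} (1 - r\<^sup>2) * r ^ m)" for r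
  have [measurable]: "\<phi> \<in> borel_measurable borel" unfolding \<phi>_def[abs_def] by measurable
  have cnj: "cnj w = of_real (cmod w) * cnj (sgn w)" for w
    by (cases "w = 0") (simp_all add: sgn_div_norm scaleR_conv_of_real)
  have eq: "of_real (wt w powr b) * block k w * cnj w ^ m = \<phi> (cmod w) * (sgn w ^ freq k * cnj (sgn w) ^ m)" for w
    unfolding cnj[of w] power_mult_distrib
    by (simp add: \<phi>_def block_def wt_def annulus_def indicator_def mult_ac del: power_Suc)
  have eqm: "moment b (block k) m = (\<integral>w. \<phi> (cmod w) * (sgn w ^ freq k * cnj (sgn w) ^ m) \<partial>dA)"
    unfolding moment_def eq ..
  show ?thesis
  proof (cases "m = freq k")
    case False
    then show ?thesis unfolding eqm using integral_sgn_orthogonal[of \<phi> "freq k" m] by auto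
  next
    case True
    have "(\<integral>w. \<phi> (cmod w) * (sgn w ^ freq k * cnj (sgn w) ^ m) \<partial>dA) =
        (\<integral>w. complex_of_real (wt w powr b * (indicator (annulus k) w * cmod w ^ freq k)) \<partial>dA)"
    proof (rule Bochner_Integration.integral_cong[OF refl])
      fix w
      show "\<phi> (cmod w) * (sgn w ^ freq k * cnj (sgn w) ^ m) = complex_of_real (wt w powr b * (indicator (annulus k) w * cmod w ^ freq k))"
      proof (cases "w \<in> annulus k")
        case True2: True
        have "sgn w * cnj (sgn w) = 1"
          using complex_norm_square[of "sgn w"] annulus_nonzero[OF True2] by (simp add: norm_sgn)
        then have "sgn w ^ freq k * cnj (sgn w) ^ m = 1" unfolding True by (simp flip: power_mult_distrib)
        then show ?thesis using True2 True by (simp add: \<phi>_def annulus_def wt_def del: power_Suc)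
      qed (simp add: \<phi>_def annulus_def wt_def indicator_def)
    qed
    also have "\<dots> = of_real (\<integral>w. wt w powr b * (indicator (annulus k) w * cmod w ^ freq k) \<partial>dA)"
      by (rule integral_complex_of_real)
    finally show ?thesis unfolding eqm if_P[OF True] .
  qed
qed

text \<open>A block has a single angular frequency, so angular orthogonality leaves one term of the
  binomial series. The points u of the circle are included because a block vanishes near the
  boundary.\<close>

lemma kernel_T_block:
  assumes c: "0 < c" and u: "cmod u \<le> 1"
  shows "integrable dA (\<lambda>w. kernel (T_op a b c) u w * block k w)"
    and "(\<integral>w. kernel (T_op a b c) u w * block k w \<partial>dA) = of_real (block_coeff b c k) * u ^ freq k"
proof -
  have s: "0 < gap k / 2" "\<And>w. w \<in> disc \<Longrightarrow> block k w \<noteq> 0 \<Longrightarrow> gap k / 2 \<le> wt w"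
    by (auto simp: block_def annulus_def indicator_def split: if_splits)
  have b1: "cmod (block k w) \<le> 1" for w by (simp add: cmod_block indicator_def)
  have "integrable dA (\<lambda>w. of_real (wt w powr b) * block k w)"
    by (rule test_fun_integrable[OF _ b1 s]) measurable
  note E = kernel_T_expansion[OF c this u, of "sqrt (1 - gap k / 2)" a]
  have r: "sqrt (1 - gap k / 2) < 1" by simp
  have r2: "cmod (u * cnj w) \<le> sqrt (1 - gap k / 2)" if "w \<in> disc" "block k w \<noteq> 0" for w
    using test_fun_radius[OF s(1) s(2)[OF that] u] .
  show "integrable dA (\<lambda>w. kernel (T_op a b c) u w * block k w)" by (rule E(1)[OF r r2])
  have "(\<lambda>n. of_real (binom_coeff c n) * moment b (block k) n * u ^ n) sums
      (\<Sum>n\<in>{freq k}. of_real (binom_coeff c n) * moment b (block k) n * u ^ n)"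
    by (rule sums_finite) (auto simp: moment_block)
  from sums_unique2[OF E(2)[OF r r2] this]
  show "(\<integral>w. kernel (T_op a b c) u w * block k w \<partial>dA) = of_real (block_coeff b c k) * u ^ freq k"
    by (simp add: moment_block block_coeff_def del: power_Suc)
qed

lemma kernel_T_lacunary:
  assumes c: "0 < c" and u: "cmod u \<le> 1"
  shows "(\<integral>w. kernel (T_op a b c) u w * lacunary x N w \<partial>dA) = (\<Sum>k<N. of_real (x k * block_coeff b c k) * u ^ freq k)"
proof -
  have "(\<integral>w. kernel (T_op a b c) u w * lacunary x N w \<partial>dA) = (\<integral>w. (\<Sum>k<N. of_real (x k) * (kernel (T_op a b c) u w * block k w)) \<partial>dA)"
    by (simp add: lacunary_def sum_distrib_left mult_ac)
  also have "\<dots> = (\<Sum>k<N. of_real (x k) * (of_real (block_coeff b c k) * u ^ freq k))"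
    using kernel_T_block[OF c u] by (simp add: Bochner_Integration.integral_sum del: power_Suc)
  finally show ?thesis by (simp add: mult.assoc)
qed

text \<open>Counting powers of the gap: the binomial coefficient gives 1 - c, the weight b, the
  measure of the annulus 1, in total 2 - c + b.\<close>

lemma block_coeff_lower:
  assumes c: "0 < c"
  obtains c0 where "0 < c0" "\<And>k. c0 * gap k powr (2 - c + b) \<le> block_coeff b c k"
proof -
  obtain c1 where c1: "0 < c1" "\<And>n. 1 \<le> n \<Longrightarrow> c1 * real n powr (c - 1) \<le> binom_coeff c n"
    using binom_coeff_lower[OF c] by blast
  \<comment> \<open>On the annulus \<open>wt\<close> lies between g / 2 and g; q absorbs this factor
    2 for either sign of b.\<close>
  define q where "q = 2 powr (- \<bar>b\<bar>)"
  have q: "0 < q" by (simp add: q_def)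
  have "c1 * q / 4 * gap k powr (2 - c + b) \<le> block_coeff b c k" for k
  proof -
    define g where "g = gap k"
    have g: "0 < g" "g \<le> 1 / 4" using gap_le_quarter[of k] by (auto simp: g_def)
    define J where "J w = wt w powr b * (indicator (annulus k) w * cmod w ^ freq k)" for w
    have J: "q * g powr b / 2 * indicator (annulus k) w \<le> J w" for w
    proof (cases "w \<in> annulus k")
      case True
      then have w: "g / 2 < wt w" "wt w \<le> g" by (auto simp: annulus_def g_def)
      have "q * g powr b \<le> wt w powr b"
      proof (cases "0 \<le> b")
        case True
        have "q * g powr b = (g / 2) powr b" using True g by (simp add: q_def powr_divide powr_minus field_simps)
        also have "\<dots> \<le> wt w powr b" using w g True by (intro powr_mono2) auto
        finally show ?thesis .
      next
        case False
        have "q \<le> 1" using powr_mono[of "- \<bar>b\<bar>" 0 2] by (simp add: q_def)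
        then have "q * g powr b \<le> 1 * g powr b" by (intro mult_right_mono) auto
        also have "\<dots> \<le> wt w powr b" using w g False by (simp, intro powr_mono2') auto
        finally show ?thesis .
      qed
      moreover have "1 / 2 \<le> cmod w ^ freq k"
      proof -
        \<comment> \<open>\<open>freq k\<close> is twice \<open>2 * 4 ^ k\<close>, so |w|^freq k is
          a power of |w|^2 \<ge> 1 - g with exponent 1 / (2 g); Bernoulli's inequality then leaves
          exactly 1/2.\<close>
        have "1 / 2 = 1 + real (2 * 4 ^ k) * (- g)" by (simp add: g_def gap_def)
        also have "\<dots> \<le> (1 + (- g)) ^ (2 * 4 ^ k)" using g by (intro Bernoulli_inequality) auto
        also have "\<dots> \<le> ((cmod w)\<^sup>2) ^ (2 * 4 ^ k)" using w g by (intro power_mono) (auto simp: wt_def)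
        also have "\<dots> = cmod w ^ freq k" by (simp flip: power_mult)
        finally show ?thesis .
      qed
      ultimately have "q * g powr b * (1 / 2) \<le> wt w powr b * cmod w ^ freq k"
        using q by (intro mult_mono) auto
      then show ?thesis using True by (simp add: J_def del: power_Suc)
    qed (simp add: J_def)
    have Ji: "integrable dA J"
    proof -
      have "integrable dA (\<lambda>w. of_real (wt w powr b) * of_real (indicator (annulus k) w * cmod w ^ freq k) :: complex)"
      proof (rule test_fun_integrable)
        show "0 < gap k / 2" by simp
        show "cmod (of_real (indicator (annulus k) w * cmod w ^ freq k)) \<le> 1" for w
        proof (cases "w \<in> annulus k")
          case True
          then have "cmod w \<le> 1" using annulus_disc[of k] by auto
          then have "cmod w ^ freq k \<le> 1" by (intro power_le_one) auto
          then show ?thesis by (simp add: indicator_def del: power_Suc of_real_mult)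
        qed simp
        show "gap k / 2 \<le> wt w" if "complex_of_real (indicator (annulus k) w * cmod w ^ freq k) \<noteq> 0" for w
          using that by (auto simp: annulus_def indicator_def split: if_splits)
      qed measurable
      then have "integrable dA (\<lambda>w. complex_of_real (J w))" by (simp add: J_def)
      then show ?thesis by (simp add: complex_of_real_integrable_eq)
    qed
    have "q * g powr b / 2 * measure dA (annulus k) = (\<integral>w. q * g powr b / 2 * indicator (annulus k) w \<partial>dA)"
      using annulus_disc[of k] by (simp add: Int_absorb2)
    also have "\<dots> \<le> (\<integral>w. J w \<partial>dA)"
    proof (rule integral_mono[OF _ Ji J])
      show "integrable dA (\<lambda>w. q * g powr b / 2 * indicator (annulus k) w)"
        using annulus_sets[of k] emeasure_annulus[of k] by (intro integrable_mult_right integrable_real_indicator) auto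
    qed
    finally have "q / 4 * g powr (b + 1) \<le> (\<integral>w. J w \<partial>dA)"
      using g by (simp add: measure_annulus g_def[symmetric] powr_add field_simps)
    moreover have "c1 * g powr (1 - c) \<le> binom_coeff c (freq k)"
    proof -
      have "real (freq k) = 1 / g" by (simp add: g_def gap_def)
      also have "\<dots> = g powr (-1)" using g by (simp add: powr_minus_divide)
      finally have "real (freq k) = g powr (-1)" .
      then have "real (freq k) powr (c - 1) = g powr (1 - c)" by (simp only: powr_powr) simp
      moreover have "1 \<le> freq k" by simp
      ultimately show ?thesis using c1(2)[of "freq k"] by (simp del: power_Suc)
    qed
    ultimately have "(c1 * g powr (1 - c)) * (q / 4 * g powr (b + 1)) \<le> binom_coeff c (freq k) * (\<integral>w. J w \<partial>dA)"
      using c1 q binom_coeff_pos[OF c, of "freq k"] by (intro mult_mono) (auto simp: less_imp_le)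
    also have "\<dots> = block_coeff b c k" by (simp add: block_coeff_def J_def)
    also have "(c1 * g powr (1 - c)) * (q / 4 * g powr (b + 1)) = c1 * q / 4 * (g powr (1 - c) * g powr (b + 1))"
      by simp
    also have "g powr (1 - c) * g powr (b + 1) = g powr (2 - c + b)"
      by (simp flip: powr_add) (simp add: algebra_simps)
    finally show ?thesis by (simp add: g_def)
  qed
  then show ?thesis using c1 q by (intro that[of "c1 * q / 4"]) auto
qed

lemma block_coeff_pos:
  assumes "0 < c"
  shows "0 < block_coeff b c k"
proof -
  obtain c0 where "0 < c0" "\<And>k. c0 * gap k powr (2 - c + b) \<le> block_coeff b c k"
    using block_coeff_lower[OF assms] by blast
  moreover have "0 < gap k powr (2 - c + b)" by simp
  ultimately show ?thesis by (meson less_le_trans mult_pos_pos)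
qed

lemma integral_cmod_sgn_power: "(\<integral>v. cmod (sgn v ^ n) \<partial>dA) = 1"
proof -
  have "(\<integral>v. cmod (sgn v ^ n) \<partial>dA) = (\<integral>v. 1 \<partial>dA)"
    by (rule integral_cong_AE)
       (measurable, use AE_dA_nonzero in \<open>eventually_elim, simp add: norm_power norm_sgn\<close>)
  then show ?thesis using dA.prob_space by simp
qed

lemma weak_L1_norm_T_block_ge:
  assumes c: "0 < c"
  shows "ennreal (block_coeff b c k) \<le> weak_L1_norm (op_apply (T_op (-1) b c) (block k))"
proof -
  have b1: "cmod (block k w) \<le> 1" for w by (simp add: cmod_block indicator_def)
  have s: "0 < gap k / 2" "\<And>w. w \<in> disc \<Longrightarrow> block k w \<noteq> 0 \<Longrightarrow> gap k / 2 \<le> wt w"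
    by (auto simp: block_def annulus_def indicator_def split: if_splits)
  have "ennreal (\<integral>v. cmod (\<integral>w. kernel (T_op (-1) b c) (sgn v) w * block k w \<partial>dA) \<partial>dA)
      \<le> weak_L1_norm (op_apply (T_op (-1) b c) (block k))"
    by (rule weak_L1_norm_T_ge_circle(1)[OF c _ b1 s]) measurable
  also have "(\<integral>v. cmod (\<integral>w. kernel (T_op (-1) b c) (sgn v) w * block k w \<partial>dA) \<partial>dA) = (\<integral>v. block_coeff b c k * cmod (sgn v ^ freq k) \<partial>dA)"
    using block_coeff_pos[OF c, of b k]
    by (intro Bochner_Integration.integral_cong refl)
       (simp add: kernel_T_block[OF c] norm_sgn norm_mult abs_of_pos del: power_Suc)
  also have "\<dots> = block_coeff b c k * (\<integral>v. cmod (sgn v ^ freq k) \<partial>dA)" by (rule integral_mult_right_zero)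
  also have "\<dots> = block_coeff b c k" unfolding integral_cmod_sgn_power by simp
  finally show ?thesis .
qed

lemma lacunary_bounds:
  shows "cmod (lacunary a N w) \<le> (\<Sum>k<N. \<bar>a k\<bar>)" "0 < gap N"
    "w \<in> disc \<Longrightarrow> lacunary a N w \<noteq> 0 \<Longrightarrow> gap N \<le> wt w"
  using lacunary_nonzeroD[of a N w] by (cases "lacunary a N w = 0", auto simp: sum_nonneg)

lemma circle_lacunary_lower:
  assumes c: "0 < c" and N: "0 < N" and a: "\<And>k. 0 \<le> a k"
  shows "(\<Sum>k<N. a k * block_coeff b c k) \<le> 4 * sqrt N * (\<integral>v. cmod (\<integral>w. kernel (T_op (-1) b c) (sgn v) w * lacunary a N w \<partial>dA) \<partial>dA)"
proof -
  have "(\<integral>w. kernel (T_op (-1) b c) (sgn v) w * lacunary a N w \<partial>dA) = (\<Sum>k<N. of_real (a k * block_coeff b c k) * sgn v ^ freq k)" for v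
    by (rule kernel_T_lacunary[OF c]) (simp add: norm_sgn)
  then show ?thesis
    using lacunary_L1_lower[OF N, of "\<lambda>k. a k * block_coeff b c k"] a block_coeff_pos[OF c, of b]
    by (simp add: less_imp_le del: power_Suc)
qed

lemma weak_L1_norm_T_lacunary_ge:
  assumes c: "0 < c" and N: "0 < N" and a: "\<And>k. 0 \<le> a k"
  shows "ennreal ((\<Sum>k<N. a k * block_coeff b c k) / (4 * sqrt N)) \<le> weak_L1_norm (op_apply (T_op (-1) b c) (lacunary a N))"
proof -
  have "(\<Sum>k<N. a k * block_coeff b c k) / (4 * sqrt N) \<le> (\<integral>v. cmod (\<integral>w. kernel (T_op (-1) b c) (sgn v) w * lacunary a N w \<partial>dA) \<partial>dA)"
    using circle_lacunary_lower[OF c N a, where b = b] N by (simp add: divide_le_eq mult.commute)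
  then have "ennreal ((\<Sum>k<N. a k * block_coeff b c k) / (4 * sqrt N)) \<le> ennreal (\<integral>v. cmod (\<integral>w. kernel (T_op (-1) b c) (sgn v) w * lacunary a N w \<partial>dA) \<partial>dA)"
    by (rule ennreal_leI)
  also have "\<dots> \<le> weak_L1_norm (op_apply (T_op (-1) b c) (lacunary a N))"
    by (rule weak_L1_norm_T_ge_circle(1)[OF c _ lacunary_bounds(1) lacunary_bounds(2,3)]) measurable
  finally show ?thesis .
qed

section \<open>Norms of the test functions\<close>

lemma Lp_norm_leI:
  assumes "0 < p" "0 \<le> X" "(\<integral>\<^sup>+z. ennreal (cmod (f z) powr p) \<partial>dA) \<le> ennreal X"
  shows "Lp_norm (ereal p) f \<le> ennreal (X powr (1 / p))"
proof -
  define Y where "Y = (\<integral>\<^sup>+z. ennreal (cmod (f z) powr p) \<partial>dA)"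
  have Y: "Y \<le> ennreal X" "Y \<noteq> top" using assms(3) by (auto simp: Y_def top_unique)
  have "enn2real Y \<le> X" using Y(1) assms(2) by (rule enn2real_leI[rotated])
  then have "enn2real Y powr (1 / p) \<le> X powr (1 / p)" using assms(1) by (intro powr_mono2) auto
  then show ?thesis using Y by (simp add: Lp_norm_def enn_powr_def ennreal_leI flip: Y_def)
qed

text \<open>The coefficients are normalised so that |f|^p is 1 / \<open>gap k\<close> on the k-th
  annulus, which makes each annulus contribute 1/2.\<close>

lemma Lp_norm_lacunary_le:
  assumes p: "0 < p"
  shows "Lp_norm (ereal p) (lacunary (\<lambda>k. gap k powr (- (1 / p))) N) \<le> ennreal (N powr (1 / p))"
proof (rule Lp_norm_leI[OF p])
  define a where "a k = gap k powr (- (1 / p))" for k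
  have "(\<integral>\<^sup>+z. ennreal (cmod (lacunary a N z) powr p) \<partial>dA) = (\<integral>\<^sup>+z. (\<Sum>k<N. ennreal (1 / gap k) * indicator (annulus k) z) \<partial>dA)"
  proof (rule nn_integral_cong)
    fix z
    show "ennreal (cmod (lacunary a N z) powr p) = (\<Sum>k<N. ennreal (1 / gap k) * indicator (annulus k) z)"
    proof (cases "\<exists>k<N. z \<in> annulus k")
      case True
      then obtain k where k: "k < N" "z \<in> annulus k" by auto
      have "(\<Sum>j<N. ennreal (1 / gap j) * indicator (annulus j) z) = (\<Sum>j\<in>{k}. ennreal (1 / gap j) * indicator (annulus j) z)"
        using k by (intro sum.mono_neutral_right) (auto simp: indicator_def dest: annulus_unique)
      moreover have "cmod (lacunary a N z) = a k"
        using k by (simp add: lacunary_in_annulus norm_mult cmod_block a_def)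
      moreover have "a k powr p = 1 / gap k"
        unfolding a_def powr_powr using p by (simp add: powr_minus_divide)
      ultimately show ?thesis using k by simp
    next
      case False
      then have "lacunary a N z = 0" by (auto simp: lacunary_def block_def indicator_def intro!: sum.neutral)
      moreover have "(\<Sum>k<N. ennreal (1 / gap k) * indicator (annulus k) z) = 0"
        using False by (intro sum.neutral) auto
      ultimately show ?thesis by simp
    qed
  qed
  also have "\<dots> = (\<Sum>k<N. ennreal (1 / gap k) * emeasure dA (annulus k))"
    by (subst nn_integral_sum, measurable) (intro sum.cong refl nn_integral_cmult_indicator annulus_sets)
  also have "\<dots> = (\<Sum>k<N. ennreal (1 / 2))"
    by (intro sum.cong refl) (simp add: emeasure_annulus flip: ennreal_mult)
  also have "\<dots> = ennreal (\<Sum>k<N. 1 / 2)" by (rule sum_ennreal) simp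
  also have "\<dots> \<le> ennreal N" by (rule ennreal_leI) simp
  finally show "(\<integral>\<^sup>+z. ennreal (cmod (lacunary (\<lambda>k. gap k powr (- (1 / p))) N z) powr p) \<partial>dA) \<le> ennreal N"
    by (simp add: a_def[abs_def])
qed simp

lemma Lorentz_p1_norm_le:
  assumes p: "0 < p" and E: "E \<in> sets dA" and f: "\<And>z. z \<in> disc \<Longrightarrow> cmod (f z) \<le> indicator E z"
  shows "Lorentz_p1_norm p f \<le> ennreal (p * measure dA E powr (1 / p))"
proof -
  have "(\<integral>\<^sup>+t\<in>{0<..}. ennreal (distr_fun f t powr (1 / p)) \<partial>lborel) \<le> (\<integral>\<^sup>+(t::real). ennreal (measure dA E powr (1 / p)) * indicator {0<..<1} t \<partial>lborel)"
  proof (rule nn_integral_mono)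
    fix t :: real
    show "ennreal (distr_fun f t powr (1 / p)) * indicator {0<..} t \<le> ennreal (measure dA E powr (1 / p)) * indicator {0<..<1} t"
    proof (cases "0 < t")
      case t: True
      show ?thesis
      proof (cases "t < 1")
        case True
        have "{z \<in> disc. cmod (f z) > t} \<subseteq> E"
        proof
          fix z assume "z \<in> {z \<in> disc. cmod (f z) > t}"
          then show "z \<in> E" using f[of z] t by (cases "z \<in> E") auto
        qed
        then have "distr_fun f t \<le> measure dA E"
          unfolding distr_fun_def using E by (intro dA.finite_measure_mono)
        then have "distr_fun f t powr (1 / p) \<le> measure dA E powr (1 / p)"
          using p by (intro powr_mono2) (auto simp: distr_fun_def)
        then show ?thesis using t True by (simp add: ennreal_leI)
      next
        case False
        have "cmod (f z) \<le> 1" if "z \<in> disc" for z using f[OF that] by (rule order_trans) (simp add: indicator_def)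
        then have empty: "{z \<in> disc. cmod (f z) > t} = {}" using False by fastforce
        show ?thesis unfolding distr_fun_def empty by simp
      qed
    qed simp
  qed
  also have "\<dots> = ennreal (measure dA E powr (1 / p))"
    by (simp add: nn_integral_cmult_indicator)
  finally have "Lorentz_p1_norm p f \<le> ennreal p * ennreal (measure dA E powr (1 / p))"
    unfolding Lorentz_p1_norm_def by (rule mult_left_mono) simp
  then show ?thesis using p by (simp add: ennreal_mult)
qed

lemma cmod_op_apply_T_le:
  "cmod (op_apply (T_op a b c) f z) \<le> cmod (op_apply (S_op a b c) (\<lambda>z. of_real (cmod (f z))) z)"
proof -
  have k: "kernel (S_op a b c) z w * of_real (cmod (f w)) = of_real (cmod (kernel (T_op a b c) z w * f w))" for w
    by (simp add: kernel_S norm_mult)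
  have "cmod (\<integral>w. kernel (T_op a b c) z w * f w \<partial>dA) \<le> (\<integral>w. cmod (kernel (T_op a b c) z w * f w) \<partial>dA)"
    by (rule integral_norm_bound)
  also have "\<dots> = cmod (\<integral>w. kernel (S_op a b c) z w * of_real (cmod (f w)) \<partial>dA)"
    unfolding k integral_complex_of_real by (simp add: Bochner_Integration.integral_nonneg)
  finally show ?thesis by (simp add: op_apply_def norm_mult factor_eq mult_left_mono)
qed

section \<open>Unboundedness\<close>

lemma weak_L1_norm_mono:
  assumes [measurable]: "g \<in> borel_measurable dA" and le: "\<And>z. z \<in> disc \<Longrightarrow> cmod (f z) \<le> cmod (g z)"
  shows "weak_L1_norm f \<le> weak_L1_norm g"
proof (rule weak_L1_normI)
  fix t :: real assume t: "0 < t"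
  have "{z \<in> space dA. cmod (g z) > t} \<in> sets dA" by measurable
  then have "emeasure dA {z \<in> disc. cmod (f z) > t} \<le> emeasure dA {z \<in> disc. cmod (g z) > t}"
    by (intro emeasure_mono) (auto intro: less_le_trans[OF _ le])
  then have "ennreal t * emeasure dA {z \<in> disc. cmod (f z) > t} \<le> ennreal t * emeasure dA {z \<in> disc. cmod (g z) > t}"
    by (intro mult_left_mono) auto
  also have "\<dots> \<le> weak_L1_norm g" by (rule weak_L1_normD[OF t])
  finally show "ennreal t * emeasure dA {z \<in> disc. cmod (f z) > t} \<le> weak_L1_norm g" .
qed

lemma weak_L1_norm_T_le_S:
  assumes [measurable]: "f \<in> borel_measurable dA"
  shows "weak_L1_norm (op_apply (T_op a b c) f) \<le> weak_L1_norm (op_apply (S_op a b c) (\<lambda>z. of_real (cmod (f z))))"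
  by (intro weak_L1_norm_mono cmod_op_apply_T_le op_apply_measurable) (auto, measurable)

text \<open>S applied to |f| dominates |T f|, so for a norm that sees only |f| a lower bound for T
  rules out both operators at once. The constant in \<open>maps_boundedly\<close> carries no sign;
  \<open>max C 0\<close> repairs this.\<close>

lemma maps_boundedly_imp_T_bound:
  assumes Op: "Op = T_op a b c \<or> Op = S_op a b c" and bd: "maps_boundedly Op N weak_L1_norm"
    and N: "\<And>f. N (\<lambda>z. of_real (cmod (f z))) = N f"
  obtains C where "0 \<le> C" "\<And>f. f \<in> borel_measurable dA \<Longrightarrow> N f < \<infinity> \<Longrightarrow> weak_L1_norm (op_apply (T_op a b c) f) \<le> ennreal C * N f"
proof -
  obtain C where C: "\<And>f. f \<in> borel_measurable dA \<Longrightarrow> N f < \<infinity> \<Longrightarrow> weak_L1_norm (op_apply Op f) \<le> ennreal C * N f"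
    using bd unfolding maps_boundedly_def fun_space_def by blast
  have "weak_L1_norm (op_apply (T_op a b c) f) \<le> ennreal C * N f" if f: "f \<in> borel_measurable dA" "N f < \<infinity>" for f
    using Op
  proof
    assume "Op = T_op a b c"
    then show ?thesis using C[OF f] by simp
  next
    assume S: "Op = S_op a b c"
    have m: "(\<lambda>z. complex_of_real (cmod (f z))) \<in> borel_measurable dA" using f(1) by measurable
    have "weak_L1_norm (op_apply (T_op a b c) f) \<le> weak_L1_norm (op_apply Op (\<lambda>z. of_real (cmod (f z))))"
      unfolding S by (rule weak_L1_norm_T_le_S[OF f(1)])
    also have "\<dots> \<le> ennreal C * N f" using C[OF m] f(2) by (simp add: N)
    finally show ?thesis .
  qed
  moreover have "ennreal C \<le> ennreal (max C 0)" by (intro ennreal_leI) simp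
  ultimately show ?thesis
    by (intro that[of "max C 0"]) (auto intro: order_trans mult_right_mono)
qed

lemma Lp_norm_cmod: "Lp_norm p (\<lambda>z. of_real (cmod (f z))) = Lp_norm p f"
  by (simp add: Lp_norm_def)

lemma Lorentz_p1_norm_cmod: "Lorentz_p1_norm p (\<lambda>z. of_real (cmod (f z))) = Lorentz_p1_norm p f"
  by (simp add: Lorentz_p1_norm_def distr_fun_def)

lemma powr_growth_contradiction:
  fixes c0 C r s :: real
  assumes "0 < c0" "s < r" and le: "\<And>N. (0::nat) < N \<Longrightarrow> c0 * real N powr r \<le> C * real N powr s"
  shows False
proof -
  have lim: "((\<lambda>N. C * real N powr (s - r)) \<longlongrightarrow> C * 0) sequentially"
    using assms by (intro tendsto_mult tendsto_const tendsto_neg_powr filterlim_real_sequentially) auto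
  have "eventually (\<lambda>N. c0 \<le> C * real N powr (s - r)) sequentially"
    using eventually_gt_at_top[of 0]
  proof eventually_elim
    case (elim N)
    have "c0 * real N powr r * real N powr (- r) \<le> C * real N powr s * real N powr (- r)"
      using le[OF elim] by (intro mult_right_mono) auto
    then show ?case using elim by (simp add: mult.assoc flip: powr_add)
  qed
  with lim have "c0 \<le> C * 0" by (intro tendsto_lowerbound) auto
  with assms show False by simp
qed

lemma gap_decay_contradiction:
  assumes "0 < c0" "s < r" and le: "\<And>k. c0 * gap k powr s \<le> C * gap k powr r"
  shows False
proof -
  have "gap \<longlonglongrightarrow> 0"
    unfolding gap_def[abs_def] by (rule LIMSEQ_Suc) (use LIMSEQ_realpow_zero[of "1/4"] in \<open>simp add: power_one_over\<close>)
  then have "(\<lambda>k. gap k powr (r - s)) \<longlonglongrightarrow> 0 powr (r - s)"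
    using assms by (intro tendsto_powr') auto
  then have lim: "(\<lambda>k. C * gap k powr (r - s)) \<longlonglongrightarrow> C * 0"
    using assms by (intro tendsto_mult tendsto_const) auto
  have "c0 \<le> C * gap k powr (r - s)" for k
  proof -
    have "c0 * gap k powr s * gap k powr (- s) \<le> C * gap k powr r * gap k powr (- s)"
      using le[of k] by (intro mult_right_mono) auto
    then show ?thesis by (simp add: mult.assoc flip: powr_add)
  qed
  with lim have "c0 \<le> C * 0" by (intro LIMSEQ_le_const) auto
  with assms show False by simp
qed

text \<open>One block suffices: its source norm is at most of order
  \<open>gap k powr (1 / p)\<close>, its image at least of order \<open>gap k powr \<sigma>\<close>,
  and \<sigma> < 1/p while the gaps tend to 0.\<close>

lemma not_maps_boundedly_Lorentz:
  assumes c: "0 < c" and Op: "Op = T_op (-1) b c \<or> Op = S_op (-1) b c"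
    and p: "1 \<le> p" "2 - c + b < 1 / p"
  shows "\<not> maps_boundedly Op (Lorentz_p1_norm p) weak_L1_norm"
proof
  assume "maps_boundedly Op (Lorentz_p1_norm p) weak_L1_norm"
  then obtain C where C: "0 \<le> C" "\<And>f. f \<in> borel_measurable dA \<Longrightarrow> Lorentz_p1_norm p f < \<infinity> \<Longrightarrow>
      weak_L1_norm (op_apply (T_op (-1) b c) f) \<le> ennreal C * Lorentz_p1_norm p f"
    using maps_boundedly_imp_T_bound[OF Op] Lorentz_p1_norm_cmod by blast
  obtain c0 where c0: "0 < c0" "\<And>k. c0 * gap k powr (2 - c + b) \<le> block_coeff b c k"
    using block_coeff_lower[OF c] by blast
  have "c0 * gap k powr (2 - c + b) \<le> (C * p) * gap k powr (1 / p)" for k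
  proof -
    have L: "Lorentz_p1_norm p (block k) \<le> ennreal (p * measure dA (annulus k) powr (1 / p))"
      using p by (intro Lorentz_p1_norm_le annulus_sets) (auto simp: cmod_block)
    also have "\<dots> \<le> ennreal (p * gap k powr (1 / p))"
    proof -
      have "measure dA (annulus k) \<le> gap k" by (simp add: measure_annulus less_imp_le)
      then show ?thesis using p by (intro ennreal_leI mult_left_mono powr_mono2) auto
    qed
    finally have L: "Lorentz_p1_norm p (block k) \<le> ennreal (p * gap k powr (1 / p))" .
    have "ennreal (block_coeff b c k) \<le> weak_L1_norm (op_apply (T_op (-1) b c) (block k))"
      by (rule weak_L1_norm_T_block_ge[OF c])
    also have "\<dots> \<le> ennreal C * Lorentz_p1_norm p (block k)"
      by (rule C(2)) (measurable, rule le_less_trans[OF L], simp)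
    also have "\<dots> \<le> ennreal C * ennreal (p * gap k powr (1 / p))"
      by (rule mult_left_mono[OF L]) simp
    also have "\<dots> = ennreal ((C * p) * gap k powr (1 / p))"
      using C(1) p by (simp add: mult.assoc flip: ennreal_mult)
    finally have "block_coeff b c k \<le> (C * p) * gap k powr (1 / p)"
      using C(1) p by (subst (asm) ennreal_le_iff) auto
    with c0(2)[of k] show ?thesis by linarith
  qed
  then show False by (rule gap_decay_contradiction[OF c0(1) p(2)])
qed

text \<open>With the normalised coefficients every term of the image has size at least c0, so the
  Riesz product bound gives order N / sqrt N = N^(1/2), against a source norm of at most N^\<sigma>
  with \<sigma> < 1/2.\<close>

lemma not_maps_boundedly_Lp_endpoint:
  assumes c: "0 < c" and Op: "Op = T_op (-1) b c \<or> Op = S_op (-1) b c"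
    and \<sigma>: "0 < 2 - c + b" "2 - c + b < 1 / 2"
  shows "\<not> maps_boundedly Op (Lp_norm (ereal (1 / (2 - c + b)))) weak_L1_norm"
proof
  define p where "p = 1 / (2 - c + b)"
  have p: "0 < p" "1 / p = 2 - c + b" using \<sigma> by (auto simp: p_def)
  assume "maps_boundedly Op (Lp_norm (ereal (1 / (2 - c + b)))) weak_L1_norm"
  then obtain C where C: "0 \<le> C" "\<And>f. f \<in> borel_measurable dA \<Longrightarrow> Lp_norm (ereal p) f < \<infinity> \<Longrightarrow>
      weak_L1_norm (op_apply (T_op (-1) b c) f) \<le> ennreal C * Lp_norm (ereal p) f"
    unfolding p_def[symmetric] using maps_boundedly_imp_T_bound[OF Op] Lp_norm_cmod by blast
  obtain c0 where c0: "0 < c0" "\<And>k. c0 * gap k powr (2 - c + b) \<le> block_coeff b c k"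
    using block_coeff_lower[OF c] by blast
  define a where "a k = gap k powr (- (1 / p))" for k
  have "c0 / 4 * real N powr (1 / 2) \<le> C * real N powr (1 / p)" if N: "0 < N" for N
  proof -
    have L: "Lp_norm (ereal p) (lacunary a N) \<le> ennreal (N powr (1 / p))"
      unfolding a_def[abs_def] by (rule Lp_norm_lacunary_le[OF p(1)])
    have "c0 \<le> a k * block_coeff b c k" for k
    proof -
      have "c0 = a k * (c0 * gap k powr (2 - c + b))"
        by (simp add: a_def p mult.left_commute[of _ c0] flip: powr_add)
      also have "\<dots> \<le> a k * block_coeff b c k" using c0(2) by (intro mult_left_mono) (auto simp: a_def)
      finally show ?thesis .
    qed
    then have "(\<Sum>k<N. c0) \<le> (\<Sum>k<N. a k * block_coeff b c k)" by (intro sum_mono)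
    then have "N * c0 / (4 * sqrt N) \<le> (\<Sum>k<N. a k * block_coeff b c k) / (4 * sqrt N)"
      by (intro divide_right_mono) auto
    moreover have "N * c0 / (4 * sqrt N) = c0 / 4 * real N powr (1 / 2)"
      using N by (simp add: powr_half_sqrt real_div_sqrt field_simps)
    ultimately have "ennreal (c0 / 4 * real N powr (1 / 2)) \<le> ennreal ((\<Sum>k<N. a k * block_coeff b c k) / (4 * sqrt N))"
      by (intro ennreal_leI) simp
    also have "\<dots> \<le> weak_L1_norm (op_apply (T_op (-1) b c) (lacunary a N))"
      by (rule weak_L1_norm_T_lacunary_ge[OF c N]) (simp add: a_def)
    also have "\<dots> \<le> ennreal C * Lp_norm (ereal p) (lacunary a N)"
      by (rule C(2)) (measurable, rule le_less_trans[OF L], simp)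
    also have "\<dots> \<le> ennreal C * ennreal (N powr (1 / p))"
      by (rule mult_left_mono[OF L]) simp
    also have "\<dots> = ennreal (C * N powr (1 / p))"
      using C(1) by (simp flip: ennreal_mult)
    finally show ?thesis using C(1) by (subst (asm) ennreal_le_iff) auto
  qed
  then show False
    using c0(1) \<sigma>(2) p by (intro powr_growth_contradiction[of "c0 / 4" "1 / p" "1 / 2" C]) auto
qed

text \<open>On the ring \<open>wt z \<le> s\<close> with s = 1 / (2 m), Bernoulli's inequality gives
  |z|^m \<ge> 1/2, so |f| \<ge> R / (2 s) there. Half of this value is taken as the level t, to have
  a strict inequality, and t s = R / 4.\<close>

lemma weak_L1_norm_ge_power:
  assumes [measurable]: "f \<in> borel_measurable dA" and R: "0 < R" and m: "0 < m"
    and ge: "\<And>z. z \<in> disc \<Longrightarrow> R * cmod z ^ m \<le> wt z * cmod (f z)"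
  shows "ennreal (R / 4) \<le> weak_L1_norm f"
proof -
  define s where "s = 1 / (2 * real m)"
  have s: "0 < s" "s \<le> 1" using m by (auto simp: s_def field_simps)
  define t where "t = R / (4 * s)"
  have t: "0 < t" "t * s = R / 4" using R s by (auto simp: t_def)
  have em: "emeasure dA {z \<in> disc. wt z \<le> s} = ennreal s"
    using s by (intro emeasure_dA_wt_le) auto
  have "ennreal (R / 4) = ennreal t * emeasure dA {z \<in> disc. wt z \<le> s}"
    unfolding em t(2)[symmetric] using s t(1) by (intro ennreal_mult) auto
  also have "\<dots> \<le> ennreal t * emeasure dA {z \<in> disc. cmod (f z) > t}"
  proof (intro mult_left_mono emeasure_mono)
    have "{z \<in> space dA. cmod (f z) > t} \<in> sets dA" by measurable
    then show "{z \<in> disc. cmod (f z) > t} \<in> sets dA" by simp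
    show "{z \<in> disc. wt z \<le> s} \<subseteq> {z \<in> disc. cmod (f z) > t}"
    proof clarify
      fix z assume z: "z \<in> disc" "wt z \<le> s"
      have w: "0 < wt z" by (rule wt_pos[OF z(1)])
      have "1 / 2 = 1 + real m * (- s)" using m by (simp add: s_def)
      also have "\<dots> \<le> (1 + (- s)) ^ m" using s by (intro Bernoulli_inequality) auto
      also have "\<dots> \<le> ((cmod z)\<^sup>2) ^ m" using z s by (intro power_mono) (auto simp: wt_def)
      also have "\<dots> = cmod z ^ m * cmod z ^ m" by (simp add: power2_eq_square power_mult_distrib)
      also have "\<dots> \<le> cmod z ^ m * 1" using z by (intro mult_left_mono power_le_one) auto
      finally have "R * (1 / 2) \<le> R * cmod z ^ m" using R by (intro mult_left_mono) auto
      also have "\<dots> \<le> wt z * cmod (f z)" by (rule ge[OF z(1)])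
      also have "\<dots> \<le> s * cmod (f z)" using z by (intro mult_right_mono) auto
      finally have "R / 2 \<le> s * cmod (f z)" by simp
      then have "2 * t * s \<le> cmod (f z) * s" using t by (simp add: mult.commute)
      then have "2 * t \<le> cmod (f z)" using s by simp
      then show "t < cmod (f z)" using t by linarith
    qed
  qed simp
  also have "\<dots> \<le> weak_L1_norm f" by (rule weak_L1_normD[OF t(1)])
  finally show ?thesis .
qed

text \<open>The positive kernel loses no mass to phases: its integral over each annulus is at least
  the modulus of what T does to the block, and these lower bounds add up. The exponent
  \<open>freq N\<close> bounds all the powers |z|^freq k from below simultaneously.\<close>

lemma weak_L1_norm_S_lacunary_ge:
  assumes c: "0 < c" and N: "0 < N" and a: "\<And>k. 0 < a k"
  shows "ennreal ((\<Sum>k<N. a k * block_coeff b c k) / 4) \<le> weak_L1_norm (op_apply (S_op (-1) b c) (\<lambda>w. of_real (cmod (lacunary a N w))))"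
proof (rule weak_L1_norm_ge_power[where m = "freq N"])
  define K where "K z w = cmod (kernel (T_op (-1) b c) z w)" for z w
  show "op_apply (S_op (-1) b c) (\<lambda>w. of_real (cmod (lacunary a N w))) \<in> borel_measurable dA"
    by (rule op_apply_measurable) (auto, measurable)
  show "0 < (\<Sum>k<N. a k * block_coeff b c k)"
    using N a block_coeff_pos[OF c, of b] by (intro sum_pos) auto
  show "0 < freq N" by simp
  fix z assume z: "z \<in> disc"
  have w: "0 < wt z" by (rule wt_pos[OF z])
  have z1: "cmod z \<le> 1" using z by auto
  have bi: "integrable dA (\<lambda>w. K z w * indicator (annulus k) w)" for k
    using integrable_norm[OF kernel_T_block(1)[OF c z1, of "-1" b k]]
    by (simp add: norm_mult cmod_block K_def)
  have "(\<Sum>k<N. a k * block_coeff b c k) * cmod z ^ freq N = (\<Sum>k<N. a k * (block_coeff b c k * cmod z ^ freq N))"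
    by (simp add: sum_distrib_right mult.assoc)
  also have "\<dots> \<le> (\<Sum>k<N. a k * (\<integral>w. K z w * indicator (annulus k) w \<partial>dA))"
  proof (intro sum_mono mult_left_mono)
    fix k assume "k \<in> {..<N}"
    then have kN: "freq k \<le> freq N" by (intro power_increasing) auto
    have "block_coeff b c k * cmod z ^ freq N \<le> block_coeff b c k * cmod z ^ freq k"
      using less_imp_le[OF block_coeff_pos[OF c, of b k]] z1 by (intro mult_left_mono power_decreasing[OF kN]) auto
    also have "\<dots> = cmod (\<integral>w. kernel (T_op (-1) b c) z w * block k w \<partial>dA)"
      using block_coeff_pos[OF c, of b k] by (simp add: kernel_T_block(2)[OF c z1] norm_mult norm_power del: power_Suc)
    also have "\<dots> \<le> (\<integral>w. cmod (kernel (T_op (-1) b c) z w * block k w) \<partial>dA)"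
      by (rule integral_norm_bound)
    also have "\<dots> = (\<integral>w. K z w * indicator (annulus k) w \<partial>dA)"
      by (simp add: norm_mult cmod_block K_def)
    finally show "block_coeff b c k * cmod z ^ freq N \<le> (\<integral>w. K z w * indicator (annulus k) w \<partial>dA)" .
  qed (use a in \<open>auto simp: less_imp_le\<close>)
  also have "\<dots> = (\<integral>w. (\<Sum>k<N. a k * (K z w * indicator (annulus k) w)) \<partial>dA)"
    using bi by (simp add: Bochner_Integration.integral_sum)
  also have "\<dots> = (\<integral>w. K z w * cmod (lacunary a N w) \<partial>dA)"
    unfolding cmod_lacunary[of a, OF less_imp_le[OF a]] sum_distrib_left
    by (intro Bochner_Integration.integral_cong sum.cong refl) (simp only: mult_ac)
  also have "\<dots> = cmod (\<integral>w. kernel (S_op (-1) b c) z w * of_real (cmod (lacunary a N w)) \<partial>dA)"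
  proof -
    have "kernel (S_op (-1) b c) z w * of_real (cmod (lacunary a N w)) = of_real (K z w * cmod (lacunary a N w))" for w
      by (simp add: kernel_S K_def)
    then show ?thesis by (simp only: integral_complex_of_real norm_of_real)
       (simp add: K_def Bochner_Integration.integral_nonneg)
  qed
  also have "\<dots> = wt z * cmod (op_apply (S_op (-1) b c) (\<lambda>w. of_real (cmod (lacunary a N w))) z)"
    using w by (simp add: op_apply_def factor_eq norm_mult norm_inverse powr_minus)
  finally show "(\<Sum>k<N. a k * block_coeff b c k) * cmod z ^ freq N \<le> wt z * cmod (op_apply (S_op (-1) b c) (\<lambda>w. of_real (cmod (lacunary a N w))) z)" .
qed

text \<open>For the moduli of the normalised lacunary sums the image is of order at least N, against
  a source norm of at most N^\<sigma> with \<sigma> < 1.\<close>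

lemma not_maps_boundedly_S_endpoint:
  assumes c: "0 < c" and \<sigma>: "0 < 2 - c + b" "2 - c + b < 1"
  shows "\<not> maps_boundedly (S_op (-1) b c) (Lp_norm (ereal (1 / (2 - c + b)))) weak_L1_norm"
proof
  define p where "p = 1 / (2 - c + b)"
  have p: "0 < p" "1 / p = 2 - c + b" using \<sigma> by (auto simp: p_def)
  assume "maps_boundedly (S_op (-1) b c) (Lp_norm (ereal (1 / (2 - c + b)))) weak_L1_norm"
  then obtain C' where C': "\<And>f. f \<in> borel_measurable dA \<Longrightarrow> Lp_norm (ereal p) f < \<infinity> \<Longrightarrow>
      weak_L1_norm (op_apply (S_op (-1) b c) f) \<le> ennreal C' * Lp_norm (ereal p) f"
    unfolding p_def[symmetric] maps_boundedly_def fun_space_def by blast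
  define C where "C = max C' 0"
  have C: "0 \<le> C" by (simp add: C_def)
  obtain c0 where c0: "0 < c0" "\<And>k. c0 * gap k powr (2 - c + b) \<le> block_coeff b c k"
    using block_coeff_lower[OF c] by blast
  define a where "a k = gap k powr (- (1 / p))" for k
  have "c0 / 4 * real N powr 1 \<le> C * real N powr (1 / p)" if N: "0 < N" for N
  proof -
    have L: "Lp_norm (ereal p) (\<lambda>w. of_real (cmod (lacunary a N w))) \<le> ennreal (N powr (1 / p))"
      unfolding a_def[abs_def] Lp_norm_cmod by (rule Lp_norm_lacunary_le[OF p(1)])
    have "c0 \<le> a k * block_coeff b c k" for k
    proof -
      have "c0 = a k * (c0 * gap k powr (2 - c + b))"
        by (simp add: a_def p mult.left_commute[of _ c0] flip: powr_add)
      also have "\<dots> \<le> a k * block_coeff b c k" using c0(2) by (intro mult_left_mono) (auto simp: a_def)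
      finally show ?thesis .
    qed
    then have "(\<Sum>k<N. c0) \<le> (\<Sum>k<N. a k * block_coeff b c k)" by (intro sum_mono)
    then have "ennreal (c0 / 4 * real N powr 1) \<le> ennreal ((\<Sum>k<N. a k * block_coeff b c k) / 4)"
      by (intro ennreal_leI) (simp add: mult.commute)
    also have "\<dots> \<le> weak_L1_norm (op_apply (S_op (-1) b c) (\<lambda>w. of_real (cmod (lacunary a N w))))"
      by (rule weak_L1_norm_S_lacunary_ge[OF c N]) (simp add: a_def)
    also have "\<dots> \<le> ennreal C' * Lp_norm (ereal p) (\<lambda>w. of_real (cmod (lacunary a N w)))"
      by (rule C') (measurable, rule le_less_trans[OF L], simp)
    also have "\<dots> \<le> ennreal C * ennreal (N powr (1 / p))"
      by (rule mult_mono[OF _ L]) (auto simp: C_def ennreal_leI)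
    also have "\<dots> = ennreal (C * N powr (1 / p))"
      using C by (simp flip: ennreal_mult)
    finally show ?thesis using C by (subst (asm) ennreal_le_iff) auto
  qed
  then show False
    using c0(1) \<sigma>(2) p by (intro powr_growth_contradiction[of "c0 / 4" "1 / p" 1 C]) auto
qed

section \<open>The critical case \<open>2 - c + b = 0\<close> and the passage to indicators\<close>

lemma kernel_T_bound:
  assumes c: "0 \<le> c" and s: "0 < s" "s \<le> wt w" and w: "w \<in> disc" and u: "cmod u \<le> 1"
  shows "cmod (kernel (T_op a b c) u w) \<le> max 1 (s powr b) * (s / 2) powr (- c)"
proof -
  have w1: "cmod w < 1" using w by auto
  have "wt w = (1 - cmod w) * (1 + cmod w)" by (simp add: wt_def power2_eq_square algebra_simps)
  also have "\<dots> \<le> (1 - cmod w) * 2" using w1 by (intro mult_left_mono) auto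
  finally have "s / 2 \<le> 1 - cmod w" using s by simp
  also have "\<dots> \<le> 1 - cmod (u * cnj w)"
    using mult_right_mono[OF u, of "cmod w"] by (simp add: norm_mult)
  also have "\<dots> \<le> cmod (1 - u * cnj w)"
    using norm_triangle_ineq2[of 1 "u * cnj w"] by simp
  finally have "cmod (1 - u * cnj w) powr (- c) \<le> (s / 2) powr (- c)"
    using c s by (intro powr_mono2') auto
  then show ?thesis
    using wt_powr_le[OF s, of b] by (simp add: kernel_norm[of _ a b c] mult_mono)
qed

text \<open>Duality: with \<open>h\<close> the conjugate sign of \<open>P\<^sub>f\<close>, the mean of \<open>\<bar>P\<^sub>f\<bar>\<close> over the circle is \<open>\<integral> f \<Phi>\<close>, and the integral
  of \<open>\<bar>\<Phi>\<bar>\<close> is tested on the four sets where \<open>Re \<Phi>\<close> or \<open>Im \<Phi>\<close> has constant sign.\<close>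

lemma circle_L1_le_indicators:
  fixes f :: "complex \<Rightarrow> complex" and b c :: real
  assumes c: "0 < c" and f[measurable]: "f \<in> borel_measurable borel" and f1: "\<And>w. cmod (f w) \<le> 1"
    and s: "0 < s" "\<And>w. w \<in> disc \<Longrightarrow> f w \<noteq> 0 \<Longrightarrow> s \<le> wt w"
    and C: "0 \<le> C" "\<And>E. E \<in> sets dA \<Longrightarrow> weak_L1_norm (op_apply (T_op (-1) b c) (indicator E)) \<le> ennreal C"
  shows "(\<integral>v. cmod (\<integral>w. kernel (T_op (-1) b c) (sgn v) w * f w \<partial>dA) \<partial>dA) \<le> 4 * C"
proof -
  interpret P: pair_prob_space dA dA ..
  define K where "K = kernel (T_op (-1) b c)"
  define Pf where "Pf g u = (\<integral>w. K u w * g w \<partial>dA)" for g u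
  define h where "h u = cnj (sgn (Pf f u))" for u
  define \<Phi> where "\<Phi> w = (\<integral>v. h (sgn v) * K (sgn v) w \<partial>dA)" for w
  \<comment> \<open>A bound for the kernel on the circle times {w. s \<le> wt w}; it makes all
    integrands below bounded on a probability space, as Fubini's theorem requires.\<close>
  define B where "B = max 1 (s powr b) * (s / 2) powr (- c)"
  have KB: "cmod (K (sgn v) w) \<le> B" if "w \<in> disc" "s \<le> wt w" for v w
    unfolding K_def B_def using c s that by (intro kernel_T_bound) (auto simp: norm_sgn)
  have B: "0 \<le> B" by (simp add: B_def)
  have Km[measurable (raw)]: "(\<lambda>x. K (f x) (g x)) \<in> borel_measurable M"
    if "f \<in> borel_measurable M" "g \<in> borel_measurable M" for f g and M :: "'z measure"
    unfolding K_def using that by measurable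
  have [measurable]: "Pf f \<in> borel_measurable borel"
    unfolding Pf_def[abs_def] by (rule dA.borel_measurable_lebesgue_integral) (simp add: case_prod_beta, measurable)
  have h[measurable]: "h \<in> borel_measurable borel" unfolding h_def[abs_def] by measurable
  have h1: "cmod (h u) \<le> 1" for u by (simp add: h_def norm_sgn)
  have \<Phi>m[measurable]: "\<Phi> \<in> borel_measurable borel"
    unfolding \<Phi>_def[abs_def] by (rule dA.borel_measurable_lebesgue_integral) (simp add: case_prod_beta, measurable)
  have hK: "cmod (h (sgn v) * K (sgn v) w) \<le> B" if "w \<in> disc" "s \<le> wt w" for v w
    using mult_mono[OF h1[of "sgn v"] KB[OF that, of v]] B by (simp add: norm_mult)
  have duality: "(\<integral>v. h (sgn v) * Pf g (sgn v) \<partial>dA) = (\<integral>w. g w * \<Phi> w \<partial>dA)"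
    if g[measurable]: "g \<in> borel_measurable borel" and g1: "\<And>w. cmod (g w) \<le> 1" and gs: "\<And>w. w \<in> disc \<Longrightarrow> g w \<noteq> 0 \<Longrightarrow> s \<le> wt w" for g
  proof -
    have int: "integrable (dA \<Otimes>\<^sub>M dA) (\<lambda>(v, w). h (sgn v) * K (sgn v) w * g w)"
    proof (rule P.integrable_const_bound[of _ B])
      show "AE x in dA \<Otimes>\<^sub>M dA. norm (case x of (v, w) \<Rightarrow> h (sgn v) * K (sgn v) w * g w) \<le> B"
      proof (rule AE_I2, clarify)
        fix v w assume "(v, w) \<in> space (dA \<Otimes>\<^sub>M dA)"
        then have w: "w \<in> disc" by (simp add: space_pair_measure)
        show "norm (h (sgn v) * K (sgn v) w * g w) \<le> B"
        proof (cases "g w = 0")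
          case False
          then show ?thesis
            using mult_mono[OF hK[OF w gs[OF w False], of v] g1[of w]] B by (simp add: norm_mult)
        qed (simp add: B)
      qed
    qed (simp add: case_prod_beta, measurable)
    have "(\<integral>v. h (sgn v) * Pf g (sgn v) \<partial>dA) = (\<integral>v. (\<integral>w. h (sgn v) * K (sgn v) w * g w \<partial>dA) \<partial>dA)"
      by (simp add: Pf_def mult.assoc)
    also have "\<dots> = (\<integral>w. (\<integral>v. h (sgn v) * K (sgn v) w * g w \<partial>dA) \<partial>dA)"
      by (rule P.Fubini_integral[OF int, symmetric])
    also have "\<dots> = (\<integral>w. g w * \<Phi> w \<partial>dA)"
      by (simp add: \<Phi>_def mult.commute[of "g _"])
    finally show ?thesis .
  qed
  define R where "R = {w \<in> disc. s \<le> wt w}"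
  have \<Phi>B: "cmod (\<Phi> w) \<le> B" if "w \<in> R" for w
  proof -
    have w: "w \<in> disc" "s \<le> wt w" using that by (auto simp: R_def)
    have i: "integrable dA (\<lambda>v. h (sgn v) * K (sgn v) w)"
      by (rule integrable_dA_bounded[of _ B]) (use hK[OF w] in auto)
    have "cmod (\<Phi> w) \<le> (\<integral>v. cmod (h (sgn v) * K (sgn v) w) \<partial>dA)"
      unfolding \<Phi>_def by (rule integral_norm_bound)
    also have "\<dots> \<le> (\<integral>v. B \<partial>dA)"
      using i hK[OF w] by (intro integral_mono) auto
    also have "\<dots> = B" using dA.prob_space by simp
    finally show ?thesis .
  qed
  \<comment> \<open>An indicator supported in R is itself an admissible test function, so its weak
    norm dominates its circle mean. As |h| \<le> 1, the hypothesis on indicators becomes a bound for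
    the integral of \<Phi> over any Borel subset of R.\<close>
  have set_bound: "cmod (\<integral>w. indicator E w * \<Phi> w \<partial>dA) \<le> C" if E: "E \<in> sets borel" "E \<subseteq> R" for E
  proof -
    let ?g = "indicator E :: complex \<Rightarrow> complex"
    have gm: "?g \<in> borel_measurable borel" using E by measurable
    then have gm': "?g \<in> borel_measurable dA" by measurable
    have g1: "cmod (?g w) \<le> 1" for w by (simp add: indicator_def)
    have gs: "s \<le> wt w" if "w \<in> disc" "?g w \<noteq> 0" for w using that E by (auto simp: R_def indicator_def split: if_splits)
    have Es: "E \<in> sets dA"
    proof -
      have "{w \<in> disc. w \<in> E} = E" using E by (auto simp: R_def)
      then show ?thesis using disc_sets_dA[of "\<lambda>w. w \<in> E"] E by simp
    qed
    note W = weak_L1_norm_T_ge_circle[OF c gm' g1 s(1) gs, of b, folded K_def, folded Pf_def]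
    have "ennreal (\<integral>v. cmod (Pf ?g (sgn v)) \<partial>dA) \<le> ennreal C"
      using W(1) C(2)[OF Es] by (rule order_trans)
    then have le: "(\<integral>v. cmod (Pf ?g (sgn v)) \<partial>dA) \<le> C" using C(1) by simp
    have [measurable]: "Pf ?g \<in> borel_measurable borel"
      unfolding Pf_def[abs_def] using gm by (intro dA.borel_measurable_lebesgue_integral) (simp add: case_prod_beta, measurable)
    have "cmod (\<integral>w. indicator E w * \<Phi> w \<partial>dA) = cmod (\<integral>v. h (sgn v) * Pf ?g (sgn v) \<partial>dA)"
      using duality[OF gm g1 gs] by simp
    also have "\<dots> \<le> (\<integral>v. cmod (h (sgn v) * Pf ?g (sgn v)) \<partial>dA)" by (rule integral_norm_bound)
    also have "\<dots> \<le> (\<integral>v. cmod (Pf ?g (sgn v)) \<partial>dA)"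
    proof (rule integral_mono)
      show le': "cmod (h (sgn v) * Pf ?g (sgn v)) \<le> cmod (Pf ?g (sgn v))" for v
        using mult_right_mono[OF h1[of "sgn v"], of "cmod (Pf ?g (sgn v))"] by (simp add: norm_mult)
      show "integrable dA (\<lambda>v. cmod (h (sgn v) * Pf ?g (sgn v)))"
        by (rule Bochner_Integration.integrable_bound[OF W(2)]) (use le' in auto)
    qed (rule W(2))
    finally show ?thesis using le by linarith
  qed
  have Rm[measurable]: "R \<in> sets borel" unfolding R_def by measurable
  have part: "(\<integral>w. indicator R w * \<bar>\<rho> (\<Phi> w)\<bar> \<partial>dA) \<le> 2 * C" if \<rho>: "\<rho> = Re \<or> \<rho> = Im" for \<rho>
  proof -
    have \<rho>m[measurable]: "(\<lambda>w. \<rho> (\<Phi> w)) \<in> borel_measurable borel" using \<rho> by auto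
    have \<rho>le: "\<bar>\<rho> z\<bar> \<le> cmod z" for z using \<rho> abs_Re_le_cmod abs_Im_le_cmod by auto
    define E1 where "E1 = {w \<in> R. 0 < \<rho> (\<Phi> w)}"
    define E2 where "E2 = {w \<in> R. \<rho> (\<Phi> w) < 0}"
    have m[measurable]: "E1 \<in> sets borel" "E2 \<in> sets borel" unfolding E1_def E2_def by measurable
    have i: "integrable dA (\<lambda>w. indicator E w * \<Phi> w)" if [measurable]: "E \<in> sets borel" and "E \<subseteq> R" for E
      by (rule integrable_dA_bounded[of _ B]) (measurable, use \<Phi>B that B in \<open>auto simp: norm_mult indicator_def\<close>)
    have pull: "\<rho> (\<integral>w. indicator E w * \<Phi> w \<partial>dA) = (\<integral>w. indicator E w * \<rho> (\<Phi> w) \<partial>dA)"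
      "integrable dA (\<lambda>w. indicator E w * \<rho> (\<Phi> w))" if E: "E \<in> sets borel" "E \<subseteq> R" for E
    proof -
      have eq: "\<rho> (indicator E w * \<Phi> w) = indicator E w * \<rho> (\<Phi> w)" for w
        using \<rho> by (auto simp: indicator_def)
      have bl: "bounded_linear \<rho>" using \<rho> bounded_linear_Re bounded_linear_Im by auto
      show "\<rho> (\<integral>w. indicator E w * \<Phi> w \<partial>dA) = (\<integral>w. indicator E w * \<rho> (\<Phi> w) \<partial>dA)"
        unfolding eq[symmetric] by (rule integral_bounded_linear[OF bl i[OF E], symmetric])
      show "integrable dA (\<lambda>w. indicator E w * \<rho> (\<Phi> w))"
        unfolding eq[symmetric] by (rule integrable_bounded_linear[OF bl i[OF E]])
    qed
    have E: "E1 \<subseteq> R" "E2 \<subseteq> R" by (auto simp: E1_def E2_def)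
    have "(\<integral>w. indicator R w * \<bar>\<rho> (\<Phi> w)\<bar> \<partial>dA) = (\<integral>w. indicator E1 w * \<rho> (\<Phi> w) - indicator E2 w * \<rho> (\<Phi> w) \<partial>dA)"
      by (intro Bochner_Integration.integral_cong refl) (auto simp: E1_def E2_def indicator_def)
    also have "\<dots> = \<rho> (\<integral>w. indicator E1 w * \<Phi> w \<partial>dA) - \<rho> (\<integral>w. indicator E2 w * \<Phi> w \<partial>dA)"
      using pull[OF m(1) E(1)] pull[OF m(2) E(2)] by simp
    also have "\<dots> \<le> C + C"
      using set_bound[OF m(1) E(1)] set_bound[OF m(2) E(2)]
        \<rho>le[of "\<integral>w. indicator E1 w * \<Phi> w \<partial>dA"] \<rho>le[of "\<integral>w. indicator E2 w * \<Phi> w \<partial>dA"] by linarith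
    finally show ?thesis by simp
  qed
  have "complex_of_real (\<integral>v. cmod (Pf f (sgn v)) \<partial>dA) = (\<integral>v. h (sgn v) * Pf f (sgn v) \<partial>dA)"
  proof -
    have "cnj (sgn x) * x = of_real (cmod x)" for x :: complex
    proof (cases "x = 0")
      case False
      then show ?thesis using complex_norm_square[of x]
        by (simp add: sgn_div_norm scaleR_conv_of_real power2_eq_square field_simps)
    qed simp
    then show ?thesis unfolding integral_complex_of_real[symmetric] h_def by simp
  qed
  also have "\<dots> = (\<integral>w. f w * \<Phi> w \<partial>dA)" by (rule duality[OF f f1 s(2)])
  finally have "\<bar>\<integral>v. cmod (Pf f (sgn v)) \<partial>dA\<bar> = cmod (\<integral>w. f w * \<Phi> w \<partial>dA)"
    by (metis norm_of_real)
  then have "(\<integral>v. cmod (Pf f (sgn v)) \<partial>dA) \<le> cmod (\<integral>w. f w * \<Phi> w \<partial>dA)" by linarith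
  also have "\<dots> \<le> (\<integral>w. cmod (f w * \<Phi> w) \<partial>dA)" by (rule integral_norm_bound)
  also have "\<dots> \<le> (\<integral>w. indicator R w * \<bar>Re (\<Phi> w)\<bar> + indicator R w * \<bar>Im (\<Phi> w)\<bar> \<partial>dA)"
  proof (rule integral_mono)
    have le: "cmod (f w * \<Phi> w) \<le> indicator R w * \<bar>Re (\<Phi> w)\<bar> + indicator R w * \<bar>Im (\<Phi> w)\<bar>" if w: "w \<in> disc" for w
    proof (cases "f w = 0")
      case False
      then have "w \<in> R" using s(2)[OF w] w by (simp add: R_def)
      moreover have "cmod (f w * \<Phi> w) \<le> cmod (\<Phi> w)"
        using mult_right_mono[OF f1[of w], of "cmod (\<Phi> w)"] by (simp add: norm_mult)
      ultimately show ?thesis using cmod_le[of "\<Phi> w"] by simp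
    qed (simp add: indicator_def)
    then show "cmod (f w * \<Phi> w) \<le> indicator R w * \<bar>Re (\<Phi> w)\<bar> + indicator R w * \<bar>Im (\<Phi> w)\<bar>" if "w \<in> space dA" for w
      using that by simp
    show i2: "integrable dA (\<lambda>w. indicator R w * \<bar>Re (\<Phi> w)\<bar> + indicator R w * \<bar>Im (\<Phi> w)\<bar>)"
    proof (rule integrable_dA_bounded[of _ "B + B"])
      fix w :: complex
      show "norm (indicator R w * \<bar>Re (\<Phi> w)\<bar> + indicator R w * \<bar>Im (\<Phi> w)\<bar>) \<le> B + B"
        using \<Phi>B[of w] abs_Re_le_cmod[of "\<Phi> w"] abs_Im_le_cmod[of "\<Phi> w"] B by (auto simp: indicator_def)
    qed measurable
    show "integrable dA (\<lambda>w. cmod (f w * \<Phi> w))"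
      by (rule Bochner_Integration.integrable_bound[OF i2])
         (measurable, rule AE_I2, metis le real_norm_def abs_ge_self order_trans space_dA abs_norm_cancel)
  qed
  also have "\<dots> = (\<integral>w. indicator R w * \<bar>Re (\<Phi> w)\<bar> \<partial>dA) + (\<integral>w. indicator R w * \<bar>Im (\<Phi> w)\<bar> \<partial>dA)"
  proof (rule Bochner_Integration.integral_add)
    show "integrable dA (\<lambda>w. indicator R w * \<bar>Re (\<Phi> w)\<bar>)" "integrable dA (\<lambda>w. indicator R w * \<bar>Im (\<Phi> w)\<bar>)"
      by (rule integrable_dA_bounded[of _ B], measurable,
          use \<Phi>B abs_Re_le_cmod abs_Im_le_cmod B in \<open>auto simp: indicator_def intro: order_trans\<close>)+
  qed
  also have "\<dots> \<le> 2 * C + 2 * C" using part[of Re] part[of Im] by (intro add_mono) auto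
  finally show ?thesis by (simp add: Pf_def K_def)
qed

text \<open>For \<sigma> = 0 the block coefficients stay above c0, so lacunary sums with all
  coefficients 1 are bounded by 1 while their circle means grow at least like sqrt N. The duality
  lemma caps these means by 4 C' if indicators are uniformly bounded; 16 is this 4 times the 4 from
  the Riesz product.\<close>

lemma no_uniform_indicator_bound:
  assumes c: "0 < c" and \<sigma>: "2 - c + b = 0"
    and C: "\<And>E. E \<in> sets dA \<Longrightarrow> weak_L1_norm (op_apply (T_op (-1) b c) (indicator E)) \<le> ennreal C"
  shows False
proof -
  define C' where "C' = max C 0"
  have C': "0 \<le> C'" "\<And>E. E \<in> sets dA \<Longrightarrow> weak_L1_norm (op_apply (T_op (-1) b c) (indicator E)) \<le> ennreal C'"
    using order_trans[OF C ennreal_leI[of C C']] by (auto simp: C'_def)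
  obtain c0 where c0: "0 < c0" "\<And>k. c0 * gap k powr (2 - c + b) \<le> block_coeff b c k"
    using block_coeff_lower[OF c] by blast
  have block_coeff: "c0 \<le> block_coeff b c k" for k using c0(2)[of k] \<sigma> by simp
  have "c0 * real N powr 1 \<le> (16 * C') * real N powr (1 / 2)" if N: "0 < N" for N
  proof -
    let ?f = "lacunary (\<lambda>_. 1) N"
    have f1: "cmod (?f w) \<le> 1" for w
    proof (cases "\<exists>k<N. w \<in> annulus k")
      case True
      then show ?thesis by (auto simp: lacunary_in_annulus cmod_block)
    next
      case False
      then have "?f w = 0" by (auto simp: lacunary_def block_def indicator_def intro!: sum.neutral)
      then show ?thesis by simp
    qed
    have "c0 * real N = (\<Sum>k<N. c0)" by simp
    also have "\<dots> \<le> (\<Sum>k<N. 1 * block_coeff b c k)" using block_coeff by (intro sum_mono) simp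
    also have "\<dots> \<le> 4 * sqrt N * (\<integral>v. cmod (\<integral>w. kernel (T_op (-1) b c) (sgn v) w * ?f w \<partial>dA) \<partial>dA)"
      by (rule circle_lacunary_lower[OF c N]) simp
    also have "\<dots> \<le> 4 * sqrt N * (4 * C')"
    proof (intro mult_left_mono circle_L1_le_indicators[OF c _ f1 _ _ C'])
      show "0 < gap N" by simp
    qed (auto intro: lacunary_bounds(3))
    finally show ?thesis using N by (simp add: powr_half_sqrt mult_ac)
  qed
  from powr_growth_contradiction[OF c0(1) _ this] show False by simp
qed

lemma Lp_norm_indicator_le:
  assumes p: "1 \<le> p" and E: "E \<in> sets dA"
  shows "Lp_norm p (indicator E) \<le> 1"
proof (cases p)
  case (real r)
  have "Lp_norm (ereal r) (indicator E) \<le> ennreal (1 powr (1 / r))"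
  proof (rule Lp_norm_leI)
    have "(\<integral>\<^sup>+z. ennreal (cmod (indicator E z) powr r) \<partial>dA) \<le> (\<integral>\<^sup>+z. 1 \<partial>dA)"
      by (intro nn_integral_mono) (auto simp: indicator_def)
    also have "\<dots> = ennreal 1" using dA.emeasure_space_1 by simp
    finally show "(\<integral>\<^sup>+z. ennreal (cmod (indicator E z) powr r) \<partial>dA) \<le> ennreal 1" .
  qed (use p real in \<open>auto simp: one_ereal_def\<close>)
  then show ?thesis using real by simp
next
  case PInf
  have "esssup dA (\<lambda>z. ennreal (cmod (indicator E z :: complex))) \<le> 1"
    using E by (intro esssup_I) (auto simp: indicator_def)
  then show ?thesis using PInf by (simp add: Lp_norm_def)
qed (use p in auto)

lemma Lorentz_p1_norm_indicator_le:
  assumes p: "1 \<le> p" and E: "E \<in> sets dA"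
  shows "Lorentz_p1_norm p (indicator E) \<le> ennreal p"
proof -
  have "Lorentz_p1_norm p (indicator E) \<le> ennreal (p * measure dA E powr (1 / p))"
    using p E by (intro Lorentz_p1_norm_le) (auto simp: indicator_def)
  also have "\<dots> \<le> ennreal (p * 1)"
    using p by (intro ennreal_leI mult_left_mono powr_le1) auto
  finally show ?thesis by simp
qed

text \<open>Any source norm that depends only on |f| and is bounded on indicators is excluded, which
  treats all Lebesgue and Lorentz exponents together.\<close>

lemma not_maps_boundedly_critical:
  assumes c: "0 < c" and \<sigma>: "2 - c + b = 0" and Op: "Op = T_op (-1) b c \<or> Op = S_op (-1) b c"
    and N: "\<And>f. N (\<lambda>z. of_real (cmod (f z))) = N f" "\<And>E. E \<in> sets dA \<Longrightarrow> N (indicator E) \<le> ennreal D"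
  shows "\<not> maps_boundedly Op N weak_L1_norm"
proof
  assume "maps_boundedly Op N weak_L1_norm"
  then obtain C where C: "0 \<le> C" "\<And>f. f \<in> borel_measurable dA \<Longrightarrow> N f < \<infinity> \<Longrightarrow>
      weak_L1_norm (op_apply (T_op (-1) b c) f) \<le> ennreal C * N f"
    using maps_boundedly_imp_T_bound[where N = N, OF Op _ N(1)] by blast
  show False
  proof (rule no_uniform_indicator_bound[OF c \<sigma>])
    fix E assume E: "E \<in> sets dA"
    have "weak_L1_norm (op_apply (T_op (-1) b c) (indicator E)) \<le> ennreal C * N (indicator E)"
      using E by (intro C(2) le_less_trans[OF N(2)]) auto
    also have "\<dots> \<le> ennreal C * ennreal D" using N(2)[OF E] by (rule mult_left_mono) simp
    also have "\<dots> = ennreal (C * D)" using C(1) by (simp add: ennreal_mult')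
    finally show "weak_L1_norm (op_apply (T_op (-1) b c) (indicator E)) \<le> ennreal (C * D)" .
  qed
qed

lemma not_weak_type_critical:
  assumes c: "0 < c" and \<sigma>: "2 - c + b = 0" and Op: "Op = T_op (-1) b c \<or> Op = S_op (-1) b c" and p: "1 \<le> p"
  shows "\<not> weak_type_p1 Op p"
  unfolding weak_type_p1_def
proof (rule not_maps_boundedly_critical[where N = "Lp_norm p", OF c \<sigma> Op Lp_norm_cmod])
  show "Lp_norm p (indicator E) \<le> ennreal 1" if "E \<in> sets dA" for E
    using Lp_norm_indicator_le[OF p that] by simp
qed

lemma not_restricted_weak_type_critical:
  assumes c: "0 < c" and \<sigma>: "2 - c + b = 0" and Op: "Op = T_op (-1) b c \<or> Op = S_op (-1) b c" and p: "1 \<le> p"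
  shows "\<not> restricted_weak_type_p1 Op p"
proof (cases "p = \<infinity>")
  case True
  show ?thesis
  proof
    assume "restricted_weak_type_p1 Op p"
    then obtain C where C: "\<And>E. E \<in> sets dA \<Longrightarrow> weak_L1_norm (op_apply Op (indicator E)) \<le> ennreal C"
      using True unfolding restricted_weak_type_p1_def by auto
    show False
    proof (rule no_uniform_indicator_bound[OF c \<sigma>])
      fix E assume E: "E \<in> sets dA"
      have i: "(\<lambda>z. complex_of_real (cmod (indicator E z))) = indicator E"
        by (auto simp: indicator_def)
      have "weak_L1_norm (op_apply (T_op (-1) b c) (indicator E)) \<le> weak_L1_norm (op_apply (S_op (-1) b c) (indicator E))"
        using weak_L1_norm_T_le_S[of "indicator E" "-1" b c] E unfolding i by simp
      then show "weak_L1_norm (op_apply (T_op (-1) b c) (indicator E)) \<le> ennreal C"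
        using Op C[OF E] by (auto intro: order_trans)
    qed
  qed
next
  case False
  then obtain r where r: "p = ereal r" "1 \<le> r" using p by (cases p) (auto simp: one_ereal_def)
  have "\<not> maps_boundedly Op (Lorentz_p1_norm r) weak_L1_norm"
    by (rule not_maps_boundedly_critical[where N = "Lorentz_p1_norm r", OF c \<sigma> Op Lorentz_p1_norm_cmod Lorentz_p1_norm_indicator_le[OF r(2)]])
  then show ?thesis using r by (simp add: restricted_weak_type_p1_def)
qed

theorem theorem12p2:
  fixes a b c :: real
  assumes "a = -1" and "b > -1" and "0 \<le> 2 - c + b" and "2 - c + b < 1" and "c > 1"
  shows
    "(2 - c + b = 0 \<longrightarrow>
        (\<forall>p::ereal. 1 \<le> p \<longrightarrow>
           \<not> weak_type_p1 (T_op a b c) p \<and> \<not> restricted_weak_type_p1 (T_op a b c) p \<and>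
           \<not> weak_type_p1 (S_op a b c) p \<and> \<not> restricted_weak_type_p1 (S_op a b c) p))
     \<and>
     (0 < 2 - c + b \<and> 2 - c + b < 1 / 2 \<longrightarrow>
        ((\<forall>p::ereal. 1 \<le> p \<and> 0 \<le> 1 / p \<and> 1 / p < ereal (2 - c + b) \<longrightarrow>
            maps_boundedly (T_op a b c) (Lp_norm p) weak_L1_norm \<and>
            maps_boundedly (S_op a b c) (Lp_norm p) weak_L1_norm) \<and>
         \<not> maps_boundedly (T_op a b c) (Lp_norm (ereal (1 / (2 - c + b)))) weak_L1_norm \<and>
         \<not> maps_boundedly (S_op a b c) (Lp_norm (ereal (1 / (2 - c + b)))) weak_L1_norm)
        \<and>
        (maps_boundedly (T_op a b c) (Lorentz_p1_norm (1 / (2 - c + b))) weak_L1_norm \<and>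
         maps_boundedly (S_op a b c) (Lorentz_p1_norm (1 / (2 - c + b))) weak_L1_norm \<and>
         (\<forall>p::real. 1 \<le> p \<and> 2 - c + b < 1 / p \<and> 1 / p \<le> 1 \<longrightarrow>
            \<not> maps_boundedly (T_op a b c) (Lorentz_p1_norm p) weak_L1_norm \<and>
            \<not> maps_boundedly (S_op a b c) (Lorentz_p1_norm p) weak_L1_norm)))
     \<and>
     (1 / 2 \<le> 2 - c + b \<and> 2 - c + b < 1 \<longrightarrow>
        (\<forall>p::ereal. 1 \<le> p \<and> 0 \<le> 1 / p \<and> 1 / p < ereal (2 - c + b) \<longrightarrow>
            maps_boundedly (T_op a b c) (Lp_norm p) weak_L1_norm \<and>
            maps_boundedly (S_op a b c) (Lp_norm p) weak_L1_norm)
        \<and>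
        (maps_boundedly (T_op a b c) (Lp_norm (ereal (1 / (2 - c + b)))) weak_L1_norm \<and>
         \<not> maps_boundedly (S_op a b c) (Lp_norm (ereal (1 / (2 - c + b)))) weak_L1_norm)
        \<and>
        (maps_boundedly (T_op a b c) (Lorentz_p1_norm (1 / (2 - c + b))) weak_L1_norm \<and>
         maps_boundedly (S_op a b c) (Lorentz_p1_norm (1 / (2 - c + b))) weak_L1_norm \<and>
         (\<forall>p::real. 1 \<le> p \<and> 2 - c + b < 1 / p \<and> 1 / p \<le> 1 \<longrightarrow>
            \<not> maps_boundedly (T_op a b c) (Lorentz_p1_norm p) weak_L1_norm \<and>
            \<not> maps_boundedly (S_op a b c) (Lorentz_p1_norm p) weak_L1_norm)))"
proof -
  let ?s = "2 - c + b"
  have a: "a = -1" and c: "0 < c" "1 < c" and s: "0 \<le> ?s" "?s < 1" using assms by auto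
  have ops: "T_op a b c = T_op (-1) b c \<or> T_op a b c = S_op (-1) b c"
    "S_op a b c = T_op (-1) b c \<or> S_op a b c = S_op (-1) b c"
    using a by auto
  have critical: "\<not> weak_type_p1 Op p \<and> \<not> restricted_weak_type_p1 Op p"
    if "Op = T_op (-1) b c \<or> Op = S_op (-1) b c" "?s = 0" "1 \<le> p" for Op p
    using not_weak_type_critical not_restricted_weak_type_critical c(1) that by blast
  have Lp: "maps_boundedly Op (Lp_norm p) weak_L1_norm"
    if "Op = T_op (-1) b c \<or> Op = S_op (-1) b c" "1 \<le> p" "1 / p < ereal ?s" "0 < ?s" for Op p
    by (rule maps_boundedly_Lp[OF c(2) s(2) that])
  have Lorentz: "maps_boundedly Op (Lorentz_p1_norm (1 / ?s)) weak_L1_norm"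
    if "Op = T_op (-1) b c \<or> Op = S_op (-1) b c" "0 < ?s" for Op
    by (rule maps_boundedly_Lorentz[OF c(2) that(2) s(2) that(1)])
  have Lorentz_neg: "\<not> maps_boundedly Op (Lorentz_p1_norm p) weak_L1_norm"
    if "Op = T_op (-1) b c \<or> Op = S_op (-1) b c" "1 \<le> p" "?s < 1 / p" for Op p
    by (rule not_maps_boundedly_Lorentz[OF c(1) that])
  have small: "\<not> maps_boundedly Op (Lp_norm (ereal (1 / ?s))) weak_L1_norm"
    if "Op = T_op (-1) b c \<or> Op = S_op (-1) b c" "0 < ?s" "?s < 1 / 2" for Op
    by (rule not_maps_boundedly_Lp_endpoint[OF c(1) that])
  have large: "maps_boundedly (T_op a b c) (Lp_norm (ereal (1 / ?s))) weak_L1_norm" if "1 / 2 \<le> ?s"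
    unfolding a by (rule maps_boundedly_T_endpoint[OF c(2) that s(2)])
  have large_neg: "\<not> maps_boundedly (S_op a b c) (Lp_norm (ereal (1 / ?s))) weak_L1_norm" if "0 < ?s"
    unfolding a by (rule not_maps_boundedly_S_endpoint[OF c(1) that s(2)])
  have pos: "0 < ?s" if "1 / 2 \<le> ?s" using that by linarith
  show ?thesis
    using critical[OF ops(1)] critical[OF ops(2)] Lp[OF ops(1)] Lp[OF ops(2)] Lorentz[OF ops(1)] Lorentz[OF ops(2)]
      Lorentz_neg[OF ops(1)] Lorentz_neg[OF ops(2)] small[OF ops(1)] small[OF ops(2)] large large_neg pos
    by (intro conjI impI allI) blast+
qed

end
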